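(* The category $\mathbf{Flex}$ of flexible $2$-categories and morphisms of flexible $2$-categories is cartesian closed.
   Context: A morphism $f$ in a category is atomic if it is not an identity and if, whenever $f=h\circ g$, either $g$ or $h$ is an identity. A category is free if each of its morphisms $f$ can be uniquely expressed as a composite of atomic morphisms $f=f_n\circ\cdots\circ f_1$ ($n\ge 0$). A functor between free categories is a morphism of free categories if it sends each atomic morphism to an atomic morphism or an identity morphism. A (strict, small) $2$-category is flexible if its underlying category is free; a $2$-functor between flexible $2$-categories is a morphism of flexible $2$-categories if its underlying functor is a morphism of free categories. $\mathbf{Flex}$ is the category of flexible $2$-categories and their morphisms, a non-full subcategory of the category of $2$-categories and $2$-functors. Products are the categorical products of $\mathbf{Flex}$, which differ from those of $2$-categories. *)

theory Defs
  imports "HOL-Library.FuncSet" "HOL-Library.Equipollence"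
begin

text \<open>
  Only the values of the operations on the carriers are meaningful; \<open>Comp C g f\<close> is
  the composite ``first \<open>f\<close>, then \<open>g\<close>''.
\<close>

record ('o, 'm) category =
  Obj :: "'o set"
  Mor :: "'m set"
  Dom :: "'m \<Rightarrow> 'o"
  Cod :: "'m \<Rightarrow> 'o"
  Idn :: "'o \<Rightarrow> 'm"
  Comp :: "'m \<Rightarrow> 'm \<Rightarrow> 'm"

definition Hom :: "('o, 'm, 'z) category_scheme \<Rightarrow> 'o \<Rightarrow> 'o \<Rightarrow> 'm set" where
  "Hom C x y = {f \<in> Mor C. Dom C f = x \<and> Cod C f = y}"

definition is_category :: "('o, 'm, 'z) category_scheme \<Rightarrow> bool" where
  "is_category C \<longleftrightarrow>
     (\<forall>f \<in> Mor C. Dom C f \<in> Obj C \<and> Cod C f \<in> Obj C) \<and>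
     (\<forall>x \<in> Obj C. Idn C x \<in> Hom C x x) \<and>
     (\<forall>f \<in> Mor C. \<forall>g \<in> Mor C. Dom C g = Cod C f \<longrightarrow>
        Comp C g f \<in> Hom C (Dom C f) (Cod C g)) \<and>
     (\<forall>f \<in> Mor C. Comp C f (Idn C (Dom C f)) = f \<and> Comp C (Idn C (Cod C f)) f = f) \<and>
     (\<forall>f \<in> Mor C. \<forall>g \<in> Mor C. \<forall>h \<in> Mor C. Dom C g = Cod C f \<longrightarrow> Dom C h = Cod C g \<longrightarrow>
        Comp C h (Comp C g f) = Comp C (Comp C h g) f)"

definition is_functor ::
  "('o, 'm, 'y) category_scheme \<Rightarrow> ('p, 'n, 'z) category_scheme \<Rightarrow> ('o \<Rightarrow> 'p) \<Rightarrow> ('m \<Rightarrow> 'n) \<Rightarrow> bool"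
where
  "is_functor C D F0 F1 \<longleftrightarrow>
     F0 \<in> Obj C \<rightarrow> Obj D \<and>
     (\<forall>f \<in> Mor C. F1 f \<in> Hom D (F0 (Dom C f)) (F0 (Cod C f))) \<and>
     (\<forall>x \<in> Obj C. F1 (Idn C x) = Idn D (F0 x)) \<and>
     (\<forall>f \<in> Mor C. \<forall>g \<in> Mor C. Dom C g = Cod C f \<longrightarrow>
        F1 (Comp C g f) = Comp D (F1 g) (F1 f))"

definition is_terminal :: "('o, 'm, 'z) category_scheme \<Rightarrow> 'o \<Rightarrow> bool" where
  "is_terminal C t \<longleftrightarrow> t \<in> Obj C \<and> (\<forall>a \<in> Obj C. \<exists>!f. f \<in> Hom C a t)"

definition is_product ::
  "('o, 'm, 'z) category_scheme \<Rightarrow> 'o \<Rightarrow> 'o \<Rightarrow> 'o \<Rightarrow> 'm \<Rightarrow> 'm \<Rightarrow> bool"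
where
  "is_product C a b p \<pi>1 \<pi>2 \<longleftrightarrow>
     p \<in> Obj C \<and> \<pi>1 \<in> Hom C p a \<and> \<pi>2 \<in> Hom C p b \<and>
     (\<forall>z \<in> Obj C. \<forall>f \<in> Hom C z a. \<forall>g \<in> Hom C z b.
        \<exists>!h. h \<in> Hom C z p \<and> Comp C \<pi>1 h = f \<and> Comp C \<pi>2 h = g)"

text \<open>
  \<open>e\<close> is an exponential \<open>b\<^sup>a\<close>, with evaluation \<open>ev : e \<times> a \<rightarrow> b\<close>, where \<open>e \<times> a\<close> is
  the product \<open>(p, \<pi>1, \<pi>2)\<close>. In the universal property \<open>k\<close> is the morphism
  \<open>h \<times> a : z \<times> a \<rightarrow> e \<times> a\<close>.
\<close>

definition is_exponential ::
  "('o, 'm, 'z) category_scheme \<Rightarrow> 'o \<Rightarrow> 'o \<Rightarrow> 'o \<Rightarrow> 'o \<Rightarrow> 'm \<Rightarrow> 'm \<Rightarrow> 'm \<Rightarrow> bool"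
where
  "is_exponential C a b e p \<pi>1 \<pi>2 ev \<longleftrightarrow>
     e \<in> Obj C \<and> is_product C e a p \<pi>1 \<pi>2 \<and> ev \<in> Hom C p b \<and>
     (\<forall>z \<in> Obj C. \<forall>q \<rho>1 \<rho>2. is_product C z a q \<rho>1 \<rho>2 \<longrightarrow>
        (\<forall>f \<in> Hom C q b. \<exists>!h. h \<in> Hom C z e \<and>
           (\<exists>k \<in> Hom C q p. Comp C \<pi>1 k = Comp C h \<rho>1 \<and> Comp C \<pi>2 k = \<rho>2 \<and> Comp C ev k = f)))"

definition cartesian_closed :: "('o, 'm, 'z) category_scheme \<Rightarrow> bool" where
  "cartesian_closed C \<longleftrightarrow>
     is_category C \<and>
     (\<exists>t. is_terminal C t) \<and>
     (\<forall>a \<in> Obj C. \<forall>b \<in> Obj C. \<exists>p \<pi>1 \<pi>2. is_product C a b p \<pi>1 \<pi>2) \<and>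
     (\<forall>a \<in> Obj C. \<forall>b \<in> Obj C. \<exists>e p \<pi>1 \<pi>2 ev. is_exponential C a b e p \<pi>1 \<pi>2 ev)"

definition is_identity :: "('o, 'm, 'z) category_scheme \<Rightarrow> 'm \<Rightarrow> bool" where
  "is_identity C f \<longleftrightarrow> (\<exists>x \<in> Obj C. f = Idn C x)"

definition atomic :: "('o, 'm, 'z) category_scheme \<Rightarrow> 'm \<Rightarrow> bool" where
  "atomic C f \<longleftrightarrow> f \<in> Mor C \<and> \<not> is_identity C f \<and>
     (\<forall>g \<in> Mor C. \<forall>h \<in> Mor C. Dom C h = Cod C g \<longrightarrow> f = Comp C h g \<longrightarrow>
        is_identity C g \<or> is_identity C h)"

text \<open>
  \<open>composes_to C [f\<^sub>1, \<dots>, f\<^sub>n] f\<close>: the morphisms form a composable string, written in order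
  of application, with composite \<open>f = f\<^sub>n \<circ> \<dots> \<circ> f\<^sub>1\<close>. The empty string at an object
  \<open>x\<close> has composite the identity of \<open>x\<close>.
\<close>

inductive composes_to :: "('o, 'm, 'z) category_scheme \<Rightarrow> 'm list \<Rightarrow> 'm \<Rightarrow> bool"
  for C where
  Nil: "x \<in> Obj C \<Longrightarrow> composes_to C [] (Idn C x)"
| Cons: "f \<in> Mor C \<Longrightarrow> composes_to C fs g \<Longrightarrow> Dom C g = Cod C f \<Longrightarrow>
    composes_to C (f # fs) (Comp C g f)"

definition free_category :: "('o, 'm, 'z) category_scheme \<Rightarrow> bool" where
  "free_category C \<longleftrightarrow> is_category C \<and>
     (\<forall>f \<in> Mor C. \<exists>!fs. (\<forall>a \<in> set fs. atomic C a) \<and> composes_to C fs f)"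

definition free_category_morphism ::
  "('o, 'm, 'y) category_scheme \<Rightarrow> ('p, 'n, 'z) category_scheme \<Rightarrow> ('o \<Rightarrow> 'p) \<Rightarrow> ('m \<Rightarrow> 'n) \<Rightarrow> bool"
where
  "free_category_morphism C D F0 F1 \<longleftrightarrow> is_functor C D F0 F1 \<and>
     (\<forall>f. atomic C f \<longrightarrow> atomic D (F1 f) \<or> is_identity D (F1 f))"

text \<open>
  A 2-category extends the record of its underlying category, so every notion for categories
  applied to a 2-category refers to its underlying category.
\<close>

record ('o, 'm, 'c) two_category = "('o, 'm) category" +
  Cell :: "'c set"
  Src :: "'c \<Rightarrow> 'm"
  Tgt :: "'c \<Rightarrow> 'm"
  CellId :: "'m \<Rightarrow> 'c"
  VComp :: "'c \<Rightarrow> 'c \<Rightarrow> 'c"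
  HComp :: "'c \<Rightarrow> 'c \<Rightarrow> 'c"

text \<open>
  The category of 1-cells and 2-cells under vertical composition, and the category of 0-cells
  and 2-cells under horizontal composition.
\<close>

definition vertical :: "('o, 'm, 'c, 'z) two_category_scheme \<Rightarrow> ('m, 'c) category" where
  "vertical X = \<lparr>Obj = Mor X, Mor = Cell X, Dom = Src X, Cod = Tgt X,
     Idn = CellId X, Comp = VComp X\<rparr>"

definition horizontal :: "('o, 'm, 'c, 'z) two_category_scheme \<Rightarrow> ('o, 'c) category" where
  "horizontal X = \<lparr>Obj = Obj X, Mor = Cell X, Dom = (\<lambda>\<alpha>. Dom X (Src X \<alpha>)),
     Cod = (\<lambda>\<alpha>. Cod X (Src X \<alpha>)), Idn = (\<lambda>x. CellId X (Idn X x)), Comp = HComp X\<rparr>"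

definition is_two_category :: "('o, 'm, 'c, 'z) two_category_scheme \<Rightarrow> bool" where
  "is_two_category X \<longleftrightarrow>
     is_category X \<and> is_category (vertical X) \<and> is_category (horizontal X) \<and>
     (\<forall>\<alpha> \<in> Cell X. Dom X (Src X \<alpha>) = Dom X (Tgt X \<alpha>) \<and> Cod X (Src X \<alpha>) = Cod X (Tgt X \<alpha>)) \<and>
     (\<forall>\<alpha> \<in> Cell X. \<forall>\<beta> \<in> Cell X. Dom X (Src X \<beta>) = Cod X (Src X \<alpha>) \<longrightarrow>
        Src X (HComp X \<beta> \<alpha>) = Comp X (Src X \<beta>) (Src X \<alpha>) \<and>
        Tgt X (HComp X \<beta> \<alpha>) = Comp X (Tgt X \<beta>) (Tgt X \<alpha>)) \<and>
     (\<forall>f \<in> Mor X. \<forall>g \<in> Mor X. Dom X g = Cod X f \<longrightarrow>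
        HComp X (CellId X g) (CellId X f) = CellId X (Comp X g f)) \<and>
     (\<forall>\<alpha> \<in> Cell X. \<forall>\<alpha>' \<in> Cell X. \<forall>\<beta> \<in> Cell X. \<forall>\<beta>' \<in> Cell X.
        Src X \<alpha>' = Tgt X \<alpha> \<longrightarrow> Src X \<beta>' = Tgt X \<beta> \<longrightarrow> Dom X (Src X \<beta>) = Cod X (Src X \<alpha>) \<longrightarrow>
        HComp X (VComp X \<beta>' \<beta>) (VComp X \<alpha>' \<alpha>) = VComp X (HComp X \<beta>' \<alpha>') (HComp X \<beta> \<alpha>))"

definition is_two_functor ::
  "('o, 'm, 'c, 'y) two_category_scheme \<Rightarrow> ('p, 'n, 'd, 'z) two_category_scheme \<Rightarrow>
   ('o \<Rightarrow> 'p) \<Rightarrow> ('m \<Rightarrow> 'n) \<Rightarrow> ('c \<Rightarrow> 'd) \<Rightarrow> bool"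
where
  "is_two_functor X Y F0 F1 F2 \<longleftrightarrow>
     is_functor X Y F0 F1 \<and>
     is_functor (vertical X) (vertical Y) F1 F2 \<and>
     is_functor (horizontal X) (horizontal Y) F0 F2"

definition flexible :: "('o, 'm, 'c, 'z) two_category_scheme \<Rightarrow> bool" where
  "flexible X \<longleftrightarrow> is_two_category X \<and> free_category X"

definition flexible_morphism ::
  "('o, 'm, 'c, 'y) two_category_scheme \<Rightarrow> ('p, 'n, 'd, 'z) two_category_scheme \<Rightarrow>
   ('o \<Rightarrow> 'p) \<Rightarrow> ('m \<Rightarrow> 'n) \<Rightarrow> ('c \<Rightarrow> 'd) \<Rightarrow> bool"
where
  "flexible_morphism X Y F0 F1 F2 \<longleftrightarrow>
     is_two_functor X Y F0 F1 F2 \<and> free_category_morphism X Y F0 F1"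

text \<open>
  The type \<open>'u\<close> plays the role of the universe: a set of its elements is small if its cardinality
  is strictly less than that of \<open>'u\<close>.
\<close>

definition small :: "'u set \<Rightarrow> bool" where
  "small A \<longleftrightarrow> A \<prec> (UNIV :: 'u set)"

definition small_two_category :: "('u, 'u, 'u, 'z) two_category_scheme \<Rightarrow> bool" where
  "small_two_category X \<longleftrightarrow> small (Obj X) \<and> small (Mor X) \<and> small (Cell X)"

record 'u flex_arrow =
  source :: "('u, 'u, 'u) two_category"
  target :: "('u, 'u, 'u) two_category"
  on_obj :: "'u \<Rightarrow> 'u"
  on_mor :: "'u \<Rightarrow> 'u"
  on_cell :: "'u \<Rightarrow> 'u"

text \<open>
  The component functions of an arrow are extensional (undefined outside the carriers of
  the source), so that arrows are equal iff they are equal as 2-functors.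
\<close>

definition Flex :: "(('u, 'u, 'u) two_category, 'u flex_arrow) category" where
  "Flex = \<lparr>
     Obj = {X. flexible X \<and> small_two_category X},
     Mor = {F. flexible (source F) \<and> small_two_category (source F) \<and>
               flexible (target F) \<and> small_two_category (target F) \<and>
               flexible_morphism (source F) (target F) (on_obj F) (on_mor F) (on_cell F) \<and>
               on_obj F \<in> extensional (Obj (source F)) \<and>
               on_mor F \<in> extensional (Mor (source F)) \<and>
               on_cell F \<in> extensional (Cell (source F))},
     Dom = source,
     Cod = target,
     Idn = (\<lambda>X. \<lparr>source = X, target = X, on_obj = (\<lambda>x \<in> Obj X. x),
                  on_mor = (\<lambda>f \<in> Mor X. f), on_cell = (\<lambda>\<alpha> \<in> Cell X. \<alpha>)\<rparr>),
     Comp = (\<lambda>G F. \<lparr>source = source F, target = target G,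
                     on_obj = compose (Obj (source F)) (on_obj G) (on_obj F),
                     on_mor = compose (Mor (source F)) (on_mor G) (on_mor F),
                     on_cell = compose (Cell (source F)) (on_cell G) (on_cell F)\<rparr>)\<rparr>"

text \<open>
  For \<open>Flex\<close> over \<open>'u\<close> to contain all the constructions that ``small'' is meant to allow,
  the cardinality of \<open>'u\<close> has to be an uncountable strong limit. Every Grothendieck universe
  (strongly inaccessible cardinality) is an instance; regularity is not required.
\<close>

definition is_universe :: "'u itself \<Rightarrow> bool" where
  "is_universe _ \<longleftrightarrow> uncountable (UNIV :: 'u set) \<and>
     (\<forall>A :: 'u set. small A \<longrightarrow> Pow A \<prec> (UNIV :: 'u set))"

end

theory Submission
  imports Defs
begin

text \<open>
  Call a 1-cell of a flexible 2-category an edge if it is atomic or an identity; the edges form a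
  reflexive graph which freely generates the 1-cells. Given a 2-category \<open>K\<close> and a reflexive graph
  mapping to its 1-cells, the paths of nondegenerate edges, with the 2-cells of \<open>K\<close> between their
  composites, form a flexible 2-category, and morphisms into it from a flexible \<open>Z\<close> are
  2-functors \<open>Z \<rightarrow> K\<close> with a lift to the graph on edges. The product in \<open>Flex\<close> is the case where \<open>K\<close>
  is the product of 2-categories and the graph consists of the pairs of edges. The exponential
  \<open>Y\<^sup>X\<close> is the case where \<open>K\<close> consists of the morphisms \<open>X \<rightarrow> Y\<close>, pseudonatural transformations and
  modifications, and the graph is that of the morphisms \<open>I \<times> X \<rightarrow> Y\<close>, with \<open>I\<close> the free category on
  one arrow. Pseudonaturality appears because the 1-cells \<open>(\<epsilon>, 1) \<circ> (1, g)\<close> and \<open>(1, g) \<circ> (\<epsilon>, 1)\<close> of a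
  product are distinct but isomorphic. Evaluation is the strictification of the pseudofunctor
  \<open>(t, g) \<mapsto> t y \<circ> F g\<close>, for \<open>t : F \<rightarrow> G\<close> and \<open>g : x \<rightarrow> y\<close>.
\<close>

section \<open>Categories, 2-categories and their morphisms\<close>

text \<open>The shape of the exponential is forced by the requirement that edges go to edges. The
  1-cell \<open>t y \<circ> F e\<close> is in general not an edge of \<open>Y\<close>, so it cannot
  be the value of evaluation on an edge \<open>(\<epsilon>, e)\<close>; an edge isomorphic to it has
  to be stored in the exponential. That this can be made strict is due to freeness: every edge of
  the product may receive its own value, and comparison cells along a path absorb the failure of
  \<open>t y \<circ> F g\<close> to be functorial.

  Currying rests on a presentation of the cells of a product: they are determined by the cells of
  the two factors and two families of invertible cells, and on these evaluation returns the very
  components of which transformations, edges and modifications consist.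

  Paths and transformations live in types other than the universe and are replaced by isomorphic
  copies. Function spaces embed into power sets, hence the strong limit; even a finite graph may
  have infinitely many paths, hence the uncountability.\<close>

locale cat =
  fixes C :: "('o, 'm, 'z) category_scheme"
  assumes is_category: "is_category C"
begin

lemma Dom_Obj [simp]: "f \<in> Mor C \<Longrightarrow> Dom C f \<in> Obj C"
  and Cod_Obj [simp]: "f \<in> Mor C \<Longrightarrow> Cod C f \<in> Obj C"
  and Idn_Mor [simp]: "x \<in> Obj C \<Longrightarrow> Idn C x \<in> Mor C"
  and Dom_Idn [simp]: "x \<in> Obj C \<Longrightarrow> Dom C (Idn C x) = x"
  and Cod_Idn [simp]: "x \<in> Obj C \<Longrightarrow> Cod C (Idn C x) = x"
  and Comp_Mor [simp]: "f \<in> Mor C \<Longrightarrow> g \<in> Mor C \<Longrightarrow> Dom C g = Cod C f \<Longrightarrow> Comp C g f \<in> Mor C"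
  and Dom_Comp [simp]: "f \<in> Mor C \<Longrightarrow> g \<in> Mor C \<Longrightarrow> Dom C g = Cod C f \<Longrightarrow> Dom C (Comp C g f) = Dom C f"
  and Cod_Comp [simp]: "f \<in> Mor C \<Longrightarrow> g \<in> Mor C \<Longrightarrow> Dom C g = Cod C f \<Longrightarrow> Cod C (Comp C g f) = Cod C g"
  and Comp_Idn_right [simp]: "f \<in> Mor C \<Longrightarrow> Dom C f = x \<Longrightarrow> Comp C f (Idn C x) = f"
  and Comp_Idn_left [simp]: "f \<in> Mor C \<Longrightarrow> Cod C f = x \<Longrightarrow> Comp C (Idn C x) f = f"
  and Comp_assoc [simp]: "f \<in> Mor C \<Longrightarrow> g \<in> Mor C \<Longrightarrow> h \<in> Mor C \<Longrightarrow> Dom C g = Cod C f \<Longrightarrow>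
    Dom C h = Cod C g \<Longrightarrow> Comp C (Comp C h g) f = Comp C h (Comp C g f)"
  using is_category by (auto simp: is_category_def Hom_def)

end

locale two_cat = cat X for X :: "('o, 'm, 'c, 'z) two_category_scheme" +
  assumes is_two_category: "is_two_category X"
begin

lemma vertical: "is_category (vertical X)" and horizontal: "is_category (horizontal X)"
  using is_two_category by (auto simp: is_two_category_def)

sublocale V: cat "vertical X" using vertical by unfold_locales
sublocale H: cat "horizontal X" using horizontal by unfold_locales

text \<open>The laws of both category structures on cells, expressed through the fields of
  \<open>X\<close>. Horizontal domains and codomains are absent because they follow from the
  boundary 1-cells by \<open>Src_HComp\<close>. In the joint list, \<open>cell_simps(11)\<close> is
  vertical and \<open>cell_simps(15)\<close> horizontal associativity.\<close>

lemmas vertical_laws = V.Dom_Obj V.Cod_Obj V.Idn_Mor V.Dom_Idn V.Cod_Idn V.Comp_Mor V.Dom_Comp V.Cod_Comp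
  V.Comp_Idn_right V.Comp_Idn_left V.Comp_assoc
lemmas horizontal_laws = H.Comp_Mor H.Comp_Idn_right H.Comp_Idn_left H.Comp_assoc
lemmas cell_simps [simp] = vertical_laws[unfolded vertical_def, simplified]
  horizontal_laws[unfolded horizontal_def, simplified]

lemma Dom_Tgt [simp]: "\<alpha> \<in> Cell X \<Longrightarrow> Dom X (Tgt X \<alpha>) = Dom X (Src X \<alpha>)"
  and Cod_Tgt [simp]: "\<alpha> \<in> Cell X \<Longrightarrow> Cod X (Tgt X \<alpha>) = Cod X (Src X \<alpha>)"
  and Src_HComp [simp]: "\<alpha> \<in> Cell X \<Longrightarrow> \<beta> \<in> Cell X \<Longrightarrow> Dom X (Src X \<beta>) = Cod X (Src X \<alpha>) \<Longrightarrow>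
    Src X (HComp X \<beta> \<alpha>) = Comp X (Src X \<beta>) (Src X \<alpha>)"
  and Tgt_HComp [simp]: "\<alpha> \<in> Cell X \<Longrightarrow> \<beta> \<in> Cell X \<Longrightarrow> Dom X (Src X \<beta>) = Cod X (Src X \<alpha>) \<Longrightarrow>
    Tgt X (HComp X \<beta> \<alpha>) = Comp X (Tgt X \<beta>) (Tgt X \<alpha>)"
  and HComp_CellId [simp]: "f \<in> Mor X \<Longrightarrow> g \<in> Mor X \<Longrightarrow> Dom X g = Cod X f \<Longrightarrow>
    HComp X (CellId X g) (CellId X f) = CellId X (Comp X g f)"
  and interchange: "\<alpha> \<in> Cell X \<Longrightarrow> \<alpha>' \<in> Cell X \<Longrightarrow> \<beta> \<in> Cell X \<Longrightarrow> \<beta>' \<in> Cell X \<Longrightarrow>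
    Src X \<alpha>' = Tgt X \<alpha> \<Longrightarrow> Src X \<beta>' = Tgt X \<beta> \<Longrightarrow> Dom X (Src X \<beta>) = Cod X (Src X \<alpha>) \<Longrightarrow>
    HComp X (VComp X \<beta>' \<beta>) (VComp X \<alpha>' \<alpha>) = VComp X (HComp X \<beta>' \<alpha>') (HComp X \<beta> \<alpha>)"
  using is_two_category by (simp_all add: is_two_category_def)

lemma whisker_left: "\<alpha> \<in> Cell X \<Longrightarrow> \<alpha>' \<in> Cell X \<Longrightarrow> g \<in> Mor X \<Longrightarrow>
    Src X \<alpha>' = Tgt X \<alpha> \<Longrightarrow> Dom X g = Cod X (Src X \<alpha>) \<Longrightarrow>
    HComp X (CellId X g) (VComp X \<alpha>' \<alpha>) = VComp X (HComp X (CellId X g) \<alpha>') (HComp X (CellId X g) \<alpha>)"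
  using interchange[of \<alpha> \<alpha>' "CellId X g" "CellId X g"] by simp

lemma whisker_right: "\<beta> \<in> Cell X \<Longrightarrow> \<beta>' \<in> Cell X \<Longrightarrow> f \<in> Mor X \<Longrightarrow>
    Src X \<beta>' = Tgt X \<beta> \<Longrightarrow> Dom X (Src X \<beta>) = Cod X f \<Longrightarrow>
    HComp X (VComp X \<beta>' \<beta>) (CellId X f) = VComp X (HComp X \<beta>' (CellId X f)) (HComp X \<beta> (CellId X f))"
  using interchange[of "CellId X f" "CellId X f" \<beta> \<beta>'] by simp

text \<open>Interchange against identity cells. Together with its mirror image it lets two cells
  that act in different places slide past each other.\<close>

lemma HComp_left_right: "\<alpha> \<in> Cell X \<Longrightarrow> \<beta> \<in> Cell X \<Longrightarrow> Dom X (Src X \<beta>) = Cod X (Src X \<alpha>) \<Longrightarrow>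
    Tgt X \<beta> = g \<Longrightarrow> Src X \<alpha> = f \<Longrightarrow>
    VComp X (HComp X (CellId X g) \<alpha>) (HComp X \<beta> (CellId X f)) = HComp X \<beta> \<alpha>"
  using interchange[of "CellId X f" \<alpha> \<beta> "CellId X g"] by auto

lemma HComp_right_left: "\<alpha> \<in> Cell X \<Longrightarrow> \<beta> \<in> Cell X \<Longrightarrow> Dom X (Src X \<beta>) = Cod X (Src X \<alpha>) \<Longrightarrow>
    Src X \<beta> = g \<Longrightarrow> Tgt X \<alpha> = f \<Longrightarrow>
    VComp X (HComp X \<beta> (CellId X f)) (HComp X (CellId X g) \<alpha>) = HComp X \<beta> \<alpha>"
  using interchange[of \<alpha> "CellId X f" "CellId X g" \<beta>] by auto

section \<open>Invertible 2-cells\<close>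

definition vertical_inverse :: "'c \<Rightarrow> 'c \<Rightarrow> bool" where
  "vertical_inverse \<alpha> \<beta> \<longleftrightarrow> \<alpha> \<in> Cell X \<and> \<beta> \<in> Cell X \<and> Src X \<beta> = Tgt X \<alpha> \<and> Tgt X \<beta> = Src X \<alpha> \<and>
     VComp X \<beta> \<alpha> = CellId X (Src X \<alpha>) \<and> VComp X \<alpha> \<beta> = CellId X (Tgt X \<alpha>)"

definition invertible :: "'c \<Rightarrow> bool" where
  "invertible \<alpha> \<longleftrightarrow> (\<exists>\<beta>. vertical_inverse \<alpha> \<beta>)"

lemma invertible_Cell [simp]: "invertible \<alpha> \<Longrightarrow> \<alpha> \<in> Cell X"
  by (auto simp: invertible_def vertical_inverse_def)

lemma invertible_CellId [simp]: "f \<in> Mor X \<Longrightarrow> invertible (CellId X f)"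
  unfolding invertible_def vertical_inverse_def by (rule exI[of _ "CellId X f"]) simp

lemma vertical_inverse_VComp:
  assumes "vertical_inverse \<alpha> \<alpha>'" "vertical_inverse \<beta> \<beta>'" "Src X \<beta> = Tgt X \<alpha>"
  shows "vertical_inverse (VComp X \<beta> \<alpha>) (VComp X \<alpha>' \<beta>')"
proof -
  have m: "\<alpha> \<in> Cell X" "\<beta> \<in> Cell X" "\<alpha>' \<in> Cell X" "\<beta>' \<in> Cell X" "Src X \<alpha>' = Tgt X \<alpha>" "Tgt X \<alpha>' = Src X \<alpha>"
    "Src X \<beta>' = Tgt X \<beta>" "Tgt X \<beta>' = Src X \<beta>"
    and e: "VComp X \<alpha>' \<alpha> = CellId X (Src X \<alpha>)" "VComp X \<alpha> \<alpha>' = CellId X (Tgt X \<alpha>)"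
      "VComp X \<beta>' \<beta> = CellId X (Src X \<beta>)" "VComp X \<beta> \<beta>' = CellId X (Tgt X \<beta>)"
    using assms by (auto simp: vertical_inverse_def)
  have "VComp X \<beta>' (VComp X \<beta> \<alpha>) = \<alpha>" "VComp X \<alpha> (VComp X \<alpha>' \<beta>') = \<beta>'"
    using m e assms(3) cell_simps(11)[of \<alpha> \<beta> \<beta>'] cell_simps(11)[of \<beta>' \<alpha>' \<alpha>] by (simp_all del: cell_simps(11) add: cell_simps(1-10))
  then show ?thesis using m e assms(3) by (simp add: vertical_inverse_def)
qed

lemma invertible_VComp [simp]:
  "invertible \<alpha> \<Longrightarrow> invertible \<beta> \<Longrightarrow> Src X \<beta> = Tgt X \<alpha> \<Longrightarrow> invertible (VComp X \<beta> \<alpha>)"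
  unfolding invertible_def using vertical_inverse_VComp by blast

lemma invertible_HComp [simp]:
  assumes "invertible \<alpha>" "invertible \<beta>" "Dom X (Src X \<beta>) = Cod X (Src X \<alpha>)"
  shows "invertible (HComp X \<beta> \<alpha>)"
proof -
  obtain \<alpha>' \<beta>' where a: "vertical_inverse \<alpha> \<alpha>'" "vertical_inverse \<beta> \<beta>'"
    using assms by (auto simp: invertible_def)
  then have "vertical_inverse (HComp X \<beta> \<alpha>) (HComp X \<beta>' \<alpha>')"
    using assms(3) interchange[of \<alpha> \<alpha>' \<beta> \<beta>'] interchange[of \<alpha>' \<alpha> \<beta>' \<beta>]
    by (simp add: vertical_inverse_def)
  then show ?thesis by (auto simp: invertible_def)
qed

text \<open>Composition with an inverse of \<open>\<gamma>\<close>. A commuting square with an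
  invertible side thus determines the opposite part; strictified cells and images of cells of a
  product are both pinned down in this way.\<close>

lemma VComp_cancel_left:
  assumes "VComp X \<gamma> \<alpha> = VComp X \<gamma> \<beta>" "invertible \<gamma>" "\<alpha> \<in> Cell X" "\<beta> \<in> Cell X"
    "Tgt X \<alpha> = Src X \<gamma>" "Tgt X \<beta> = Src X \<gamma>"
  shows "\<alpha> = \<beta>"
proof -
  obtain \<delta> where d: "vertical_inverse \<gamma> \<delta>" using assms by (auto simp: invertible_def)
  have "VComp X (VComp X \<delta> \<gamma>) \<alpha> = VComp X (VComp X \<delta> \<gamma>) \<beta>"
    using assms d cell_simps(11)[of \<alpha> \<gamma> \<delta>] cell_simps(11)[of \<beta> \<gamma> \<delta>] by (simp add: vertical_inverse_def del: cell_simps)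
  then show ?thesis using assms d by (simp add: vertical_inverse_def)
qed

end

lemma two_catI:
  fixes X :: "('o, 'm, 'c, 'z) two_category_scheme"
  assumes "is_category X"
    and "\<And>\<alpha>. \<alpha> \<in> Cell X \<Longrightarrow> Src X \<alpha> \<in> Mor X \<and> Tgt X \<alpha> \<in> Mor X \<and>
      Dom X (Src X \<alpha>) = Dom X (Tgt X \<alpha>) \<and> Cod X (Src X \<alpha>) = Cod X (Tgt X \<alpha>)"
    and "\<And>f. f \<in> Mor X \<Longrightarrow> CellId X f \<in> Cell X \<and> Src X (CellId X f) = f \<and> Tgt X (CellId X f) = f"
    and "\<And>\<alpha> \<beta>. \<alpha> \<in> Cell X \<Longrightarrow> \<beta> \<in> Cell X \<Longrightarrow> Src X \<beta> = Tgt X \<alpha> \<Longrightarrow>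
      VComp X \<beta> \<alpha> \<in> Cell X \<and> Src X (VComp X \<beta> \<alpha>) = Src X \<alpha> \<and> Tgt X (VComp X \<beta> \<alpha>) = Tgt X \<beta>"
    and "\<And>\<alpha>. \<alpha> \<in> Cell X \<Longrightarrow> VComp X \<alpha> (CellId X (Src X \<alpha>)) = \<alpha> \<and> VComp X (CellId X (Tgt X \<alpha>)) \<alpha> = \<alpha>"
    and "\<And>\<alpha> \<beta> \<gamma>. \<alpha> \<in> Cell X \<Longrightarrow> \<beta> \<in> Cell X \<Longrightarrow> \<gamma> \<in> Cell X \<Longrightarrow> Src X \<beta> = Tgt X \<alpha> \<Longrightarrow> Src X \<gamma> = Tgt X \<beta> \<Longrightarrow>
      VComp X \<gamma> (VComp X \<beta> \<alpha>) = VComp X (VComp X \<gamma> \<beta>) \<alpha>"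
    and "\<And>\<alpha> \<beta>. \<alpha> \<in> Cell X \<Longrightarrow> \<beta> \<in> Cell X \<Longrightarrow> Dom X (Src X \<beta>) = Cod X (Src X \<alpha>) \<Longrightarrow>
      HComp X \<beta> \<alpha> \<in> Cell X \<and> Src X (HComp X \<beta> \<alpha>) = Comp X (Src X \<beta>) (Src X \<alpha>) \<and>
      Tgt X (HComp X \<beta> \<alpha>) = Comp X (Tgt X \<beta>) (Tgt X \<alpha>)"
    and "\<And>\<alpha>. \<alpha> \<in> Cell X \<Longrightarrow> HComp X \<alpha> (CellId X (Idn X (Dom X (Src X \<alpha>)))) = \<alpha> \<and>
      HComp X (CellId X (Idn X (Cod X (Src X \<alpha>)))) \<alpha> = \<alpha>"
    and "\<And>\<alpha> \<beta> \<gamma>. \<alpha> \<in> Cell X \<Longrightarrow> \<beta> \<in> Cell X \<Longrightarrow> \<gamma> \<in> Cell X \<Longrightarrow>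
      Dom X (Src X \<beta>) = Cod X (Src X \<alpha>) \<Longrightarrow> Dom X (Src X \<gamma>) = Cod X (Src X \<beta>) \<Longrightarrow>
      HComp X \<gamma> (HComp X \<beta> \<alpha>) = HComp X (HComp X \<gamma> \<beta>) \<alpha>"
    and "\<And>f g. f \<in> Mor X \<Longrightarrow> g \<in> Mor X \<Longrightarrow> Dom X g = Cod X f \<Longrightarrow>
      HComp X (CellId X g) (CellId X f) = CellId X (Comp X g f)"
    and "\<And>\<alpha> \<alpha>' \<beta> \<beta>'. \<alpha> \<in> Cell X \<Longrightarrow> \<alpha>' \<in> Cell X \<Longrightarrow> \<beta> \<in> Cell X \<Longrightarrow> \<beta>' \<in> Cell X \<Longrightarrow>
      Src X \<alpha>' = Tgt X \<alpha> \<Longrightarrow> Src X \<beta>' = Tgt X \<beta> \<Longrightarrow> Dom X (Src X \<beta>) = Cod X (Src X \<alpha>) \<Longrightarrow>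
      HComp X (VComp X \<beta>' \<beta>) (VComp X \<alpha>' \<alpha>) = VComp X (HComp X \<beta>' \<alpha>') (HComp X \<beta> \<alpha>)"
  shows "two_cat X"
proof -
  interpret C: cat X using assms(1) by unfold_locales
  have v: "is_category (vertical X)"
    unfolding is_category_def Hom_def vertical_def using assms(2-6) by simp
  have h: "is_category (horizontal X)"
    unfolding is_category_def Hom_def horizontal_def using assms(2,3,7-9) by simp
  show ?thesis
    by unfold_locales (use assms v h in \<open>simp add: is_two_category_def\<close>)
qed

section \<open>2-functors\<close>

record ('o, 'p, 'm, 'n, 'c, 'd) cell_map =
  at_obj :: "'o \<Rightarrow> 'p"
  at_mor :: "'m \<Rightarrow> 'n"
  at_cell :: "'c \<Rightarrow> 'd"

locale two_functor = X: two_cat X + Y: two_cat Y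
  for X :: "('o, 'm, 'c, 'y) two_category_scheme" and Y :: "('p, 'n, 'd, 'z) two_category_scheme" +
  fixes F :: "('o, 'p, 'm, 'n, 'c, 'd) cell_map"
  assumes is_two_functor: "is_two_functor X Y (at_obj F) (at_mor F) (at_cell F)"
begin

lemma at_obj_Obj [simp]: "x \<in> Obj X \<Longrightarrow> at_obj F x \<in> Obj Y"
  and at_mor_Mor [simp]: "f \<in> Mor X \<Longrightarrow> at_mor F f \<in> Mor Y"
  and Dom_at_mor [simp]: "f \<in> Mor X \<Longrightarrow> Dom Y (at_mor F f) = at_obj F (Dom X f)"
  and Cod_at_mor [simp]: "f \<in> Mor X \<Longrightarrow> Cod Y (at_mor F f) = at_obj F (Cod X f)"
  and at_mor_Idn [simp]: "x \<in> Obj X \<Longrightarrow> at_mor F (Idn X x) = Idn Y (at_obj F x)"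
  and at_mor_Comp [simp]: "f \<in> Mor X \<Longrightarrow> g \<in> Mor X \<Longrightarrow> Dom X g = Cod X f \<Longrightarrow>
    at_mor F (Comp X g f) = Comp Y (at_mor F g) (at_mor F f)"
  and at_cell_Cell [simp]: "\<alpha> \<in> Cell X \<Longrightarrow> at_cell F \<alpha> \<in> Cell Y"
  and Src_at_cell [simp]: "\<alpha> \<in> Cell X \<Longrightarrow> Src Y (at_cell F \<alpha>) = at_mor F (Src X \<alpha>)"
  and Tgt_at_cell [simp]: "\<alpha> \<in> Cell X \<Longrightarrow> Tgt Y (at_cell F \<alpha>) = at_mor F (Tgt X \<alpha>)"
  and at_cell_CellId [simp]: "f \<in> Mor X \<Longrightarrow> at_cell F (CellId X f) = CellId Y (at_mor F f)"
  and at_cell_VComp [simp]: "\<alpha> \<in> Cell X \<Longrightarrow> \<beta> \<in> Cell X \<Longrightarrow> Src X \<beta> = Tgt X \<alpha> \<Longrightarrow>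
    at_cell F (VComp X \<beta> \<alpha>) = VComp Y (at_cell F \<beta>) (at_cell F \<alpha>)"
  and at_cell_HComp [simp]: "\<alpha> \<in> Cell X \<Longrightarrow> \<beta> \<in> Cell X \<Longrightarrow> Dom X (Src X \<beta>) = Cod X (Src X \<alpha>) \<Longrightarrow>
    at_cell F (HComp X \<beta> \<alpha>) = HComp Y (at_cell F \<beta>) (at_cell F \<alpha>)"
  using is_two_functor
  by (auto simp: is_two_functor_def is_functor_def Hom_def vertical_def horizontal_def)

lemmas functor_laws = at_obj_Obj at_mor_Mor Dom_at_mor Cod_at_mor at_mor_Idn at_mor_Comp
  at_cell_Cell Src_at_cell Tgt_at_cell at_cell_CellId at_cell_VComp at_cell_HComp

lemma invertible_at_cell [simp]: "X.invertible \<alpha> \<Longrightarrow> Y.invertible (at_cell F \<alpha>)"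
proof -
  assume "X.invertible \<alpha>"
  then obtain \<beta> where "X.vertical_inverse \<alpha> \<beta>" by (auto simp: X.invertible_def)
  then have "Y.vertical_inverse (at_cell F \<alpha>) (at_cell F \<beta>)"
    by (simp add: X.vertical_inverse_def Y.vertical_inverse_def flip: at_cell_VComp)
  then show ?thesis by (auto simp: Y.invertible_def)
qed

end

lemma two_functorI:
  assumes "two_cat X" "two_cat Y"
    and "\<And>x. x \<in> Obj X \<Longrightarrow> at_obj F x \<in> Obj Y"
    and "\<And>f. f \<in> Mor X \<Longrightarrow> at_mor F f \<in> Mor Y \<and> Dom Y (at_mor F f) = at_obj F (Dom X f) \<and>
      Cod Y (at_mor F f) = at_obj F (Cod X f)"
    and "\<And>x. x \<in> Obj X \<Longrightarrow> at_mor F (Idn X x) = Idn Y (at_obj F x)"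
    and "\<And>f g. f \<in> Mor X \<Longrightarrow> g \<in> Mor X \<Longrightarrow> Dom X g = Cod X f \<Longrightarrow>
      at_mor F (Comp X g f) = Comp Y (at_mor F g) (at_mor F f)"
    and "\<And>\<alpha>. \<alpha> \<in> Cell X \<Longrightarrow> at_cell F \<alpha> \<in> Cell Y \<and> Src Y (at_cell F \<alpha>) = at_mor F (Src X \<alpha>) \<and>
      Tgt Y (at_cell F \<alpha>) = at_mor F (Tgt X \<alpha>)"
    and "\<And>f. f \<in> Mor X \<Longrightarrow> at_cell F (CellId X f) = CellId Y (at_mor F f)"
    and "\<And>\<alpha> \<beta>. \<alpha> \<in> Cell X \<Longrightarrow> \<beta> \<in> Cell X \<Longrightarrow> Src X \<beta> = Tgt X \<alpha> \<Longrightarrow>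
      at_cell F (VComp X \<beta> \<alpha>) = VComp Y (at_cell F \<beta>) (at_cell F \<alpha>)"
    and "\<And>\<alpha> \<beta>. \<alpha> \<in> Cell X \<Longrightarrow> \<beta> \<in> Cell X \<Longrightarrow> Dom X (Src X \<beta>) = Cod X (Src X \<alpha>) \<Longrightarrow>
      at_cell F (HComp X \<beta> \<alpha>) = HComp Y (at_cell F \<beta>) (at_cell F \<alpha>)"
  shows "two_functor X Y F"
proof -
  interpret X: two_cat X by fact
  interpret Y: two_cat Y by fact
  show ?thesis
    by unfold_locales
      (use assms(3-) in \<open>simp add: is_two_functor_def is_functor_def Hom_def vertical_def horizontal_def\<close>)
qed

definition id_map :: "('o, 'o, 'm, 'm, 'c, 'c) cell_map" where
  "id_map = \<lparr>at_obj = (\<lambda>x. x), at_mor = (\<lambda>f. f), at_cell = (\<lambda>\<alpha>. \<alpha>)\<rparr>"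

definition comp_map ::
  "('p, 'q, 'n, 'k, 'd, 'e) cell_map \<Rightarrow> ('o, 'p, 'm, 'n, 'c, 'd) cell_map \<Rightarrow> ('o, 'q, 'm, 'k, 'c, 'e) cell_map"
where
  "comp_map G F = \<lparr>at_obj = (\<lambda>x. at_obj G (at_obj F x)), at_mor = (\<lambda>f. at_mor G (at_mor F f)),
     at_cell = (\<lambda>\<alpha>. at_cell G (at_cell F \<alpha>))\<rparr>"

lemma id_map_simps [simp]: "at_obj id_map x = x" "at_mor id_map f = f" "at_cell id_map \<alpha> = \<alpha>"
  by (simp_all add: id_map_def)

lemma comp_map_simps [simp]: "at_obj (comp_map G F) x = at_obj G (at_obj F x)"
  "at_mor (comp_map G F) f = at_mor G (at_mor F f)"
  "at_cell (comp_map G F) \<alpha> = at_cell G (at_cell F \<alpha>)"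
  by (simp_all add: comp_map_def)

text \<open>Equality of morphisms: a \<open>cell_map\<close> is a bare triple of functions whose
  values off the carriers are arbitrary.\<close>

definition agree ::
  "('o, 'm, 'c, 'z) two_category_scheme \<Rightarrow> ('o, 'p, 'm, 'n, 'c, 'd) cell_map \<Rightarrow> ('o, 'p, 'm, 'n, 'c, 'd) cell_map \<Rightarrow> bool"
where
  "agree X F G \<longleftrightarrow> (\<forall>x \<in> Obj X. at_obj F x = at_obj G x) \<and> (\<forall>f \<in> Mor X. at_mor F f = at_mor G f) \<and>
     (\<forall>\<alpha> \<in> Cell X. at_cell F \<alpha> = at_cell G \<alpha>)"

lemma two_functor_id: "two_cat X \<Longrightarrow> two_functor X X id_map"
  by (rule two_functorI) simp_all

lemma two_functor_comp:
  assumes "two_functor X Y F" "two_functor Y W G"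
  shows "two_functor X W (comp_map G F)"
proof -
  interpret F: two_functor X Y F by fact
  interpret G: two_functor Y W G by fact
  show ?thesis by (rule two_functorI) (simp_all add: F.X.two_cat_axioms G.Y.two_cat_axioms)
qed

section \<open>Free categories\<close>

definition edges :: "('o, 'm, 'z) category_scheme \<Rightarrow> 'm set" where
  "edges C = {f \<in> Mor C. atomic C f \<or> is_identity C f}"

definition decomposition :: "('o, 'm, 'z) category_scheme \<Rightarrow> 'm \<Rightarrow> 'm list" where
  "decomposition C f = (THE fs. (\<forall>a \<in> set fs. atomic C a) \<and> composes_to C fs f)"

lemma (in cat) composes_to_Mor: "composes_to C fs f \<Longrightarrow> f \<in> Mor C"
  by (induction rule: composes_to.induct) auto

lemma (in cat) composes_to_append:
  "composes_to C fs f \<Longrightarrow> composes_to C gs g \<Longrightarrow> Dom C g = Cod C f \<Longrightarrow> composes_to C (fs @ gs) (Comp C g f)"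
proof (induction rule: composes_to.induct)
  case (Nil x)
  then show ?case by (simp add: composes_to_Mor)
next
  case (Cons f fs f')
  then have "f' \<in> Mor C" "g \<in> Mor C" by (auto simp: composes_to_Mor)
  with Cons show ?case by (simp add: composes_to.Cons flip: Comp_assoc)
qed

locale free_cat = cat C for C :: "('o, 'm, 'z) category_scheme" +
  assumes free: "free_category C"
begin

lemma Idn_edges [simp]: "x \<in> Obj C \<Longrightarrow> Idn C x \<in> edges C"
  by (auto simp: edges_def is_identity_def)

lemma atomic_edges: "atomic C a \<Longrightarrow> a \<in> edges C"
  by (auto simp: edges_def atomic_def)

lemma edges_cases [consumes 1, case_names atomic Idn]:
  assumes "e \<in> edges C"
  obtains "atomic C e" | x where "x \<in> Obj C" "e = Idn C x"
  using assms by (auto simp: edges_def is_identity_def)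

lemma edges_Mor [simp]: "e \<in> edges C \<Longrightarrow> e \<in> Mor C"
  by (simp add: edges_def)

lemma decomposition_eqI: "\<forall>a \<in> set fs. atomic C a \<Longrightarrow> composes_to C fs f \<Longrightarrow> decomposition C f = fs"
  unfolding decomposition_def using free composes_to_Mor[of fs f]
  by (intro the_equality) (auto simp: free_category_def)

lemma decomposition_works: "f \<in> Mor C \<Longrightarrow>
  (\<forall>a \<in> set (decomposition C f). atomic C a) \<and> composes_to C (decomposition C f) f"
  unfolding decomposition_def by (rule theI') (use free in \<open>auto simp: free_category_def\<close>)

lemma decomposition_Idn [simp]: "x \<in> Obj C \<Longrightarrow> decomposition C (Idn C x) = []"
  by (rule decomposition_eqI) (auto intro: composes_to.Nil)

lemma decomposition_Comp [simp]: "f \<in> Mor C \<Longrightarrow> g \<in> Mor C \<Longrightarrow> Dom C g = Cod C f \<Longrightarrow>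
  decomposition C (Comp C g f) = decomposition C f @ decomposition C g"
  using decomposition_works[of f] decomposition_works[of g]
  by (intro decomposition_eqI composes_to_append) auto

lemma decomposition_atomic [simp]: "atomic C a \<Longrightarrow> decomposition C a = [a]"
  using composes_to.Cons[of a C "[]" "Idn C (Cod C a)"] composes_to.Nil[of "Cod C a" C]
  by (intro decomposition_eqI) (auto simp: atomic_def)

text \<open>Induction over the decomposition, removing the 1-cell applied first. Edges are used
  instead of atomic 1-cells because morphisms preserve edges but may send atomic 1-cells to
  identities.\<close>

lemma free_induct [consumes 1, case_names Idn Comp]:
  assumes "f \<in> Mor C"
    and "\<And>x. x \<in> Obj C \<Longrightarrow> P (Idn C x)"
    and "\<And>e g. e \<in> edges C \<Longrightarrow> g \<in> Mor C \<Longrightarrow> Dom C g = Cod C e \<Longrightarrow> P g \<Longrightarrow> P (Comp C g e)"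
  shows "P f"
proof -
  have "composes_to C fs f \<Longrightarrow> \<forall>a \<in> set fs. atomic C a \<Longrightarrow> P f" for fs f
    by (induction rule: composes_to.induct) (auto simp: assms(2,3) atomic_edges composes_to_Mor)
  then show ?thesis using decomposition_works[OF assms(1)] by blast
qed

end

locale flex = two_cat X + free_cat X for X :: "('o, 'm, 'c, 'z) two_category_scheme"

lemma flex_iff: "flex X \<longleftrightarrow> flexible X"
proof -
  have "is_category X" if "is_two_category X" using that by (simp add: is_two_category_def)
  then show ?thesis
    by (auto simp: flex_def two_cat_def free_cat_def cat_def two_cat_axioms_def free_cat_axioms_def flexible_def)
qed

locale flex_functor = two_functor X Y F + X: flex X + Y: flex Y
  for X :: "('o, 'm, 'c, 'y) two_category_scheme" and Y :: "('p, 'n, 'd, 'z) two_category_scheme" and F +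
  assumes at_mor_edges [simp]: "e \<in> edges X \<Longrightarrow> at_mor F e \<in> edges Y"

lemma flex_functor_iff: "flex_functor X Y F \<longleftrightarrow> flexible X \<and> flexible Y \<and>
  flexible_morphism X Y (at_obj F) (at_mor F) (at_cell F)"
proof
  assume "flex_functor X Y F"
  then interpret flex_functor X Y F .
  have "is_functor X Y (at_obj F) (at_mor F)"
    using is_two_functor by (simp add: is_two_functor_def)
  moreover have "atomic Y (at_mor F f) \<or> is_identity Y (at_mor F f)" if "atomic X f" for f
    using at_mor_edges[of f] X.atomic_edges[OF that] by (simp add: edges_def del: X.edges_Mor Y.edges_Mor)
  ultimately show "flexible X \<and> flexible Y \<and> flexible_morphism X Y (at_obj F) (at_mor F) (at_cell F)"
    using X.flex_axioms Y.flex_axioms is_two_functor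
    by (simp add: flex_iff flexible_morphism_def free_category_morphism_def)
next
  assume a: "flexible X \<and> flexible Y \<and> flexible_morphism X Y (at_obj F) (at_mor F) (at_cell F)"
  then interpret X: flex X by (simp add: flex_iff)
  interpret Y: flex Y using a by (simp add: flex_iff)
  interpret two_functor X Y F
    by unfold_locales (use a in \<open>simp add: flexible_morphism_def\<close>)
  show "flex_functor X Y F"
  proof unfold_locales
    fix e assume "e \<in> edges X"
    then show "at_mor F e \<in> edges Y"
      using a by (auto simp: flexible_morphism_def free_category_morphism_def edges_def is_identity_def
          simp del: X.edges_Mor Y.edges_Mor)
  qed
qed

lemma flex_functorI:
  assumes "two_functor X Y F" "flex X" "flex Y" "\<And>e. e \<in> edges X \<Longrightarrow> at_mor F e \<in> edges Y"
  shows "flex_functor X Y F"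
  using assms by (simp add: flex_functor_def flex_functor_axioms_def)

lemma flex_functor_id: "flex X \<Longrightarrow> flex_functor X X id_map"
  by (rule flex_functorI) (auto simp: two_functor_id flex_def)

lemma flex_functor_comp:
  "flex_functor X Y F \<Longrightarrow> flex_functor Y W G \<Longrightarrow> flex_functor X W (comp_map G F)"
  by (rule flex_functorI)
    (auto simp: flex_functor_def flex_functor_axioms_def intro: two_functor_comp)

lemma (in two_functor) agree_two_functor:
  assumes "agree X F G"
  shows "two_functor X Y G"
proof -
  have s: "at_obj G x = at_obj F x" if "x \<in> Obj X" for x using that assms by (simp add: agree_def)
  have m: "at_mor G x = at_mor F x" if "x \<in> Mor X" for x using that assms by (simp add: agree_def)
  have c: "at_cell G x = at_cell F x" if "x \<in> Cell X" for x using that assms by (simp add: agree_def)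
  show ?thesis
    by (rule two_functorI) (simp_all add: X.two_cat_axioms Y.two_cat_axioms s m c)
qed

lemma (in flex_functor) agree_flex_functor: "agree X F G \<Longrightarrow> flex_functor X Y G"
  using agree_two_functor at_mor_edges
  by (intro flex_functorI) (auto simp: X.flex_axioms Y.flex_axioms agree_def)

lemma (in flex) at_mor_eqI:
  assumes "two_functor X Y F" "two_functor X Y G"
    and "\<And>x. x \<in> Obj X \<Longrightarrow> at_obj F x = at_obj G x"
    and "\<And>e. e \<in> edges X \<Longrightarrow> at_mor F e = at_mor G e"
    and "f \<in> Mor X"
  shows "at_mor F f = at_mor G f"
proof -
  interpret F: two_functor X Y F by fact
  interpret G: two_functor X Y G by fact
  show ?thesis using assms(5) by (induction rule: free_induct) (use assms(3,4) in auto)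
qed

section \<open>Replacing the 1-cells of a 2-category by the paths of a reflexive graph\<close>

text \<open>The starting vertex is an explicit argument since the empty path has to know its
  endpoint. At the vertex \<open>x\<close> only \<open>i x\<close> is excluded: in the graphs
  considered, \<open>u (i y)\<close> is the identity of \<open>y\<close>, so every other degenerate
  edge starts elsewhere.\<close>

primrec is_path :: "('o, 'm, 'z) category_scheme \<Rightarrow> 'e set \<Rightarrow> ('e \<Rightarrow> 'm) \<Rightarrow> ('o \<Rightarrow> 'e) \<Rightarrow> 'o \<Rightarrow> 'e list \<Rightarrow> bool"
where
  "is_path K E u i x [] \<longleftrightarrow> x \<in> Obj K"
| "is_path K E u i x (r # es) \<longleftrightarrow> r \<in> E \<and> r \<noteq> i x \<and> Dom K (u r) = x \<and> is_path K E u i (Cod K (u r)) es"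

primrec list_comp :: "('o, 'm, 'z) category_scheme \<Rightarrow> ('e \<Rightarrow> 'm) \<Rightarrow> 'o \<Rightarrow> 'e list \<Rightarrow> 'm" where
  "list_comp K u x [] = Idn K x"
| "list_comp K u x (r # es) = Comp K (list_comp K u (Cod K (u r)) es) (u r)"

definition path_comp :: "('o, 'm, 'z) category_scheme \<Rightarrow> ('e \<Rightarrow> 'm) \<Rightarrow> 'o \<times> 'e list \<Rightarrow> 'm" where
  "path_comp K u p = list_comp K u (fst p) (snd p)"

definition path_append :: "'o \<times> 'e list \<Rightarrow> 'o \<times> 'e list \<Rightarrow> 'o \<times> 'e list" where
  "path_append q p = (fst p, snd p @ snd q)"

text \<open>
  The reflexive graph has the objects of \<open>K\<close> as vertices and \<open>E\<close> as edges; \<open>u\<close> interprets the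
  edges as 1-cells of \<open>K\<close>, and \<open>i x\<close> is the degenerate edge at \<open>x\<close>.
\<close>

definition path_two_category ::
  "('o, 'm, 'c, 'z) two_category_scheme \<Rightarrow> 'e set \<Rightarrow> ('e \<Rightarrow> 'm) \<Rightarrow> ('o \<Rightarrow> 'e) \<Rightarrow>
   ('o, 'o \<times> 'e list, ('o \<times> 'e list) \<times> ('o \<times> 'e list) \<times> 'c) two_category"
where
  "path_two_category K E u i = \<lparr>
     Obj = Obj K,
     Mor = {p. is_path K E u i (fst p) (snd p)},
     Dom = fst,
     Cod = (\<lambda>p. Cod K (path_comp K u p)),
     Idn = (\<lambda>x. (x, [])),
     Comp = path_append,
     Cell = {(p, q, k). is_path K E u i (fst p) (snd p) \<and> is_path K E u i (fst q) (snd q) \<and>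
       k \<in> Cell K \<and> Src K k = path_comp K u p \<and> Tgt K k = path_comp K u q},
     Src = fst,
     Tgt = (\<lambda>\<alpha>. fst (snd \<alpha>)),
     CellId = (\<lambda>p. (p, p, CellId K (path_comp K u p))),
     VComp = (\<lambda>\<beta> \<alpha>. (fst \<alpha>, fst (snd \<beta>), VComp K (snd (snd \<beta>)) (snd (snd \<alpha>)))),
     HComp = (\<lambda>\<beta> \<alpha>. (path_append (fst \<beta>) (fst \<alpha>), path_append (fst (snd \<beta>)) (fst (snd \<alpha>)),
       HComp K (snd (snd \<beta>)) (snd (snd \<alpha>))))\<rparr>"

locale path_graph = K: two_cat K for K :: "('o, 'm, 'c, 'z) two_category_scheme" +
  fixes E :: "'e set" and u :: "'e \<Rightarrow> 'm" and i :: "'o \<Rightarrow> 'e"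
  assumes u_Mor [simp]: "r \<in> E \<Longrightarrow> u r \<in> Mor K"
    and i_E [simp]: "x \<in> Obj K \<Longrightarrow> i x \<in> E"
    and u_i [simp]: "x \<in> Obj K \<Longrightarrow> u (i x) = Idn K x"
begin

abbreviation Paths :: "('o, 'o \<times> 'e list, ('o \<times> 'e list) \<times> ('o \<times> 'e list) \<times> 'c) two_category" where
  "Paths \<equiv> path_two_category K E u i"

abbreviation pcomp :: "'o \<times> 'e list \<Rightarrow> 'm" where
  "pcomp \<equiv> path_comp K u"

text \<open>Erasing the degenerate edge makes \<open>single\<close> a map from \<open>E\<close> onto
  all edges of \<open>Paths\<close>, identities included.\<close>

definition single :: "'e \<Rightarrow> 'o \<times> 'e list" where
  "single r = (Dom K (u r), if r = i (Dom K (u r)) then [] else [r])"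

lemma Paths_simps [simp]:
  "Obj Paths = Obj K" "Dom Paths p = fst p" "Idn Paths x = (x, [])" "Comp Paths q p = path_append q p"
  "Cod Paths p = Cod K (pcomp p)"
  "Src Paths \<alpha> = fst \<alpha>" "Tgt Paths \<alpha> = fst (snd \<alpha>)" "CellId Paths p = (p, p, CellId K (pcomp p))"
  "VComp Paths \<beta> \<alpha> = (fst \<alpha>, fst (snd \<beta>), VComp K (snd (snd \<beta>)) (snd (snd \<alpha>)))"
  "HComp Paths \<beta> \<alpha> = (path_append (fst \<beta>) (fst \<alpha>), path_append (fst (snd \<beta>)) (fst (snd \<alpha>)),
       HComp K (snd (snd \<beta>)) (snd (snd \<alpha>)))"
  by (simp_all add: path_two_category_def)

lemma Mor_Paths: "p \<in> Mor Paths \<longleftrightarrow> is_path K E u i (fst p) (snd p)"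
  by (simp add: path_two_category_def)

lemma Cell_Paths: "\<alpha> \<in> Cell Paths \<longleftrightarrow> fst \<alpha> \<in> Mor Paths \<and> fst (snd \<alpha>) \<in> Mor Paths \<and>
  snd (snd \<alpha>) \<in> Cell K \<and> Src K (snd (snd \<alpha>)) = pcomp (fst \<alpha>) \<and> Tgt K (snd (snd \<alpha>)) = pcomp (fst (snd \<alpha>))"
  by (auto simp: path_two_category_def)

lemma Cell_PathsI [simp]: "p \<in> Mor Paths \<Longrightarrow> q \<in> Mor Paths \<Longrightarrow> k \<in> Cell K \<Longrightarrow>
  Src K k = pcomp p \<Longrightarrow> Tgt K k = pcomp q \<Longrightarrow> (p, q, k) \<in> Cell Paths"
  by (simp add: Cell_Paths)

lemma list_comp_Mor: "is_path K E u i x es \<Longrightarrow>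
  x \<in> Obj K \<and> list_comp K u x es \<in> Mor K \<and> Dom K (list_comp K u x es) = x"
proof (induction es arbitrary: x)
  case (Cons r es)
  then show ?case using K.Dom_Obj[of "u r"] by (auto simp del: K.Dom_Obj)
qed simp

lemma fst_Obj [simp]: "p \<in> Mor Paths \<Longrightarrow> fst p \<in> Obj K"
  and pcomp_Mor [simp]: "p \<in> Mor Paths \<Longrightarrow> pcomp p \<in> Mor K"
  and Dom_pcomp [simp]: "p \<in> Mor Paths \<Longrightarrow> Dom K (pcomp p) = fst p"
  using list_comp_Mor by (auto simp: Mor_Paths path_comp_def)

lemma pcomp_Nil [simp]: "pcomp (x, []) = Idn K x"
  by (simp add: path_comp_def)

lemma Nil_Mor_Paths [simp]: "(x, []) \<in> Mor Paths \<longleftrightarrow> x \<in> Obj K"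
  by (simp add: Mor_Paths)

lemma is_path_append: "is_path K E u i x es \<Longrightarrow> is_path K E u i (Cod K (list_comp K u x es)) fs \<Longrightarrow>
  is_path K E u i x (es @ fs) \<and>
  list_comp K u x (es @ fs) = Comp K (list_comp K u (Cod K (list_comp K u x es)) fs) (list_comp K u x es)"
proof (induction es arbitrary: x)
  case Nil
  then show ?case using list_comp_Mor by simp
next
  case (Cons r es)
  then show ?case
    using list_comp_Mor[of _ es] list_comp_Mor[of _ fs] by simp
qed

lemma path_append_Mor [simp]: "p \<in> Mor Paths \<Longrightarrow> q \<in> Mor Paths \<Longrightarrow> fst q = Cod K (pcomp p) \<Longrightarrow>
    path_append q p \<in> Mor Paths"
  and pcomp_append [simp]: "p \<in> Mor Paths \<Longrightarrow> q \<in> Mor Paths \<Longrightarrow> fst q = Cod K (pcomp p) \<Longrightarrow>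
    pcomp (path_append q p) = Comp K (pcomp q) (pcomp p)"
  using is_path_append[of "fst p" "snd p" "snd q"] by (auto simp: Mor_Paths path_append_def path_comp_def)

lemma fst_path_append [simp]: "fst (path_append q p) = fst p"
  by (simp add: path_append_def)

lemma path_append_assoc: "path_append r (path_append q p) = path_append (path_append r q) p"
  by (simp add: path_append_def)

lemma path_append_Nil [simp]: "path_append (x, []) p = p" "fst p = x \<Longrightarrow> path_append p (x, []) = p"
  by (auto simp: path_append_def)

lemma is_category_Paths: "is_category Paths"
  unfolding is_category_def Hom_def by (simp add: path_append_assoc)

text \<open>Apart from its boundary paths a cell lives in \<open>K\<close>, and \<open>pcomp\<close>
  turns concatenation into composition, so the laws are inherited. The endpoints of the two boundary
  paths agree because their composites are parallel in \<open>K\<close>.\<close>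

lemma two_cat_Paths: "two_cat Paths"
proof (rule two_catI[OF is_category_Paths], goal_cases)
  case (1 \<alpha>)
  then show ?case using K.Dom_Tgt[of "snd (snd \<alpha>)"] K.Cod_Tgt[of "snd (snd \<alpha>)"]
    by (auto simp: Cell_Paths simp del: K.Dom_Tgt K.Cod_Tgt)
next
  case (4 \<alpha>)
  then show ?case by (cases \<alpha>) (auto simp: Cell_Paths)
next
  case (5 \<alpha> \<beta> \<gamma>)
  then show ?case by (simp add: Cell_Paths)
next
  case (6 \<alpha> \<beta>)
  then have "Cod K (pcomp (fst (snd \<alpha>))) = Cod K (pcomp (fst \<alpha>))" "fst (fst (snd \<beta>)) = fst (fst \<beta>)"
    using K.Dom_Tgt[of "snd (snd \<beta>)"] K.Cod_Tgt[of "snd (snd \<alpha>)"]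
    by (auto simp: Cell_Paths simp del: K.Dom_Tgt K.Cod_Tgt)
  with 6 show ?case by (auto simp: Cell_Paths)
next
  case (7 \<alpha>)
  then have "fst (fst (snd \<alpha>)) = fst (fst \<alpha>)"
    using K.Dom_Tgt[of "snd (snd \<alpha>)"]
    by (auto simp: Cell_Paths simp del: K.Dom_Tgt K.Cod_Tgt)
  with 7 show ?case by (cases \<alpha>) (auto simp: Cell_Paths)
next
  case (8 \<alpha> \<beta> \<gamma>)
  then show ?case by (simp add: path_append_assoc Cell_Paths)
next
  case (10 \<alpha> \<alpha>' \<beta> \<beta>')
  then show ?case by (auto simp: Cell_Paths K.interchange)
qed (auto simp: Cell_Paths)

lemma Cell_PathsD [simp]:
  assumes "\<alpha> \<in> Cell Paths"
  shows "fst \<alpha> \<in> Mor Paths" "fst (snd \<alpha>) \<in> Mor Paths" "snd (snd \<alpha>) \<in> Cell K"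
    "Src K (snd (snd \<alpha>)) = pcomp (fst \<alpha>)" "Tgt K (snd (snd \<alpha>)) = pcomp (fst (snd \<alpha>))"
  using assms by (simp_all add: Cell_Paths)

sublocale P: two_cat Paths by (rule two_cat_Paths)

lemma Cell_parallel:
  assumes "\<alpha> \<in> Cell Paths"
  shows "fst (fst (snd \<alpha>)) = fst (fst \<alpha>)" "Cod K (pcomp (fst (snd \<alpha>))) = Cod K (pcomp (fst \<alpha>))"
  using P.Dom_Tgt[OF assms] P.Cod_Tgt[OF assms] by simp_all

lemma single_Mor [simp]: "r \<in> E \<Longrightarrow> single r \<in> Mor Paths"
  by (simp add: single_def Mor_Paths)

lemma fst_single [simp]: "fst (single r) = Dom K (u r)"
  by (simp add: single_def)

lemma pcomp_single [simp]: "r \<in> E \<Longrightarrow> pcomp (single r) = u r"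
proof -
  assume "r \<in> E"
  moreover from this have "u r = Idn K (Dom K (u r))" if "r = i (Dom K (u r))"
    using that u_i[of "Dom K (u r)"] by simp
  ultimately show ?thesis by (auto simp: single_def path_comp_def)
qed

lemma single_i [simp]: "x \<in> Obj K \<Longrightarrow> single (i x) = (x, [])"
  by (simp add: single_def)

lemma Cons_Mor_Paths: "(x, r # es) \<in> Mor Paths \<longleftrightarrow>
  r \<in> E \<and> r \<noteq> i x \<and> Dom K (u r) = x \<and> (Cod K (u r), es) \<in> Mor Paths"
  by (auto simp: Mor_Paths)

lemma path_append_single: "(x, r # es) \<in> Mor Paths \<Longrightarrow> (x, r # es) = path_append (Cod K (u r), es) (single r)"
  by (auto simp: Cons_Mor_Paths single_def path_append_def)

lemma is_identity_Paths: "is_identity Paths p \<longleftrightarrow> fst p \<in> Obj K \<and> snd p = []"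
  by (cases p) (auto simp: is_identity_def)

text \<open>Length is additive under concatenation and vanishes exactly on identities; a longer path
  factors through the single edge applied first.\<close>

lemma atomic_Paths: "atomic Paths p \<longleftrightarrow> p \<in> Mor Paths \<and> length (snd p) = 1"
proof
  assume a: "atomic Paths p"
  obtain x es where p: "p = (x, es)" by (cases p)
  have m: "p \<in> Mor Paths" using a by (simp add: atomic_def)
  show "p \<in> Mor Paths \<and> length (snd p) = 1"
  proof (cases es)
    case Nil
    then show ?thesis using a m p fst_Obj[OF m] by (auto simp: atomic_def is_identity_Paths simp del: fst_Obj)
  next
    case (Cons r fs)
    with m p have r: "p = Comp Paths (Cod K (u r), fs) (single r)" "(Cod K (u r), fs) \<in> Mor Paths" "r \<in> E"
      and sr: "single r = (x, [r])"
      using path_append_single[of x r fs] by (auto simp: Cons_Mor_Paths single_def)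
    have "single r \<in> Mor Paths" "(Cod K (u r), fs) \<in> Mor Paths" "Dom Paths (Cod K (u r), fs) = Cod Paths (single r)"
      using single_Mor[OF \<open>r \<in> E\<close>] pcomp_single[OF \<open>r \<in> E\<close>] r(2) by simp_all
    then have "is_identity Paths (single r) \<or> is_identity Paths (Cod K (u r), fs)"
      using a r(1) unfolding atomic_def by blast
    then have "fs = []" using sr by (simp add: is_identity_Paths)
    then show ?thesis using m p Cons by simp
  qed
next
  assume a: "p \<in> Mor Paths \<and> length (snd p) = 1"
  have "is_identity Paths g \<or> is_identity Paths h"
    if "g \<in> Mor Paths" "h \<in> Mor Paths" "Dom Paths h = Cod Paths g" "p = Comp Paths h g" for g h
  proof -
    have "snd g = [] \<or> snd h = []"
      using a that(4) by (cases "snd g") (auto simp: path_append_def)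
    then show ?thesis using that fst_Obj by (auto simp: is_identity_Paths simp del: fst_Obj)
  qed
  then show "atomic Paths p" using a unfolding atomic_def by (auto simp: is_identity_Paths)
qed

lemma edges_Paths: "edges Paths = single ` E"
proof (intro equalityI subsetI)
  fix p assume "p \<in> edges Paths"
  then have m: "p \<in> Mor Paths" and l: "length (snd p) = 1 \<or> snd p = []"
    by (auto simp: edges_def atomic_Paths is_identity_Paths)
  obtain x es where p: "p = (x, es)" by (cases p)
  show "p \<in> single ` E"
  proof (cases es)
    case Nil
    then have "p = single (i x)" "i x \<in> E" using m p by simp_all
    then show ?thesis by blast
  next
    case (Cons r fs)
    then have "p = single r" "r \<in> E" using m p l by (auto simp: Cons_Mor_Paths single_def)
    then show ?thesis by blast
  qed
next
  fix p assume "p \<in> single ` E"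
  then obtain r where "r \<in> E" "p = single r" by auto
  then show "p \<in> edges Paths"
    using single_Mor[of r] by (auto simp: edges_def atomic_Paths is_identity_Paths single_def)
qed

lemma path_append_eq_conv:
  assumes "atomic Paths p"
  shows "path_append q p = (x, es) \<longleftrightarrow> (\<exists>r. p = (x, [r]) \<and> es = r # snd q)"
  using assms by (cases p) (auto simp: atomic_Paths path_append_def length_Suc_conv)

lemma free_category_Paths: "free_category Paths"
proof -
  have ex: "\<exists>ps. (\<forall>a \<in> set ps. atomic Paths a) \<and> composes_to Paths ps (x, es)" if "(x, es) \<in> Mor Paths" for x es
    using that
  proof (induction es arbitrary: x)
    case Nil
    then show ?case using composes_to.Nil[of x Paths] by (intro exI[of _ "[]"]) simp
  next
    case (Cons r es)
    then obtain ps where ps: "\<forall>a \<in> set ps. atomic Paths a" "composes_to Paths ps (Cod K (u r), es)"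
      by (auto simp: Cons_Mor_Paths)
    have e: "r \<in> E" "r \<noteq> i x" "Dom K (u r) = x" using Cons.prems by (auto simp: Cons_Mor_Paths)
    then have "atomic Paths (single r)" by (simp add: atomic_Paths) (simp add: single_def)
    moreover have "composes_to Paths (single r # ps) (x, r # es)"
      using composes_to.Cons[OF _ ps(2), of "single r"] e path_append_single[OF Cons.prems] by simp
    ultimately show ?case using ps(1) by (intro exI[of _ "single r # ps"]) auto
  qed
  \<comment> \<open>An atomic first factor is read off the head of the list, so two decompositions
    begin alike; the remaining composites then have equal lists and both start at the codomain of
    that factor.\<close>
  have un: "composes_to Paths ps p \<Longrightarrow> \<forall>a \<in> set ps. atomic Paths a \<Longrightarrow>
    composes_to Paths qs p \<Longrightarrow> \<forall>a \<in> set qs. atomic Paths a \<Longrightarrow> ps = qs" for ps qs p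
  proof (induction arbitrary: qs rule: composes_to.induct)
    case (Nil x)
    from Nil(3) show ?case
    proof cases
      case (Cons f fs g)
      then have "atomic Paths f" "path_append g f = (x, [])" using Nil(4) by auto
      then show ?thesis by (simp add: path_append_eq_conv)
    qed simp
  next
    case (Cons f fs g)
    from Cons(6) show ?case
    proof cases
      case (Nil x)
      then have "atomic Paths f" "path_append g f = (x, [])" using Cons(5) by auto
      then show ?thesis by (simp add: path_append_eq_conv)
    next
      case c: (Cons f' fs' g')
      then have "atomic Paths f" "atomic Paths f'" "path_append g f = path_append g' f'"
        using Cons(5,7) by auto
      moreover obtain r r' where "snd f = [r]" "snd f' = [r']"
        using calculation by (auto simp: atomic_Paths length_Suc_conv)
      ultimately have f: "f = f'" "snd g = snd g'"
        by (auto simp: path_append_def prod_eq_iff)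
      moreover have "fst g = fst g'" using f Cons(3) c by simp
      ultimately have "g = g'" by (simp add: prod_eq_iff)
      then have "fs = fs'" using Cons.IH[of fs'] Cons(5,7) c by auto
      with c f show ?thesis by simp
    qed
  qed
  have "\<exists>!ps. (\<forall>a \<in> set ps. atomic Paths a) \<and> composes_to Paths ps p" if "p \<in> Mor Paths" for p
  proof (rule ex_ex1I)
    show "\<exists>ps. (\<forall>a \<in> set ps. atomic Paths a) \<and> composes_to Paths ps p"
      using ex[of "fst p" "snd p"] that by simp
  qed (blast intro: un)
  then show ?thesis unfolding free_category_def using is_category_Paths by blast
qed

sublocale P: flex Paths
  by unfold_locales (rule free_category_Paths)

lemma functor_Paths:
  assumes "two_functor Z Paths F"
  shows "f \<in> Mor Z \<Longrightarrow> at_mor F f \<in> Mor Paths"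
    and "f \<in> Mor Z \<Longrightarrow> fst (at_mor F f) = at_obj F (Dom Z f)"
    and "x \<in> Obj Z \<Longrightarrow> at_mor F (Idn Z x) = (at_obj F x, [])"
    and "f \<in> Mor Z \<Longrightarrow> g \<in> Mor Z \<Longrightarrow> Dom Z g = Cod Z f \<Longrightarrow>
      at_mor F (Comp Z g f) = path_append (at_mor F g) (at_mor F f)"
    and "\<alpha> \<in> Cell Z \<Longrightarrow>
      at_cell F \<alpha> = (at_mor F (Src Z \<alpha>), at_mor F (Tgt Z \<alpha>), snd (snd (at_cell F \<alpha>)))"
  using two_functor.functor_laws[OF assms] by (simp_all add: prod_eq_iff)

end

text \<open>The data of a morphism into \<open>Paths\<close>. The choice \<open>\<phi>\<close> of
  graph edges is a datum of its own because several edges of \<open>E\<close> may lie over one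
  1-cell of \<open>K\<close>.\<close>

locale path_lift = path_graph K E u i + Z: flex Z + G: two_functor Z K G
  for K :: "('o, 'm, 'c, 'y) two_category_scheme" and E :: "'e set" and u i
    and Z :: "('p, 'n, 'd, 'z) two_category_scheme" and G +
  fixes \<phi> :: "'n \<Rightarrow> 'e"
  assumes \<phi>_E [simp]: "e \<in> edges Z \<Longrightarrow> \<phi> e \<in> E"
    and u_\<phi> [simp]: "e \<in> edges Z \<Longrightarrow> u (\<phi> e) = at_mor G e"
    and \<phi>_Idn [simp]: "x \<in> Obj Z \<Longrightarrow> \<phi> (Idn Z x) = i (at_obj G x)"
begin

text \<open>An atomic 1-cell that \<open>\<phi>\<close> sends to a degenerate edge contributes the
  empty list, so only nondegenerate edges occur in the result.\<close>

definition lift_path :: "'n \<Rightarrow> 'o \<times> 'e list" where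
  "lift_path f = (at_obj G (Dom Z f), concat (map (\<lambda>a. snd (single (\<phi> a))) (decomposition Z f)))"

definition lift :: "('p, 'o, 'n, 'o \<times> 'e list, 'd, ('o \<times> 'e list) \<times> ('o \<times> 'e list) \<times> 'c) cell_map" where
  "lift = \<lparr>at_obj = at_obj G, at_mor = lift_path,
     at_cell = (\<lambda>\<alpha>. (lift_path (Src Z \<alpha>), lift_path (Tgt Z \<alpha>), at_cell G \<alpha>))\<rparr>"

lemma lift_path_Idn [simp]: "x \<in> Obj Z \<Longrightarrow> lift_path (Idn Z x) = (at_obj G x, [])"
  by (simp add: lift_path_def)

lemma lift_path_edges [simp]: "e \<in> edges Z \<Longrightarrow> lift_path e = single (\<phi> e)"
proof -
  assume e: "e \<in> edges Z"
  then show ?thesis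
  proof (cases rule: Z.edges_cases)
    case atomic
    then show ?thesis using e by (simp add: lift_path_def prod_eq_iff)
  next
    case (Idn x)
    then show ?thesis by simp
  qed
qed

lemma fst_lift_path [simp]: "fst (lift_path f) = at_obj G (Dom Z f)"
  by (simp add: lift_path_def)

lemma lift_path_Comp [simp]: "f \<in> Mor Z \<Longrightarrow> g \<in> Mor Z \<Longrightarrow> Dom Z g = Cod Z f \<Longrightarrow>
  lift_path (Comp Z g f) = path_append (lift_path g) (lift_path f)"
  by (simp add: lift_path_def path_append_def)

lemma lift_path_Mor: "f \<in> Mor Z \<Longrightarrow> lift_path f \<in> Mor Paths \<and> pcomp (lift_path f) = at_mor G f"
  by (induction rule: Z.free_induct) auto

lemma lift_simps [simp]: "at_obj lift x = at_obj G x" "f \<in> Mor Z \<Longrightarrow> at_mor lift f \<in> Mor Paths"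
  "f \<in> Mor Z \<Longrightarrow> pcomp (at_mor lift f) = at_mor G f" "e \<in> edges Z \<Longrightarrow> at_mor lift e = single (\<phi> e)"
  "snd (snd (at_cell lift \<alpha>)) = at_cell G \<alpha>"
  by (simp_all add: lift_def lift_path_Mor)

lemma two_functor_lift: "two_functor Z Paths lift"
  by (rule two_functorI) (simp_all add: Z.two_cat_axioms two_cat_Paths lift_def lift_path_Mor)

lemma flex_functor_lift: "flex_functor Z Paths lift"
  by (rule flex_functorI) (simp_all add: two_functor_lift Z.flex_axioms P.flex_axioms edges_Paths)

end

text \<open>Freeness of \<open>Z\<close> fixes the 1-cells, and these fix the boundary paths of
  every cell; what is left of a cell is its component in \<open>K\<close>.\<close>

lemma (in path_graph) lift_unique:
  assumes "flex_functor Z Paths F" "flex_functor Z Paths G"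
    and "\<And>x. x \<in> Obj Z \<Longrightarrow> at_obj F x = at_obj G x"
    and "\<And>e. e \<in> edges Z \<Longrightarrow> at_mor F e = at_mor G e"
    and "\<And>\<alpha>. \<alpha> \<in> Cell Z \<Longrightarrow> snd (snd (at_cell F \<alpha>)) = snd (snd (at_cell G \<alpha>))"
  shows "agree Z F G"
proof -
  interpret F: flex_functor Z Paths F by fact
  interpret G: flex_functor Z Paths G by fact
  have m: "at_mor F f = at_mor G f" if "f \<in> Mor Z" for f
    using F.X.at_mor_eqI[OF F.two_functor_axioms G.two_functor_axioms assms(3,4) that] .
  show ?thesis
    unfolding agree_def
    using assms m F.Src_at_cell G.Src_at_cell F.Tgt_at_cell G.Tgt_at_cell
    by (auto simp: prod_eq_iff simp del: F.Src_at_cell G.Src_at_cell F.Tgt_at_cell G.Tgt_at_cell)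
qed

section \<open>Products\<close>

definition prod_two_cat ::
  "('o, 'm, 'c, 'y) two_category_scheme \<Rightarrow> ('p, 'n, 'd, 'z) two_category_scheme \<Rightarrow>
   ('o \<times> 'p, 'm \<times> 'n, 'c \<times> 'd) two_category"
where
  "prod_two_cat X Y = \<lparr>
     Obj = Obj X \<times> Obj Y, Mor = Mor X \<times> Mor Y,
     Dom = (\<lambda>f. (Dom X (fst f), Dom Y (snd f))), Cod = (\<lambda>f. (Cod X (fst f), Cod Y (snd f))),
     Idn = (\<lambda>x. (Idn X (fst x), Idn Y (snd x))),
     Comp = (\<lambda>g f. (Comp X (fst g) (fst f), Comp Y (snd g) (snd f))),
     Cell = Cell X \<times> Cell Y,
     Src = (\<lambda>\<alpha>. (Src X (fst \<alpha>), Src Y (snd \<alpha>))), Tgt = (\<lambda>\<alpha>. (Tgt X (fst \<alpha>), Tgt Y (snd \<alpha>))),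
     CellId = (\<lambda>f. (CellId X (fst f), CellId Y (snd f))),
     VComp = (\<lambda>\<beta> \<alpha>. (VComp X (fst \<beta>) (fst \<alpha>), VComp Y (snd \<beta>) (snd \<alpha>))),
     HComp = (\<lambda>\<beta> \<alpha>. (HComp X (fst \<beta>) (fst \<alpha>), HComp Y (snd \<beta>) (snd \<alpha>)))\<rparr>"

lemma prod_two_cat_simps [simp]:
  "Obj (prod_two_cat X Y) = Obj X \<times> Obj Y" "Mor (prod_two_cat X Y) = Mor X \<times> Mor Y"
  "Dom (prod_two_cat X Y) f = (Dom X (fst f), Dom Y (snd f))"
  "Cod (prod_two_cat X Y) f = (Cod X (fst f), Cod Y (snd f))"
  "Idn (prod_two_cat X Y) x = (Idn X (fst x), Idn Y (snd x))"
  "Comp (prod_two_cat X Y) g f = (Comp X (fst g) (fst f), Comp Y (snd g) (snd f))"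
  "Cell (prod_two_cat X Y) = Cell X \<times> Cell Y"
  "Src (prod_two_cat X Y) \<alpha> = (Src X (fst \<alpha>), Src Y (snd \<alpha>))"
  "Tgt (prod_two_cat X Y) \<alpha> = (Tgt X (fst \<alpha>), Tgt Y (snd \<alpha>))"
  "CellId (prod_two_cat X Y) f = (CellId X (fst f), CellId Y (snd f))"
  "VComp (prod_two_cat X Y) \<beta> \<alpha> = (VComp X (fst \<beta>) (fst \<alpha>), VComp Y (snd \<beta>) (snd \<alpha>))"
  "HComp (prod_two_cat X Y) \<beta> \<alpha> = (HComp X (fst \<beta>) (fst \<alpha>), HComp Y (snd \<beta>) (snd \<alpha>))"
  by (simp_all add: prod_two_cat_def)

lemma two_cat_prod:
  assumes "two_cat X" "two_cat Y"
  shows "two_cat (prod_two_cat X Y)"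
proof -
  interpret X: two_cat X by fact
  interpret Y: two_cat Y by fact
  have "is_category (prod_two_cat X Y)"
    by (auto simp: is_category_def Hom_def)
  then show ?thesis by (rule two_catI) (auto simp: X.interchange Y.interchange)
qed

definition pair_idn ::
  "('o, 'm, 'c, 'y) two_category_scheme \<Rightarrow> ('p, 'n, 'd, 'z) two_category_scheme \<Rightarrow> 'o \<times> 'p \<Rightarrow> 'm \<times> 'n"
where
  "pair_idn X Y x = (Idn X (fst x), Idn Y (snd x))"

text \<open>A pair of atomic 1-cells is itself atomic here and differs from both ways of performing
  the two one after the other. In the product of categories all three coincide, which destroys
  unique decomposition.\<close>

abbreviation flex_prod where
  "flex_prod X Y \<equiv> path_two_category (prod_two_cat X Y) (edges X \<times> edges Y) (\<lambda>e. e) (pair_idn X Y)"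

definition pair_map ::
  "('o, 'p, 'm, 'n, 'c, 'd) cell_map \<Rightarrow> ('o, 'q, 'm, 'k, 'c, 'e) cell_map \<Rightarrow>
   ('o, 'p \<times> 'q, 'm, 'n \<times> 'k, 'c, 'd \<times> 'e) cell_map"
where
  "pair_map F G = \<lparr>at_obj = (\<lambda>x. (at_obj F x, at_obj G x)), at_mor = (\<lambda>f. (at_mor F f, at_mor G f)),
     at_cell = (\<lambda>\<alpha>. (at_cell F \<alpha>, at_cell G \<alpha>))\<rparr>"

lemma pair_map_simps [simp]: "at_obj (pair_map F G) x = (at_obj F x, at_obj G x)"
  "at_mor (pair_map F G) f = (at_mor F f, at_mor G f)"
  "at_cell (pair_map F G) \<alpha> = (at_cell F \<alpha>, at_cell G \<alpha>)"
  by (simp_all add: pair_map_def)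

lemma two_functor_pair_map:
  assumes "two_functor Z X F" "two_functor Z Y G"
  shows "two_functor Z (prod_two_cat X Y) (pair_map F G)"
proof -
  interpret F: two_functor Z X F by fact
  interpret G: two_functor Z Y G by fact
  show ?thesis
    by (rule two_functorI)
      (simp_all add: F.X.two_cat_axioms two_cat_prod F.Y.two_cat_axioms G.Y.two_cat_axioms)
qed

definition const_map ::
  "('p, 'n, 'd, 'z) two_category_scheme \<Rightarrow> 'p \<Rightarrow> ('o, 'p, 'm, 'n, 'c, 'd) cell_map"
where
  "const_map Y y = \<lparr>at_obj = (\<lambda>_. y), at_mor = (\<lambda>_. Idn Y y), at_cell = (\<lambda>_. CellId Y (Idn Y y))\<rparr>"

lemma const_map_simps [simp]: "at_obj (const_map Y y) x = y" "at_mor (const_map Y y) f = Idn Y y"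
  "at_cell (const_map Y y) \<alpha> = CellId Y (Idn Y y)"
  by (simp_all add: const_map_def)

lemma flex_functor_const:
  assumes "flex X" "flex Y" "y \<in> Obj Y"
  shows "flex_functor X Y (const_map Y y)"
proof -
  interpret X: flex X by fact
  interpret Y: flex Y by fact
  have "two_functor X Y (const_map Y y)"
    by (rule two_functorI) (simp_all add: X.two_cat_axioms Y.two_cat_axioms assms(3))
  then show ?thesis by (rule flex_functorI) (simp_all add: assms)
qed

definition proj1 where
  "proj1 X Y = \<lparr>at_obj = fst, at_mor = (\<lambda>p. fst (path_comp (prod_two_cat X Y) (\<lambda>e. e) p)),
     at_cell = (\<lambda>\<alpha>. fst (snd (snd \<alpha>)))\<rparr>"

definition proj2 where
  "proj2 X Y = \<lparr>at_obj = snd, at_mor = (\<lambda>p. snd (path_comp (prod_two_cat X Y) (\<lambda>e. e) p)),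
     at_cell = (\<lambda>\<alpha>. snd (snd (snd \<alpha>)))\<rparr>"

lemma proj_simps [simp]:
  "at_obj (proj1 X Y) x = fst x" "at_mor (proj1 X Y) p = fst (path_comp (prod_two_cat X Y) (\<lambda>e. e) p)"
  "at_cell (proj1 X Y) \<alpha> = fst (snd (snd \<alpha>))"
  "at_obj (proj2 X Y) x = snd x" "at_mor (proj2 X Y) p = snd (path_comp (prod_two_cat X Y) (\<lambda>e. e) p)"
  "at_cell (proj2 X Y) \<alpha> = snd (snd (snd \<alpha>))"
  by (simp_all add: proj1_def proj2_def)

definition pairing where
  "pairing X Y Z F G = path_lift.lift (prod_two_cat X Y) (\<lambda>e. e) (pair_idn X Y) Z (pair_map F G)
     (\<lambda>e. (at_mor F e, at_mor G e))"

locale flex_product = X: flex X + Y: flex Y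
  for X :: "('o, 'm, 'c, 'y) two_category_scheme" and Y :: "('p, 'n, 'd, 'z) two_category_scheme"
begin

sublocale path_graph "prod_two_cat X Y" "edges X \<times> edges Y" "\<lambda>e. e" "pair_idn X Y"
  using two_cat_prod[OF X.two_cat_axioms Y.two_cat_axioms]
  by (auto simp: path_graph_def path_graph_axioms_def pair_idn_def)

lemma flex_prod: "flex (flex_prod X Y)"
  by (rule P.flex_axioms)

lemma pcomp_parts [simp]:
  assumes "p \<in> Mor Paths"
  shows "fst (pcomp p) \<in> Mor X" "snd (pcomp p) \<in> Mor Y"
    "Dom X (fst (pcomp p)) = fst (fst p)" "Dom Y (snd (pcomp p)) = snd (fst p)"
  using pcomp_Mor[OF assms] Dom_pcomp[OF assms] by (auto simp: mem_Times_iff prod_eq_iff simp del: pcomp_Mor Dom_pcomp)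

lemma Cell_parts [simp]:
  assumes "\<alpha> \<in> Cell Paths"
  shows "fst (snd (snd \<alpha>)) \<in> Cell X" "snd (snd (snd \<alpha>)) \<in> Cell Y"
    "Src X (fst (snd (snd \<alpha>))) = fst (pcomp (fst \<alpha>))" "Src Y (snd (snd (snd \<alpha>))) = snd (pcomp (fst \<alpha>))"
    "Tgt X (fst (snd (snd \<alpha>))) = fst (pcomp (fst (snd \<alpha>)))" "Tgt Y (snd (snd (snd \<alpha>))) = snd (pcomp (fst (snd \<alpha>)))"
  using Cell_PathsD[OF assms] by (auto simp: mem_Times_iff prod_eq_iff simp del: Cell_PathsD)

lemma flex_functor_proj1: "flex_functor Paths X (proj1 X Y)"
proof -
  have "two_functor Paths X (proj1 X Y)"
    by (rule two_functorI) (simp_all add: X.two_cat_axioms P.two_cat_axioms mem_Times_iff prod_eq_iff)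
  then show ?thesis by (rule flex_functorI) (auto simp: X.flex_axioms P.flex_axioms edges_Paths)
qed

lemma flex_functor_proj2: "flex_functor Paths Y (proj2 X Y)"
proof -
  have "two_functor Paths Y (proj2 X Y)"
    by (rule two_functorI) (simp_all add: Y.two_cat_axioms P.two_cat_axioms mem_Times_iff prod_eq_iff)
  then show ?thesis by (rule flex_functorI) (auto simp: Y.flex_axioms P.flex_axioms edges_Paths)
qed

lemma path_lift_pairing:
  assumes "flex_functor Z X F" "flex_functor Z Y G"
  shows "path_lift (prod_two_cat X Y) (edges X \<times> edges Y) (\<lambda>e. e) (pair_idn X Y) Z (pair_map F G)
    (\<lambda>e. (at_mor F e, at_mor G e))"
proof -
  interpret F: flex_functor Z X F by fact
  interpret G: flex_functor Z Y G by fact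
  interpret FG: two_functor Z "prod_two_cat X Y" "pair_map F G"
    by (rule two_functor_pair_map) unfold_locales
  show ?thesis by unfold_locales (auto simp: pair_idn_def)
qed

lemma flex_functor_pairing:
  assumes "flex_functor Z X F" "flex_functor Z Y G"
  shows "flex_functor Z Paths (pairing X Y Z F G)"
  unfolding pairing_def by (rule path_lift.flex_functor_lift[OF path_lift_pairing[OF assms]])

lemma pairing_simps:
  assumes "flex_functor Z X F" "flex_functor Z Y G"
  shows "at_obj (pairing X Y Z F G) x = (at_obj F x, at_obj G x)"
    and "f \<in> Mor Z \<Longrightarrow> pcomp (at_mor (pairing X Y Z F G) f) = (at_mor F f, at_mor G f)"
    and "e \<in> edges Z \<Longrightarrow> at_mor (pairing X Y Z F G) e = single (at_mor F e, at_mor G e)"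
    and "snd (snd (at_cell (pairing X Y Z F G) \<alpha>)) = (at_cell F \<alpha>, at_cell G \<alpha>)"
proof -
  interpret path_lift "prod_two_cat X Y" "edges X \<times> edges Y" "\<lambda>e. e" "pair_idn X Y" Z "pair_map F G"
    "\<lambda>e. (at_mor F e, at_mor G e)" by (rule path_lift_pairing[OF assms])
  show "at_obj (pairing X Y Z F G) x = (at_obj F x, at_obj G x)"
    "f \<in> Mor Z \<Longrightarrow> pcomp (at_mor (pairing X Y Z F G) f) = (at_mor F f, at_mor G f)"
    "e \<in> edges Z \<Longrightarrow> at_mor (pairing X Y Z F G) e = single (at_mor F e, at_mor G e)"
    "snd (snd (at_cell (pairing X Y Z F G) \<alpha>)) = (at_cell F \<alpha>, at_cell G \<alpha>)"
    by (simp_all add: pairing_def del: u_\<phi>)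
qed

lemma proj_pairing:
  assumes "flex_functor Z X F" "flex_functor Z Y G"
  shows "agree Z (comp_map (proj1 X Y) (pairing X Y Z F G)) F"
    and "agree Z (comp_map (proj2 X Y) (pairing X Y Z F G)) G"
  by (simp_all add: agree_def pairing_simps[OF assms])

text \<open>The graph is interpreted by the identity map, so an edge is recovered from its
  composite. Hence the two projections determine a morphism on edges, although they do not see how a
  longer path is subdivided.\<close>

lemma single_edge: "p \<in> edges Paths \<Longrightarrow> p = single (pcomp p)"
  by (auto simp: edges_Paths)

lemma product_unique:
  assumes "flex_functor Z Paths F" "flex_functor Z Paths G"
    and "agree Z (comp_map (proj1 X Y) F) (comp_map (proj1 X Y) G)"
    and "agree Z (comp_map (proj2 X Y) F) (comp_map (proj2 X Y) G)"
  shows "agree Z F G"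
proof -
  interpret F: flex_functor Z Paths F by fact
  interpret G: flex_functor Z Paths G by fact
  show ?thesis
  proof (rule lift_unique[OF assms(1,2)])
    fix e assume e: "e \<in> edges Z"
    then have "pcomp (at_mor F e) = pcomp (at_mor G e)"
      using assms(3,4) by (simp add: agree_def prod_eq_iff)
    then show "at_mor F e = at_mor G e"
      using single_edge[OF F.at_mor_edges[OF e]] single_edge[OF G.at_mor_edges[OF e]] by metis
  qed (use assms(3,4) in \<open>simp_all add: agree_def prod_eq_iff\<close>)
qed

text \<open>
  Every 1-cell of the product is isomorphic to a 1-cell of \<open>X\<close> applied after a 1-cell of \<open>Y\<close>,
  by means of the cells \<open>split\<close> and \<open>swap\<close>, whose two components are identities.
\<close>

definition left :: "'p \<Rightarrow> ('o, 'o \<times> 'p, 'm, _, 'c, _) cell_map" where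
  "left y = pairing X Y X id_map (const_map Y y)"

definition right :: "'o \<Rightarrow> ('p, 'o \<times> 'p, 'n, _, 'd, _) cell_map" where
  "right x = pairing X Y Y (const_map X x) id_map"

lemma flex_functor_left: "y \<in> Obj Y \<Longrightarrow> flex_functor X Paths (left y)"
  unfolding left_def
  by (intro flex_functor_pairing flex_functor_id flex_functor_const X.flex_axioms Y.flex_axioms)

lemma flex_functor_right: "x \<in> Obj X \<Longrightarrow> flex_functor Y Paths (right x)"
  unfolding right_def
  by (intro flex_functor_pairing flex_functor_id flex_functor_const X.flex_axioms Y.flex_axioms)

lemma two_functor_left: "y \<in> Obj Y \<Longrightarrow> two_functor X Paths (left y)"
  and two_functor_right: "x \<in> Obj X \<Longrightarrow> two_functor Y Paths (right x)"
  using flex_functor_left flex_functor_right by (auto simp: flex_functor_def)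

lemmas left_path [simp] = functor_Paths(1-4)[OF two_functor_left]
lemmas right_path [simp] = functor_Paths(1-4)[OF two_functor_right]

lemma left_simps [simp]:
  assumes "y \<in> Obj Y"
  shows "at_obj (left y) x = (x, y)"
    and "f \<in> Mor X \<Longrightarrow> pcomp (at_mor (left y) f) = (f, Idn Y y)"
    and "snd (snd (at_cell (left y) \<alpha>)) = (\<alpha>, CellId Y (Idn Y y))"
  using pairing_simps[OF flex_functor_id[OF X.flex_axioms]
      flex_functor_const[OF X.flex_axioms Y.flex_axioms assms]]
  by (simp_all add: left_def)

lemma right_simps [simp]:
  assumes "x \<in> Obj X"
  shows "at_obj (right x) y = (x, y)"
    and "f \<in> Mor Y \<Longrightarrow> pcomp (at_mor (right x) f) = (Idn X x, f)"
    and "snd (snd (at_cell (right x) \<beta>)) = (CellId X (Idn X x), \<beta>)"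
  using pairing_simps[OF flex_functor_const[OF Y.flex_axioms X.flex_axioms assms]
      flex_functor_id[OF Y.flex_axioms]]
  by (simp_all add: right_def)

lemma left_at_cell [simp]: "y \<in> Obj Y \<Longrightarrow> \<alpha> \<in> Cell X \<Longrightarrow> at_cell (left y) \<alpha> =
    (at_mor (left y) (Src X \<alpha>), at_mor (left y) (Tgt X \<alpha>), \<alpha>, CellId Y (Idn Y y))"
  and right_at_cell [simp]: "x \<in> Obj X \<Longrightarrow> \<beta> \<in> Cell Y \<Longrightarrow> at_cell (right x) \<beta> =
    (at_mor (right x) (Src Y \<beta>), at_mor (right x) (Tgt Y \<beta>), CellId X (Idn X x), \<beta>)"
  using functor_Paths(5)[OF two_functor_left, of y \<alpha>] functor_Paths(5)[OF two_functor_right, of x \<beta>]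
  by (simp_all only: left_simps right_simps)

lemma left_edges: "y \<in> Obj Y \<Longrightarrow> a \<in> edges X \<Longrightarrow> at_mor (left y) a = single (a, Idn Y y)"
  unfolding left_def
  using pairing_simps(3)[OF flex_functor_id[OF X.flex_axioms] flex_functor_const[OF X.flex_axioms Y.flex_axioms]]
  by simp

lemma right_edges: "x \<in> Obj X \<Longrightarrow> e \<in> edges Y \<Longrightarrow> at_mor (right x) e = single (Idn X x, e)"
  unfolding right_def
  using pairing_simps(3)[OF flex_functor_const[OF Y.flex_axioms X.flex_axioms] flex_functor_id[OF Y.flex_axioms]]
  by simp

definition normal :: "'m \<Rightarrow> 'n \<Rightarrow> ('o \<times> 'p) \<times> ('m \<times> 'n) list" where
  "normal f g = path_append (at_mor (left (Cod Y g)) f) (at_mor (right (Dom X f)) g)"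

definition split where
  "split a e = (single (a, e), normal a e, CellId X a, CellId Y e)"

definition swap where
  "swap f g = (path_append (at_mor (right (Cod X f)) g) (at_mor (left (Dom Y g)) f), normal f g,
     CellId X f, CellId Y g)"

lemma normal_simps [simp]:
  assumes "f \<in> Mor X" "g \<in> Mor Y"
  shows "normal f g \<in> Mor Paths" "pcomp (normal f g) = (f, g)" "fst (normal f g) = (Dom X f, Dom Y g)"
  using assms by (simp_all add: normal_def)

lemma split_Cell [simp]: "a \<in> edges X \<Longrightarrow> e \<in> edges Y \<Longrightarrow> split a e \<in> Cell Paths"
  by (simp add: split_def)

lemma swap_Cell [simp]: "f \<in> Mor X \<Longrightarrow> g \<in> Mor Y \<Longrightarrow> swap f g \<in> Cell Paths"
  by (simp add: swap_def)

text \<open>The component in the product of 2-categories is an identity, so exchanging the two paths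
  gives an inverse.\<close>

lemma invertible_coherence:
  assumes "p \<in> Mor Paths" "q \<in> Mor Paths" "pcomp p = pcomp q" "fst k = CellId X (fst (pcomp p))" "snd k = CellId Y (snd (pcomp p))"
  shows "P.invertible (p, q, k)"
proof -
  have k: "k = CellId (prod_two_cat X Y) (pcomp p)" using assms(4,5) by (simp add: prod_eq_iff)
  have "P.vertical_inverse (p, q, k) (q, p, k)"
    using assms unfolding P.vertical_inverse_def k by (simp add: mem_Times_iff)
  then show ?thesis unfolding P.invertible_def by blast
qed

lemma invertible_split [simp]: "a \<in> edges X \<Longrightarrow> e \<in> edges Y \<Longrightarrow> P.invertible (split a e)"
  and invertible_swap [simp]: "f \<in> Mor X \<Longrightarrow> g \<in> Mor Y \<Longrightarrow> P.invertible (swap f g)"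
  unfolding split_def swap_def by (rule invertible_coherence; simp)+

lemma left_cell [simp]: "y \<in> Obj Y \<Longrightarrow> \<alpha> \<in> Cell X \<Longrightarrow> at_cell (left y) \<alpha> \<in> Cell Paths"
  and right_cell [simp]: "x \<in> Obj X \<Longrightarrow> \<beta> \<in> Cell Y \<Longrightarrow> at_cell (right x) \<beta> \<in> Cell Paths"
  by simp_all

definition normalize where
  "normalize p = (p, normal (fst (pcomp p)) (snd (pcomp p)),
     CellId X (fst (pcomp p)), CellId Y (snd (pcomp p)))"

lemma normalize_Cell [simp]: "p \<in> Mor Paths \<Longrightarrow> normalize p \<in> Cell Paths"
  by (simp add: normalize_def prod_eq_iff)

lemma invertible_normalize [simp]: "p \<in> Mor Paths \<Longrightarrow> P.invertible (normalize p)"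
  unfolding normalize_def by (rule invertible_coherence; simp add: prod_eq_iff)

text \<open>The new first edge is cut by \<open>split\<close> while the rest is normalized;
  \<open>swap\<close> then carries \<open>a\<close> past the \<open>Y\<close>-part of
  \<open>q\<close>. All components are identities, so only boundary paths have to match.\<close>

lemma normalize_Comp:
  assumes "a \<in> edges X" "b \<in> edges Y" "q \<in> Mor Paths" "fst q = (Cod X a, Cod Y b)"
  shows "normalize (path_append q (single (a, b))) =
    VComp Paths
      (HComp Paths (CellId Paths (at_mor (left (Cod Y (snd (pcomp q)))) (fst (pcomp q))))
        (HComp Paths (swap a (snd (pcomp q))) (CellId Paths (at_mor (right (Dom X a)) b))))
      (HComp Paths (normalize q) (split a b))"
  using assms pcomp_parts[of q]
  by (simp add: normalize_def swap_def split_def normal_def path_append_assoc del: pcomp_parts)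

text \<open>Between normal forms every cell becomes a horizontal composite of cells of the two
  factors: both sides have the components \<open>\<beta>\<close> and
  \<open>\<gamma>\<close>.\<close>

lemma normalize_natural:
  assumes "\<alpha> \<in> Cell Paths" "\<alpha> = (p, q, \<beta>, \<gamma>)"
  shows "VComp Paths (normalize q) \<alpha> =
    VComp Paths (HComp Paths (at_cell (left (Cod Y (Src Y \<gamma>))) \<beta>) (at_cell (right (Dom X (Src X \<beta>))) \<gamma>)) (normalize p)"
proof -
  note a = Cell_PathsD[OF assms(1), unfolded assms(2), simplified] Cell_parts[OF assms(1), unfolded assms(2), simplified]
  have "Dom X (Src X \<beta>) \<in> Obj X" using a(3) X.Dom_Obj[of "Src X \<beta>"] by simp
  then have "fst (fst p) \<in> Obj X" unfolding a using a(1) by simp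
  then show ?thesis using a Cell_parallel[OF assms(1)] unfolding assms(2) by (simp add: normalize_def normal_def)
qed

text \<open>\<open>normalize\<close> is composed of the cells \<open>split\<close> and
  \<open>swap\<close>, so both functors agree on it; its naturality square reduces
  \<open>\<alpha>\<close> to cells of the two factors. As the image of \<open>normalize\<close> is
  invertible, it can be cancelled in \<open>W\<close>.\<close>

lemma agree_on_generators:
  assumes "two_functor Paths W F" "two_functor Paths W G"
    and mor: "\<And>p. p \<in> Mor Paths \<Longrightarrow> at_mor F p = at_mor G p"
    and split: "\<And>a e. a \<in> edges X \<Longrightarrow> e \<in> edges Y \<Longrightarrow> at_cell F (split a e) = at_cell G (split a e)"
    and swap: "\<And>f g. f \<in> Mor X \<Longrightarrow> g \<in> Mor Y \<Longrightarrow> at_cell F (swap f g) = at_cell G (swap f g)"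
    and left: "\<And>y \<beta>. y \<in> Obj Y \<Longrightarrow> \<beta> \<in> Cell X \<Longrightarrow>
      at_cell F (at_cell (left y) \<beta>) = at_cell G (at_cell (left y) \<beta>)"
    and right: "\<And>x \<beta>. x \<in> Obj X \<Longrightarrow> \<beta> \<in> Cell Y \<Longrightarrow>
      at_cell F (at_cell (right x) \<beta>) = at_cell G (at_cell (right x) \<beta>)"
    and \<alpha>: "\<alpha> \<in> Cell Paths"
  shows "at_cell F \<alpha> = at_cell G \<alpha>"
proof -
  interpret F: two_functor Paths W F by fact
  interpret G: two_functor Paths W G by fact
  define ok where "ok \<beta> \<longleftrightarrow> at_cell F \<beta> = at_cell G \<beta>" for \<beta>
  have id: "ok (CellId Paths p)" if "p \<in> Mor Paths" for p
    unfolding ok_def F.at_cell_CellId[OF that] G.at_cell_CellId[OF that] mor[OF that] ..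
  have V: "ok (VComp Paths \<gamma> \<beta>)"
    if "\<beta> \<in> Cell Paths" "\<gamma> \<in> Cell Paths" "Src Paths \<gamma> = Tgt Paths \<beta>" "ok \<beta>" "ok \<gamma>" for \<beta> \<gamma>
    using that(4,5) unfolding ok_def F.at_cell_VComp[OF that(1-3)] G.at_cell_VComp[OF that(1-3)] by simp
  have H: "ok (HComp Paths \<gamma> \<beta>)"
    if "\<beta> \<in> Cell Paths" "\<gamma> \<in> Cell Paths" "Dom Paths (Src Paths \<gamma>) = Cod Paths (Src Paths \<beta>)"
      "ok \<beta>" "ok \<gamma>" for \<beta> \<gamma>
    using that(4,5) unfolding ok_def F.at_cell_HComp[OF that(1-3)] G.at_cell_HComp[OF that(1-3)] by simp
  have n: "ok (normalize p)" if "p \<in> Mor Paths" for p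
    using that
  proof (induction rule: P.free_induct)
    case (Idn x)
    then have "normalize (Idn Paths x) = CellId Paths (Idn Paths x)"
      by (auto simp: normalize_def normal_def)
    then show ?case using id[of "Idn Paths x"] Idn by (metis P.Idn_Mor)
  next
    case (Comp e q)
    then obtain a b where e: "e = single (a, b)" "a \<in> edges X" "b \<in> edges Y"
      by (auto simp: edges_Paths)
    let ?g = "snd (pcomp q)"
    let ?w = "at_mor (left (Cod Y ?g)) (fst (pcomp q))" and ?v = "at_mor (right (Dom X a)) b"
    have q: "fst q = (Cod X a, Cod Y b)" "q \<in> Mor Paths" using Comp e by simp_all
    have m: "?w \<in> Mor Paths" "?v \<in> Mor Paths" using e q by simp_all
    have sw: "ok (swap a ?g)" unfolding ok_def by (rule swap) (use e q in simp_all)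
    have sv: "ok (HComp Paths (swap a ?g) (CellId Paths ?v))"
      by (rule H[OF _ _ _ id[OF m(2)] sw]) (use e q in \<open>simp_all add: swap_def\<close>)
    have wsv: "ok (HComp Paths (CellId Paths ?w) (HComp Paths (swap a ?g) (CellId Paths ?v)))"
      by (rule H[OF _ _ _ sv id[OF m(1)]]) (use e q in \<open>simp_all add: swap_def\<close>)
    have ns: "ok (HComp Paths (normalize q) (split a b))"
      by (rule H[OF _ _ _ split[OF e(2,3), folded ok_def] Comp.IH])
        (use e q in \<open>simp_all add: split_def normalize_def prod_eq_iff\<close>)
    have "ok (normalize (path_append q e))"
      unfolding e(1) normalize_Comp[OF e(2,3) q(2,1)]
      by (rule V[OF _ _ _ ns wsv])
        (use e q in \<open>simp_all add: swap_def split_def normalize_def normal_def prod_eq_iff path_append_assoc\<close>)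
    then show ?case by simp
  qed
  obtain p q \<beta> \<gamma> where e: "\<alpha> = (p, q, \<beta>, \<gamma>)" by (cases \<alpha>)
  note a = Cell_PathsD[OF \<alpha>, unfolded e, simplified] Cell_parts[OF \<alpha>, unfolded e, simplified]
  note par = Cell_parallel[OF \<alpha>, unfolded e, simplified]
  have s: "Src Paths (normalize q) = Tgt Paths \<alpha>" by (simp add: e normalize_def)
  have nq: "normalize q \<in> Cell Paths" using a by simp
  have o: "Dom X (Src X \<beta>) \<in> Obj X" "Cod Y (Src Y \<gamma>) \<in> Obj Y"
    by (rule X.Dom_Obj Y.Cod_Obj, rule X.cell_simps(1) Y.cell_simps(1), use a in simp)+
  let ?LR = "HComp Paths (at_cell (left (Cod Y (Src Y \<gamma>))) \<beta>) (at_cell (right (Dom X (Src X \<beta>))) \<gamma>)"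
  have lr: "ok ?LR"
    by (rule H[OF _ _ _ right[folded ok_def] left[folded ok_def]]) (use a o in simp_all)
  have "ok (VComp Paths ?LR (normalize p))"
    by (rule V[OF _ _ _ n lr]) (use a o par in \<open>simp_all add: normalize_def normal_def\<close>)
  then have "VComp W (at_cell F (normalize q)) (at_cell F \<alpha>) = VComp W (at_cell F (normalize q)) (at_cell G \<alpha>)"
    using normalize_natural[OF \<alpha> e] F.at_cell_VComp[OF \<alpha> nq s] G.at_cell_VComp[OF \<alpha> nq s] n[of q] a
    by (simp add: ok_def)
  moreover have "F.Y.invertible (at_cell F (normalize q))"
    using a by (intro F.invertible_at_cell invertible_normalize) simp
  ultimately show ?thesis
    using F.Y.VComp_cancel_left[of "at_cell F (normalize q)" "at_cell F \<alpha>" "at_cell G \<alpha>"]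
      F.at_cell_Cell[OF \<alpha>] G.at_cell_Cell[OF \<alpha>] F.Tgt_at_cell[OF \<alpha>] G.Tgt_at_cell[OF \<alpha>] F.Src_at_cell[OF nq]
      mor[of q] s a(1,2) by (simp add: e normalize_def)
qed

section \<open>Relations between the generating cells\<close>

lemmas left_functor = left_simps(1) two_functor.functor_laws[OF two_functor_left]
lemmas right_functor = right_simps(1) two_functor.functor_laws[OF two_functor_right]

lemma split_functor:
  assumes "a \<in> edges X" "e \<in> edges Y"
  shows "split a e \<in> Cell Paths" "P.invertible (split a e)" "Src Paths (split a e) = single (a, e)"
    "Tgt Paths (split a e) = Comp Paths (at_mor (left (Cod Y e)) a) (at_mor (right (Dom X a)) e)"
  using assms by (simp_all add: invertible_split) (simp_all add: split_def normal_def)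

lemma swap_functor:
  assumes "f \<in> Mor X" "g \<in> Mor Y"
  shows "swap f g \<in> Cell Paths" "P.invertible (swap f g)"
    "Src Paths (swap f g) = Comp Paths (at_mor (right (Cod X f)) g) (at_mor (left (Dom Y g)) f)"
    "Tgt Paths (swap f g) = Comp Paths (at_mor (left (Cod Y g)) f) (at_mor (right (Dom X f)) g)"
  using assms by (simp_all add: invertible_swap) (simp_all add: swap_def normal_def)

lemma single_functor:
  assumes "a \<in> edges X" "e \<in> edges Y"
  shows "single (a, e) \<in> edges Paths" "single (a, e) \<in> Mor Paths"
    "Dom Paths (single (a, e)) = (Dom X a, Dom Y e)" "Cod Paths (single (a, e)) = (Cod X a, Cod Y e)"
  using assms by (auto simp: edges_Paths)

text \<open>These two degenerate cases become conditions on the edges of the exponential: an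
  identity of the first factor yields the degenerate edge, an identity of the second yields the
  plain component of the transformation.\<close>

lemma split_Idn_left:
  assumes "x \<in> Obj X" "e \<in> edges Y"
  shows "split (Idn X x) e = CellId Paths (at_mor (right x) e)"
  using assms right_edges[OF assms] by (simp add: split_def normal_def)

lemma split_Idn_right:
  assumes "a \<in> edges X" "y \<in> Obj Y"
  shows "split a (Idn Y y) = CellId Paths (at_mor (left y) a)"
  using assms left_edges[OF assms(2,1)] by (simp add: split_def normal_def)

text \<open>Under a morphism out of the product, the laws in the \<open>Y\<close>-variable
  (\<open>swap_Idn_right\<close>, \<open>swap_Comp_right\<close>, \<open>swap_natural_right\<close>)
  become axioms of a pseudonatural transformation. Those in the \<open>X\<close>-variable become
  identities and composites of transformations and the modification axiom.\<close>

lemma swap_Idn_left: "x \<in> Obj X \<Longrightarrow> g \<in> Mor Y \<Longrightarrow> swap (Idn X x) g = CellId Paths (at_mor (right x) g)"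
  and swap_Idn_right: "f \<in> Mor X \<Longrightarrow> y \<in> Obj Y \<Longrightarrow> swap f (Idn Y y) = CellId Paths (at_mor (left y) f)"
  by (simp_all add: swap_def normal_def)

lemma swap_Comp_left:
  assumes "f \<in> Mor X" "f' \<in> Mor X" "g \<in> Mor Y" "Dom X f' = Cod X f"
  shows "swap (Comp X f' f) g =
    VComp Paths (HComp Paths (CellId Paths (at_mor (left (Cod Y g)) f')) (swap f g))
      (HComp Paths (swap f' g) (CellId Paths (at_mor (left (Dom Y g)) f)))"
  using assms by (simp add: swap_def normal_def path_append_assoc)

lemma swap_Comp_right:
  assumes "f \<in> Mor X" "g \<in> Mor Y" "g' \<in> Mor Y" "Dom Y g' = Cod Y g"
  shows "swap f (Comp Y g' g) =
    VComp Paths (HComp Paths (swap f g') (CellId Paths (at_mor (right (Dom X f)) g)))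
      (HComp Paths (CellId Paths (at_mor (right (Cod X f)) g')) (swap f g))"
  using assms by (simp add: swap_def normal_def path_append_assoc)

lemma swap_natural_left:
  assumes "\<alpha> \<in> Cell X" "g \<in> Mor Y"
  shows "VComp Paths (HComp Paths (at_cell (left (Cod Y g)) \<alpha>) (CellId Paths (at_mor (right (Dom X (Src X \<alpha>))) g)))
      (swap (Src X \<alpha>) g) =
    VComp Paths (swap (Tgt X \<alpha>) g) (HComp Paths (CellId Paths (at_mor (right (Cod X (Src X \<alpha>))) g)) (at_cell (left (Dom Y g)) \<alpha>))"
  using assms by (simp add: swap_def normal_def)

lemma swap_natural_right:
  assumes "f \<in> Mor X" "\<beta> \<in> Cell Y"
  shows "VComp Paths (swap f (Tgt Y \<beta>)) (HComp Paths (at_cell (right (Cod X f)) \<beta>) (CellId Paths (at_mor (left (Dom Y (Src Y \<beta>))) f))) =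
    VComp Paths (HComp Paths (CellId Paths (at_mor (left (Cod Y (Src Y \<beta>))) f)) (at_cell (right (Dom X f)) \<beta>)) (swap f (Src Y \<beta>))"
  using assms by (simp add: swap_def normal_def)

end

section \<open>Strictification of pseudofunctors\<close>

context two_cat
begin

lemma HComp_CellId_left: "\<alpha> \<in> Cell X \<Longrightarrow> f \<in> Mor X \<Longrightarrow> g \<in> Mor X \<Longrightarrow>
    Dom X f = Cod X (Src X \<alpha>) \<Longrightarrow> Dom X g = Cod X f \<Longrightarrow>
    HComp X (CellId X g) (HComp X (CellId X f) \<alpha>) = HComp X (CellId X (Comp X g f)) \<alpha>"
  using cell_simps(15)[of \<alpha> "CellId X f" "CellId X g"] by (simp del: cell_simps(15))

text \<open>The two whiskerings commute inside a longer composite as well; \<open>\<gamma>\<close>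
  is whatever is applied before them.\<close>

lemma exchange:
  assumes "\<alpha> \<in> Cell X" "\<beta> \<in> Cell X" "\<gamma> \<in> Cell X" "Dom X (Src X \<beta>) = Cod X (Src X \<alpha>)"
    "Tgt X \<gamma> = Comp X (Src X \<beta>) (Src X \<alpha>)"
  shows "VComp X (HComp X (CellId X (Tgt X \<beta>)) \<alpha>) (VComp X (HComp X \<beta> (CellId X (Src X \<alpha>))) \<gamma>) =
    VComp X (HComp X \<beta> (CellId X (Tgt X \<alpha>))) (VComp X (HComp X (CellId X (Src X \<beta>)) \<alpha>) \<gamma>)"
  using HComp_left_right[OF assms(1,2,4) refl refl] HComp_right_left[OF assms(1,2,4) refl refl]
    cell_simps(11)[of \<gamma> "HComp X \<beta> (CellId X (Src X \<alpha>))" "HComp X (CellId X (Tgt X \<beta>)) \<alpha>"]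
    cell_simps(11)[of \<gamma> "HComp X (CellId X (Src X \<beta>)) \<alpha>" "HComp X \<beta> (CellId X (Tgt X \<alpha>))"]
    assms by (simp del: cell_simps(11))

definition inverse_cell :: "'c \<Rightarrow> 'c" where
  "inverse_cell \<alpha> = (SOME \<beta>. vertical_inverse \<alpha> \<beta>)"

lemma inverse_cell: "invertible \<alpha> \<Longrightarrow> vertical_inverse \<alpha> (inverse_cell \<alpha>)"
  unfolding invertible_def inverse_cell_def by (rule someI_ex)

end

text \<open>A pseudofunctor that preserves identity 1-cells on the nose and has identities as unit
  constraints, so \<open>\<phi>\<close> is the only constraint to be given. Evaluation is of this
  kind.\<close>

locale pseudofunctor = K: two_cat K + Y: two_cat Y
  for K :: "('o, 'm, 'c, 'y) two_category_scheme" and Y :: "('p, 'n, 'd, 'z) two_category_scheme" +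
  fixes N :: "('o, 'p, 'm, 'n, 'c, 'd) cell_map" and \<phi> :: "'m \<Rightarrow> 'm \<Rightarrow> 'd"
  assumes N_obj [simp]: "x \<in> Obj K \<Longrightarrow> at_obj N x \<in> Obj Y"
    and N_mor [simp]: "f \<in> Mor K \<Longrightarrow> at_mor N f \<in> Mor Y"
      "f \<in> Mor K \<Longrightarrow> Dom Y (at_mor N f) = at_obj N (Dom K f)"
      "f \<in> Mor K \<Longrightarrow> Cod Y (at_mor N f) = at_obj N (Cod K f)"
    and N_Idn [simp]: "x \<in> Obj K \<Longrightarrow> at_mor N (Idn K x) = Idn Y (at_obj N x)"
    and N_cell [simp]: "k \<in> Cell K \<Longrightarrow> at_cell N k \<in> Cell Y"
      "k \<in> Cell K \<Longrightarrow> Src Y (at_cell N k) = at_mor N (Src K k)"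
      "k \<in> Cell K \<Longrightarrow> Tgt Y (at_cell N k) = at_mor N (Tgt K k)"
    and N_CellId [simp]: "f \<in> Mor K \<Longrightarrow> at_cell N (CellId K f) = CellId Y (at_mor N f)"
    and N_VComp [simp]: "k \<in> Cell K \<Longrightarrow> l \<in> Cell K \<Longrightarrow> Src K l = Tgt K k \<Longrightarrow>
      at_cell N (VComp K l k) = VComp Y (at_cell N l) (at_cell N k)"
    and \<phi>_invertible [simp]: "f \<in> Mor K \<Longrightarrow> g \<in> Mor K \<Longrightarrow> Dom K g = Cod K f \<Longrightarrow> Y.invertible (\<phi> g f)"
    and \<phi>_Src [simp]: "f \<in> Mor K \<Longrightarrow> g \<in> Mor K \<Longrightarrow> Dom K g = Cod K f \<Longrightarrow>
      Src Y (\<phi> g f) = Comp Y (at_mor N g) (at_mor N f)"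
    and \<phi>_Tgt [simp]: "f \<in> Mor K \<Longrightarrow> g \<in> Mor K \<Longrightarrow> Dom K g = Cod K f \<Longrightarrow>
      Tgt Y (\<phi> g f) = at_mor N (Comp K g f)"
    and \<phi>_natural: "k \<in> Cell K \<Longrightarrow> l \<in> Cell K \<Longrightarrow> Dom K (Src K l) = Cod K (Src K k) \<Longrightarrow>
      VComp Y (\<phi> (Tgt K l) (Tgt K k)) (HComp Y (at_cell N l) (at_cell N k)) =
      VComp Y (at_cell N (HComp K l k)) (\<phi> (Src K l) (Src K k))"
    and \<phi>_assoc: "f \<in> Mor K \<Longrightarrow> g \<in> Mor K \<Longrightarrow> h \<in> Mor K \<Longrightarrow> Dom K g = Cod K f \<Longrightarrow> Dom K h = Cod K g \<Longrightarrow>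
      VComp Y (\<phi> (Comp K h g) f) (HComp Y (\<phi> h g) (CellId Y (at_mor N f))) =
      VComp Y (\<phi> h (Comp K g f)) (HComp Y (CellId Y (at_mor N h)) (\<phi> g f))"
    and \<phi>_Idn_right [simp]: "f \<in> Mor K \<Longrightarrow> Dom K f = x \<Longrightarrow> \<phi> f (Idn K x) = CellId Y (at_mor N f)"
    and \<phi>_Idn_left [simp]: "f \<in> Mor K \<Longrightarrow> Cod K f = x \<Longrightarrow> \<phi> (Idn K x) f = CellId Y (at_mor N f)"
begin

lemma \<phi>_Cell [simp]: "f \<in> Mor K \<Longrightarrow> g \<in> Mor K \<Longrightarrow> Dom K g = Cod K f \<Longrightarrow> \<phi> g f \<in> Cell Y"
  by simp

end

lemma pseudofunctor_comp:
  assumes "two_functor Z K W" "pseudofunctor K Y N \<phi>"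
  shows "pseudofunctor Z Y (comp_map N W) (\<lambda>g f. \<phi> (at_mor W g) (at_mor W f))"
proof -
  interpret W: two_functor Z K W by fact
  interpret N: pseudofunctor K Y N \<phi> by fact
  show ?thesis
  proof unfold_locales
    fix k l assume "k \<in> Cell Z" "l \<in> Cell Z" "Dom Z (Src Z l) = Cod Z (Src Z k)"
    then show "VComp Y (\<phi> (at_mor W (Tgt Z l)) (at_mor W (Tgt Z k)))
          (HComp Y (at_cell (comp_map N W) l) (at_cell (comp_map N W) k)) =
        VComp Y (at_cell (comp_map N W) (HComp Z l k)) (\<phi> (at_mor W (Src Z l)) (at_mor W (Src Z k)))"
      using N.\<phi>_natural[of "at_cell W k" "at_cell W l"] by simp
  next
    fix f g h assume "f \<in> Mor Z" "g \<in> Mor Z" "h \<in> Mor Z" "Dom Z g = Cod Z f" "Dom Z h = Cod Z g"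
    then show "VComp Y (\<phi> (at_mor W (Comp Z h g)) (at_mor W f))
          (HComp Y (\<phi> (at_mor W h) (at_mor W g)) (CellId Y (at_mor (comp_map N W) f))) =
        VComp Y (\<phi> (at_mor W h) (at_mor W (Comp Z g f)))
          (HComp Y (CellId Y (at_mor (comp_map N W) h)) (\<phi> (at_mor W g) (at_mor W f)))"
      using N.\<phi>_assoc[of "at_mor W f" "at_mor W g" "at_mor W h"] by simp
  qed auto
qed

text \<open>The value \<open>s r\<close> on an edge is prescribed and merely isomorphic, through
  \<open>\<tau> r\<close>, to the value of the pseudofunctor. This freedom allows evaluation to send
  edges to edges; degenerate edges still go to identities.\<close>

locale strictification = path_graph K E u i + pseudofunctor K Y N \<phi>
  for K :: "('o, 'm, 'c, 'y) two_category_scheme" and E :: "'e set" and u i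
    and Y :: "('p, 'n, 'd, 'z) two_category_scheme" and N \<phi> +
  fixes s :: "'e \<Rightarrow> 'n" and \<tau> :: "'e \<Rightarrow> 'd"
  assumes s_Mor [simp]: "r \<in> E \<Longrightarrow> s r \<in> Mor Y"
    and Dom_s [simp]: "r \<in> E \<Longrightarrow> Dom Y (s r) = at_obj N (Dom K (u r))"
    and Cod_s [simp]: "r \<in> E \<Longrightarrow> Cod Y (s r) = at_obj N (Cod K (u r))"
    and s_i [simp]: "x \<in> Obj K \<Longrightarrow> s (i x) = Idn Y (at_obj N x)"
    and \<tau>_invertible [simp]: "r \<in> E \<Longrightarrow> Y.invertible (\<tau> r)"
    and Src_\<tau> [simp]: "r \<in> E \<Longrightarrow> Src Y (\<tau> r) = s r"
    and Tgt_\<tau> [simp]: "r \<in> E \<Longrightarrow> Tgt Y (\<tau> r) = at_mor N (u r)"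
    and \<tau>_i [simp]: "x \<in> Obj K \<Longrightarrow> \<tau> (i x) = CellId Y (Idn Y (at_obj N x))"
begin

lemma \<tau>_Cell [simp]: "r \<in> E \<Longrightarrow> \<tau> r \<in> Cell Y"
  by simp

primrec strict_list :: "'e list \<Rightarrow> 'o \<Rightarrow> 'n" where
  "strict_list [] x = Idn Y (at_obj N x)"
| "strict_list (r # es) x = Comp Y (strict_list es (Cod K (u r))) (s r)"

text \<open>The isomorphism from the strict value of a path to the pseudofunctor at its composite:
  the comparisons \<open>\<tau>\<close> of the edges pasted with the constraints
  \<open>\<phi>\<close>.\<close>

primrec coherence_list :: "'e list \<Rightarrow> 'o \<Rightarrow> 'd" where
  "coherence_list [] x = CellId Y (Idn Y (at_obj N x))"
| "coherence_list (r # es) x =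
    VComp Y (\<phi> (list_comp K u (Cod K (u r)) es) (u r)) (HComp Y (coherence_list es (Cod K (u r))) (\<tau> r))"

definition strict_mor :: "'o \<times> 'e list \<Rightarrow> 'n" where
  "strict_mor p = strict_list (snd p) (fst p)"

definition coherence :: "'o \<times> 'e list \<Rightarrow> 'd" where
  "coherence p = coherence_list (snd p) (fst p)"

lemma strict_mor_Nil [simp]: "strict_mor (x, []) = Idn Y (at_obj N x)"
  and coherence_Nil [simp]: "coherence (x, []) = CellId Y (Idn Y (at_obj N x))"
  by (simp_all add: strict_mor_def coherence_def)

lemma strict_list_Mor: "is_path K E u i x es \<Longrightarrow> strict_list es x \<in> Mor Y \<and>
  Dom Y (strict_list es x) = at_obj N x \<and> Cod Y (strict_list es x) = at_obj N (Cod K (list_comp K u x es))"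
  by (induction es arbitrary: x) (use list_comp_Mor in \<open>auto\<close>)

lemma strict_mor [simp]: "p \<in> Mor Paths \<Longrightarrow> strict_mor p \<in> Mor Y"
    "p \<in> Mor Paths \<Longrightarrow> Dom Y (strict_mor p) = at_obj N (fst p)"
    "p \<in> Mor Paths \<Longrightarrow> Cod Y (strict_mor p) = at_obj N (Cod K (pcomp p))"
  using strict_list_Mor by (auto simp: Mor_Paths strict_mor_def path_comp_def)

lemma coherence_list_Cell: "is_path K E u i x es \<Longrightarrow> Y.invertible (coherence_list es x) \<and>
  Src Y (coherence_list es x) = strict_list es x \<and> Tgt Y (coherence_list es x) = at_mor N (list_comp K u x es)"
proof (induction es arbitrary: x)
  case (Cons r es)
  then show ?case using list_comp_Mor[of _ es] strict_list_Mor[of _ es] by simp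
qed simp

lemma coherence [simp]: "p \<in> Mor Paths \<Longrightarrow> Y.invertible (coherence p)"
    "p \<in> Mor Paths \<Longrightarrow> Src Y (coherence p) = strict_mor p"
    "p \<in> Mor Paths \<Longrightarrow> Tgt Y (coherence p) = at_mor N (pcomp p)"
  using coherence_list_Cell by (auto simp: Mor_Paths strict_mor_def coherence_def path_comp_def)

lemma coherence_Cell [simp]: "p \<in> Mor Paths \<Longrightarrow> coherence p \<in> Cell Y"
  by simp

lemma append_single:
  assumes "q \<in> Mor Paths" "r \<in> E" "fst q = Cod K (u r)"
  shows "strict_mor (path_append q (single r)) = Comp Y (strict_mor q) (s r)"
    and "coherence (path_append q (single r)) = VComp Y (\<phi> (pcomp q) (u r)) (HComp Y (coherence q) (\<tau> r))"
proof -
  have "strict_mor (path_append q (single r)) = Comp Y (strict_mor q) (s r) \<and>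
    coherence (path_append q (single r)) = VComp Y (\<phi> (pcomp q) (u r)) (HComp Y (coherence q) (\<tau> r))"
  proof (cases "r = i (Dom K (u r))")
    case True
    define x where "x = Dom K (u r)"
    have r: "r = i x" "x \<in> Obj K" using True assms by (simp_all add: x_def)
    then show ?thesis using assms(1,3) by (simp add: path_append_Nil)
  next
    case False
    then have "path_append q (single r) = (Dom K (u r), r # snd q)" by (simp add: path_append_def single_def)
    then show ?thesis using assms(3)[symmetric] by (simp add: strict_mor_def coherence_def path_comp_def)
  qed
  then show "strict_mor (path_append q (single r)) = Comp Y (strict_mor q) (s r)"
    "coherence (path_append q (single r)) = VComp Y (\<phi> (pcomp q) (u r)) (HComp Y (coherence q) (\<tau> r))"
    by auto
qed

lemma strict_mor_single [simp]: "r \<in> E \<Longrightarrow> strict_mor (single r) = s r"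
  and coherence_single [simp]: "r \<in> E \<Longrightarrow> coherence (single r) = \<tau> r"
  using append_single[of "(Cod K (u r), [])" r] by simp_all

lemma strict_mor_append [simp]:
  assumes "p \<in> Mor Paths" "q \<in> Mor Paths" "fst q = Cod K (pcomp p)"
  shows "strict_mor (path_append q p) = Comp Y (strict_mor q) (strict_mor p)"
proof -
  have "fst q = Cod K (pcomp p) \<longrightarrow> ?thesis" using assms(1)
  proof (induction rule: P.free_induct)
    case (Comp e p)
    then obtain r where r: "e = single r" "r \<in> E" by (auto simp: edges_Paths)
    show ?case using Comp r assms(2) append_single(1)[of "path_append q p" r] append_single(1)[of p r]
      by (auto simp: path_append_assoc)
  qed (use assms(2) in simp)
  then show ?thesis using assms(3) by simp
qed

text \<open>Coherence is built edge by edge; its compatibility with arbitrary concatenation is the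
  associativity law of \<open>\<phi>\<close>, applied once for every edge of \<open>p\<close>, with
  interchange to separate the factors.\<close>

lemma coherence_append [simp]:
  assumes "p \<in> Mor Paths" "q \<in> Mor Paths" "fst q = Cod K (pcomp p)"
  shows "coherence (path_append q p) = VComp Y (\<phi> (pcomp q) (pcomp p)) (HComp Y (coherence q) (coherence p))"
proof -
  have "fst q = Cod K (pcomp p) \<longrightarrow> ?thesis" using assms(1)
  proof (induction rule: P.free_induct)
    case (Comp e p)
    then obtain r where r: "e = single r" "r \<in> E" by (auto simp: edges_Paths)
    have p: "fst p = Cod K (u r)" "p \<in> Mor Paths" using Comp r by simp_all
    show ?case
    proof
      assume a: "fst q = Cod K (pcomp (Comp Paths p e))"
      then have q: "fst q = Cod K (pcomp p)" using p r by simp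
      have "coherence (path_append q (path_append p e)) =
        VComp Y (\<phi> (Comp K (pcomp q) (pcomp p)) (u r)) (HComp Y (VComp Y (\<phi> (pcomp q) (pcomp p)) (HComp Y (coherence q) (coherence p))) (\<tau> r))"
        using append_single(2)[of "path_append q p" r] p q r assms(2) Comp.IH by (simp add: path_append_assoc)
      also have "HComp Y (VComp Y (\<phi> (pcomp q) (pcomp p)) (HComp Y (coherence q) (coherence p))) (\<tau> r) =
        VComp Y (HComp Y (\<phi> (pcomp q) (pcomp p)) (CellId Y (at_mor N (u r)))) (HComp Y (coherence q) (HComp Y (coherence p) (\<tau> r)))"
        using Y.interchange[of "\<tau> r" "CellId Y (at_mor N (u r))" "HComp Y (coherence q) (coherence p)" "\<phi> (pcomp q) (pcomp p)"] p q r assms(2) by simp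
      also have "VComp Y (\<phi> (Comp K (pcomp q) (pcomp p)) (u r)) \<dots> =
        VComp Y (VComp Y (\<phi> (pcomp q) (Comp K (pcomp p) (u r))) (HComp Y (CellId Y (at_mor N (pcomp q))) (\<phi> (pcomp p) (u r))))
          (HComp Y (coherence q) (HComp Y (coherence p) (\<tau> r)))"
        unfolding \<phi>_assoc[of "u r" "pcomp p" "pcomp q", symmetric, OF u_Mor[OF r(2)] pcomp_Mor[OF p(2)] pcomp_Mor[OF assms(2)],
           unfolded Dom_pcomp[OF p(2)] Dom_pcomp[OF assms(2)], OF p(1) q]
        using p q r assms(2) by simp
      also have "\<dots> = VComp Y (\<phi> (pcomp q) (Comp K (pcomp p) (u r))) (HComp Y (coherence q) (VComp Y (\<phi> (pcomp p) (u r)) (HComp Y (coherence p) (\<tau> r))))"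
        using Y.interchange[of "HComp Y (coherence p) (\<tau> r)" "\<phi> (pcomp p) (u r)" "coherence q" "CellId Y (at_mor N (pcomp q))"] p q r assms(2) by simp
      finally show "coherence (path_append q (Comp Paths p e)) = VComp Y (\<phi> (pcomp q) (pcomp (Comp Paths p e))) (HComp Y (coherence q) (coherence (Comp Paths p e)))"
        using append_single(2)[OF p(2) r(2) p(1)] r p by simp
    qed
  qed (use assms(2) in simp)
  then show ?thesis using assms(3) by simp
qed

definition strict_cell where
  "strict_cell \<alpha> = VComp Y (Y.inverse_cell (coherence (fst (snd \<alpha>))))
     (VComp Y (at_cell N (snd (snd \<alpha>))) (coherence (fst \<alpha>)))"

lemma strict_cell:
  assumes "\<alpha> \<in> Cell Paths"
  shows "strict_cell \<alpha> \<in> Cell Y" "Src Y (strict_cell \<alpha>) = strict_mor (fst \<alpha>)"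
    "Tgt Y (strict_cell \<alpha>) = strict_mor (fst (snd \<alpha>))"
    "VComp Y (coherence (fst (snd \<alpha>))) (strict_cell \<alpha>) = VComp Y (at_cell N (snd (snd \<alpha>))) (coherence (fst \<alpha>))"
proof -
  have v: "Y.vertical_inverse (coherence (fst (snd \<alpha>))) (Y.inverse_cell (coherence (fst (snd \<alpha>))))"
    using assms by (intro Y.inverse_cell) simp
  then show "strict_cell \<alpha> \<in> Cell Y" "Src Y (strict_cell \<alpha>) = strict_mor (fst \<alpha>)"
    "Tgt Y (strict_cell \<alpha>) = strict_mor (fst (snd \<alpha>))"
    using assms by (simp_all add: strict_cell_def Y.vertical_inverse_def)
  show "VComp Y (coherence (fst (snd \<alpha>))) (strict_cell \<alpha>) = VComp Y (at_cell N (snd (snd \<alpha>))) (coherence (fst \<alpha>))"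
    using v assms Y.cell_simps(11)[of "VComp Y (at_cell N (snd (snd \<alpha>))) (coherence (fst \<alpha>))" "Y.inverse_cell (coherence (fst (snd \<alpha>)))" "coherence (fst (snd \<alpha>))"]
    by (simp add: strict_cell_def Y.vertical_inverse_def del: Y.cell_simps(11))
qed

text \<open>Naturality of coherence characterizes \<open>strict_cell\<close>, because the coherence
  of the target can be cancelled. Laws and values are verified through this equation, so the chosen
  inverse does not matter.\<close>

lemma strict_cell_eqI:
  assumes "\<alpha> \<in> Cell Paths" "\<gamma> \<in> Cell Y" "Tgt Y \<gamma> = strict_mor (fst (snd \<alpha>))"
    "VComp Y (coherence (fst (snd \<alpha>))) \<gamma> = VComp Y (at_cell N (snd (snd \<alpha>))) (coherence (fst \<alpha>))"
  shows "strict_cell \<alpha> = \<gamma>"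
proof (rule Y.VComp_cancel_left)
  show "VComp Y (coherence (fst (snd \<alpha>))) (strict_cell \<alpha>) = VComp Y (coherence (fst (snd \<alpha>))) \<gamma>"
    unfolding assms(4) by (rule strict_cell(4)[OF assms(1)])
qed (simp_all add: assms(1-3) strict_cell(1-3)[OF assms(1)])

definition strict_map where
  "strict_map = \<lparr>at_obj = at_obj N, at_mor = strict_mor, at_cell = strict_cell\<rparr>"

lemma strict_map_simps [simp]: "at_obj strict_map x = at_obj N x" "at_mor strict_map p = strict_mor p"
  "at_cell strict_map \<alpha> = strict_cell \<alpha>"
  by (simp_all add: strict_map_def)

text \<open>On 1-cells, composition is concatenation and is preserved strictly. On cells, the
  candidate for each composite solves the equation that defines the strict cell: vertical composites
  stack two naturality squares, horizontal ones place them side by side and use naturality of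
  \<open>\<phi>\<close>.\<close>

lemma two_functor_strict_map: "two_functor Paths Y strict_map"
proof (rule two_functorI, goal_cases)
  case (8 f)
  then have "f \<in> Mor Paths" by simp
  then have "strict_cell (CellId Paths f) = CellId Y (strict_mor f)"
    by (intro strict_cell_eqI P.cell_simps(3)) simp_all
  then show ?case by simp
next
  case (9 \<alpha> \<beta>)
  then obtain p q k r l where e: "\<alpha> = (p, q, k)" "\<beta> = (q, r, l)" by (cases \<alpha>; cases \<beta>) simp
  note c = Cell_PathsD[OF 9(1)[unfolded e], simplified] Cell_PathsD[OF 9(2)[unfolded e], simplified]
  note s = strict_cell[OF 9(1), unfolded e, simplified] strict_cell[OF 9(2), unfolded e, simplified]
  let ?\<alpha> = "strict_cell (p, q, k)" and ?\<beta> = "strict_cell (q, r, l)"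
  have "strict_cell (VComp Paths (q, r, l) (p, q, k)) = VComp Y ?\<beta> ?\<alpha>"
  proof (rule strict_cell_eqI)
    have "VComp Y (coherence r) (VComp Y ?\<beta> ?\<alpha>) = VComp Y (VComp Y (coherence r) ?\<beta>) ?\<alpha>"
      using s(1-3,5-7) c by simp
    also have "\<dots> = VComp Y (at_cell N l) (VComp Y (coherence q) ?\<alpha>)"
      unfolding s(8) using s(1-3) c by simp
    also have "\<dots> = VComp Y (at_cell N l) (VComp Y (at_cell N k) (coherence p))" unfolding s(4) ..
    finally show "VComp Y (coherence (fst (snd (VComp Paths (q, r, l) (p, q, k))))) (VComp Y ?\<beta> ?\<alpha>) =
      VComp Y (at_cell N (snd (snd (VComp Paths (q, r, l) (p, q, k))))) (coherence (fst (VComp Paths (q, r, l) (p, q, k))))"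
      using c by simp
  qed (use s c in simp_all)
  then show ?case by (simp add: e)
next
  case (10 \<alpha> \<beta>)
  obtain p q k p' q' l where e: "\<alpha> = (p, q, k)" "\<beta> = (p', q', l)" by (cases \<alpha>; cases \<beta>)
  note c = Cell_PathsD[OF 10(1)[unfolded e], simplified] Cell_PathsD[OF 10(2)[unfolded e], simplified]
  note s = strict_cell[OF 10(1), unfolded e, simplified] strict_cell[OF 10(2), unfolded e, simplified]
  note par = Cell_parallel[OF 10(1), unfolded e, simplified] Cell_parallel[OF 10(2), unfolded e, simplified]
  have st: "fst p' = Cod K (pcomp p)" using 10(3) by (simp add: e)
  let ?\<alpha> = "strict_cell (p, q, k)" and ?\<beta> = "strict_cell (p', q', l)"
  let ?H = "HComp Paths (p', q', l) (p, q, k)"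
  have "strict_cell ?H = HComp Y ?\<beta> ?\<alpha>"
  proof (rule strict_cell_eqI)
    have "VComp Y (coherence (fst (snd ?H))) (HComp Y ?\<beta> ?\<alpha>) =
      VComp Y (\<phi> (pcomp q') (pcomp q)) (VComp Y (HComp Y (coherence q') (coherence q)) (HComp Y ?\<beta> ?\<alpha>))"
      using s(1-3,5-7) c st par by simp
    also have "\<dots> = VComp Y (\<phi> (pcomp q') (pcomp q))
      (HComp Y (VComp Y (at_cell N l) (coherence p')) (VComp Y (at_cell N k) (coherence p)))"
      using s c st par Y.interchange[of ?\<alpha> "coherence q" ?\<beta> "coherence q'"] by simp
    also have "\<dots> = VComp Y (VComp Y (\<phi> (pcomp q') (pcomp q)) (HComp Y (at_cell N l) (at_cell N k)))
      (HComp Y (coherence p') (coherence p))"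
      using c st par by (simp add: Y.interchange)
    also have "\<dots> = VComp Y (VComp Y (at_cell N (HComp K l k)) (\<phi> (pcomp p') (pcomp p)))
      (HComp Y (coherence p') (coherence p))"
      using \<phi>_natural[of k l] c st by simp
    also have "\<dots> = VComp Y (at_cell N (snd (snd ?H))) (coherence (fst ?H))"
      using c st par by simp
    finally show "VComp Y (coherence (fst (snd ?H))) (HComp Y ?\<beta> ?\<alpha>) =
      VComp Y (at_cell N (snd (snd ?H))) (coherence (fst ?H))" .
  qed (use s c st par in simp_all)
  then show ?case by (simp add: e)
qed (simp_all add: P.two_cat_axioms Y.two_cat_axioms strict_cell)

end

section \<open>Pseudonatural transformations and modifications\<close>

record ('o, 'p, 'm, 'n, 'c, 'd) transformation =
  tr_dom :: "('o, 'p, 'm, 'n, 'c, 'd) cell_map"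
  tr_cod :: "('o, 'p, 'm, 'n, 'c, 'd) cell_map"
  tr_obj :: "'o \<Rightarrow> 'n"
  tr_mor :: "'m \<Rightarrow> 'd"

record ('o, 'p, 'm, 'n, 'c, 'd) modification =
  md_src :: "('o, 'p, 'm, 'n, 'c, 'd) transformation"
  md_tgt :: "('o, 'p, 'm, 'n, 'c, 'd) transformation"
  md_obj :: "'o \<Rightarrow> 'd"

text \<open>Being the objects of a 2-category, these are compared by equality; fixing the values off
  the carriers leaves one representative of each morphism.\<close>

definition extensional_functors ::
  "('o, 'm, 'c, 'y) two_category_scheme \<Rightarrow> ('p, 'n, 'd, 'z) two_category_scheme \<Rightarrow>
   ('o, 'p, 'm, 'n, 'c, 'd) cell_map set"
where
  "extensional_functors X Y = {F. flex_functor X Y F \<and> at_obj F \<in> extensional (Obj X) \<and>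
     at_mor F \<in> extensional (Mor X) \<and> at_cell F \<in> extensional (Cell X)}"

locale functors = X: flex X + Y: flex Y
  for X :: "('o, 'm, 'c) two_category" and Y :: "('p, 'n, 'd) two_category"
begin

text \<open>The components are arbitrary 1-cells of \<open>Y\<close>, not only edges. For
  \<open>t : F \<rightarrow> G\<close> and \<open>g : x \<rightarrow> y\<close> the cell runs from
  \<open>G g \<circ> t x\<close> to \<open>t y \<circ> F g\<close>, which is the direction of
  \<open>swap\<close>.\<close>

definition pseudonatural :: "('o, 'p, 'm, 'n, 'c, 'd) transformation \<Rightarrow> bool" where
  "pseudonatural t \<longleftrightarrow>
     tr_dom t \<in> extensional_functors X Y \<and> tr_cod t \<in> extensional_functors X Y \<and>
     tr_obj t \<in> extensional (Obj X) \<and> tr_mor t \<in> extensional (Mor X) \<and>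
     (\<forall>x \<in> Obj X. tr_obj t x \<in> Mor Y \<and> Dom Y (tr_obj t x) = at_obj (tr_dom t) x \<and>
        Cod Y (tr_obj t x) = at_obj (tr_cod t) x) \<and>
     (\<forall>g \<in> Mor X. Y.invertible (tr_mor t g) \<and>
        Src Y (tr_mor t g) = Comp Y (at_mor (tr_cod t) g) (tr_obj t (Dom X g)) \<and>
        Tgt Y (tr_mor t g) = Comp Y (tr_obj t (Cod X g)) (at_mor (tr_dom t) g)) \<and>
     (\<forall>x \<in> Obj X. tr_mor t (Idn X x) = CellId Y (tr_obj t x)) \<and>
     (\<forall>f \<in> Mor X. \<forall>g \<in> Mor X. Dom X g = Cod X f \<longrightarrow>
        tr_mor t (Comp X g f) = VComp Y (HComp Y (tr_mor t g) (CellId Y (at_mor (tr_dom t) f)))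
          (HComp Y (CellId Y (at_mor (tr_cod t) g)) (tr_mor t f))) \<and>
     (\<forall>\<beta> \<in> Cell X.
        VComp Y (tr_mor t (Tgt X \<beta>)) (HComp Y (at_cell (tr_cod t) \<beta>) (CellId Y (tr_obj t (Dom X (Src X \<beta>))))) =
        VComp Y (HComp Y (CellId Y (tr_obj t (Cod X (Src X \<beta>)))) (at_cell (tr_dom t) \<beta>)) (tr_mor t (Src X \<beta>)))"

definition is_modification :: "('o, 'p, 'm, 'n, 'c, 'd) modification \<Rightarrow> bool" where
  "is_modification m \<longleftrightarrow>
     pseudonatural (md_src m) \<and> pseudonatural (md_tgt m) \<and>
     tr_dom (md_tgt m) = tr_dom (md_src m) \<and> tr_cod (md_tgt m) = tr_cod (md_src m) \<and>
     md_obj m \<in> extensional (Obj X) \<and>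
     (\<forall>x \<in> Obj X. md_obj m x \<in> Cell Y \<and> Src Y (md_obj m x) = tr_obj (md_src m) x \<and>
        Tgt Y (md_obj m x) = tr_obj (md_tgt m) x) \<and>
     (\<forall>g \<in> Mor X.
        VComp Y (HComp Y (md_obj m (Cod X g)) (CellId Y (at_mor (tr_dom (md_src m)) g))) (tr_mor (md_src m) g) =
        VComp Y (tr_mor (md_tgt m) g) (HComp Y (CellId Y (at_mor (tr_cod (md_src m)) g)) (md_obj m (Dom X g))))"

definition identity_transformation where
  "identity_transformation F = \<lparr>tr_dom = F, tr_cod = F, tr_obj = (\<lambda>x\<in>Obj X. Idn Y (at_obj F x)),
     tr_mor = (\<lambda>g\<in>Mor X. CellId Y (at_mor F g))\<rparr>"

definition comp_transformation where
  "comp_transformation t s = \<lparr>tr_dom = tr_dom s, tr_cod = tr_cod t,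
     tr_obj = (\<lambda>x\<in>Obj X. Comp Y (tr_obj t x) (tr_obj s x)),
     tr_mor = (\<lambda>g\<in>Mor X. VComp Y (HComp Y (CellId Y (tr_obj t (Cod X g))) (tr_mor s g))
       (HComp Y (tr_mor t g) (CellId Y (tr_obj s (Dom X g)))))\<rparr>"

definition Trans :: "(('o, 'p, 'm, 'n, 'c, 'd) cell_map, ('o, 'p, 'm, 'n, 'c, 'd) transformation,
  ('o, 'p, 'm, 'n, 'c, 'd) modification) two_category" where
  "Trans = \<lparr>
     Obj = extensional_functors X Y, Mor = {t. pseudonatural t}, Dom = tr_dom, Cod = tr_cod,
     Idn = identity_transformation, Comp = comp_transformation,
     Cell = {m. is_modification m}, Src = md_src, Tgt = md_tgt,
     CellId = (\<lambda>t. \<lparr>md_src = t, md_tgt = t, md_obj = (\<lambda>x\<in>Obj X. CellId Y (tr_obj t x))\<rparr>),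
     VComp = (\<lambda>n m. \<lparr>md_src = md_src m, md_tgt = md_tgt n,
       md_obj = (\<lambda>x\<in>Obj X. VComp Y (md_obj n x) (md_obj m x))\<rparr>),
     HComp = (\<lambda>n m. \<lparr>md_src = comp_transformation (md_src n) (md_src m),
       md_tgt = comp_transformation (md_tgt n) (md_tgt m),
       md_obj = (\<lambda>x\<in>Obj X. HComp Y (md_obj n x) (md_obj m x))\<rparr>)\<rparr>"

lemma Trans_simps [simp]:
  "Obj Trans = extensional_functors X Y" "t \<in> Mor Trans \<longleftrightarrow> pseudonatural t"
  "Dom Trans t = tr_dom t" "Cod Trans t = tr_cod t"
  "Idn Trans F = identity_transformation F" "Comp Trans t s = comp_transformation t s"
  "m \<in> Cell Trans \<longleftrightarrow> is_modification m" "Src Trans m = md_src m" "Tgt Trans m = md_tgt m"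
  "CellId Trans t = \<lparr>md_src = t, md_tgt = t, md_obj = (\<lambda>x\<in>Obj X. CellId Y (tr_obj t x))\<rparr>"
  "VComp Trans n m = \<lparr>md_src = md_src m, md_tgt = md_tgt n, md_obj = (\<lambda>x\<in>Obj X. VComp Y (md_obj n x) (md_obj m x))\<rparr>"
  "HComp Trans n m = \<lparr>md_src = comp_transformation (md_src n) (md_src m),
       md_tgt = comp_transformation (md_tgt n) (md_tgt m),
       md_obj = (\<lambda>x\<in>Obj X. HComp Y (md_obj n x) (md_obj m x))\<rparr>"
  by (simp_all add: Trans_def)

lemma identity_transformation_simps [simp]:
  "tr_dom (identity_transformation F) = F" "tr_cod (identity_transformation F) = F"
  "x \<in> Obj X \<Longrightarrow> tr_obj (identity_transformation F) x = Idn Y (at_obj F x)"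
  "g \<in> Mor X \<Longrightarrow> tr_mor (identity_transformation F) g = CellId Y (at_mor F g)"
  by (simp_all add: identity_transformation_def)

lemma comp_transformation_simps [simp]:
  "tr_dom (comp_transformation t s) = tr_dom s" "tr_cod (comp_transformation t s) = tr_cod t"
  "x \<in> Obj X \<Longrightarrow> tr_obj (comp_transformation t s) x = Comp Y (tr_obj t x) (tr_obj s x)"
  "g \<in> Mor X \<Longrightarrow> tr_mor (comp_transformation t s) g =
    VComp Y (HComp Y (CellId Y (tr_obj t (Cod X g))) (tr_mor s g))
       (HComp Y (tr_mor t g) (CellId Y (tr_obj s (Dom X g))))"
  by (simp_all add: comp_transformation_def)

lemma transformation_eqI:
  assumes "pseudonatural s" "pseudonatural t" "tr_dom s = tr_dom t" "tr_cod s = tr_cod t"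
    "\<And>x. x \<in> Obj X \<Longrightarrow> tr_obj s x = tr_obj t x" "\<And>g. g \<in> Mor X \<Longrightarrow> tr_mor s g = tr_mor t g"
  shows "s = t"
  using assms by (intro transformation.equality extensionalityI[of _ "Obj X"] extensionalityI[of _ "Mor X"])
    (auto simp: pseudonatural_def)

lemma modification_eqI:
  assumes "is_modification m" "is_modification n" "md_src m = md_src n" "md_tgt m = md_tgt n"
    "\<And>x. x \<in> Obj X \<Longrightarrow> md_obj m x = md_obj n x"
  shows "m = n"
  using assms by (intro modification.equality extensionalityI[of _ "Obj X"]) (auto simp: is_modification_def)

lemma extensional_functorsD: "F \<in> extensional_functors X Y \<Longrightarrow> flex_functor X Y F"
  by (simp add: extensional_functors_def)

lemma extensional_functorsI: "F \<in> extensional_functors X Y \<Longrightarrow> two_functor X Y F"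
  by (simp add: extensional_functors_def flex_functor_def)

lemma pseudonatural_functors [simp]:
  assumes "pseudonatural t"
  shows "tr_dom t \<in> extensional_functors X Y" "tr_cod t \<in> extensional_functors X Y"
  using assms unfolding pseudonatural_def by blast+

lemma pseudonaturalD [simp]:
  assumes "pseudonatural t"
  shows "x \<in> Obj X \<Longrightarrow> tr_obj t x \<in> Mor Y"
    "x \<in> Obj X \<Longrightarrow> Dom Y (tr_obj t x) = at_obj (tr_dom t) x"
    "x \<in> Obj X \<Longrightarrow> Cod Y (tr_obj t x) = at_obj (tr_cod t) x"
    "g \<in> Mor X \<Longrightarrow> Y.invertible (tr_mor t g)"
    "g \<in> Mor X \<Longrightarrow> tr_mor t g \<in> Cell Y"
    "g \<in> Mor X \<Longrightarrow> Src Y (tr_mor t g) = Comp Y (at_mor (tr_cod t) g) (tr_obj t (Dom X g))"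
    "g \<in> Mor X \<Longrightarrow> Tgt Y (tr_mor t g) = Comp Y (tr_obj t (Cod X g)) (at_mor (tr_dom t) g)"
    "x \<in> Obj X \<Longrightarrow> tr_mor t (Idn X x) = CellId Y (tr_obj t x)"
    "f \<in> Mor X \<Longrightarrow> g \<in> Mor X \<Longrightarrow> Dom X g = Cod X f \<Longrightarrow>
        tr_mor t (Comp X g f) = VComp Y (HComp Y (tr_mor t g) (CellId Y (at_mor (tr_dom t) f)))
          (HComp Y (CellId Y (at_mor (tr_cod t) g)) (tr_mor t f))"
  using assms unfolding pseudonatural_def by (blast intro: Y.invertible_Cell)+

lemma tr_mor_natural:
  assumes "pseudonatural t" "\<beta> \<in> Cell X"
  shows "VComp Y (tr_mor t (Tgt X \<beta>)) (HComp Y (at_cell (tr_cod t) \<beta>) (CellId Y (tr_obj t (Dom X (Src X \<beta>))))) =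
        VComp Y (HComp Y (CellId Y (tr_obj t (Cod X (Src X \<beta>)))) (at_cell (tr_dom t) \<beta>)) (tr_mor t (Src X \<beta>))"
  using assms unfolding pseudonatural_def by blast

lemmas functor_simps [simp] = two_functor.functor_laws[OF extensional_functorsI]
  flex_functor.at_mor_edges[OF extensional_functorsD]

lemma is_modificationD [simp]:
  assumes "is_modification m"
  shows "pseudonatural (md_src m)" "pseudonatural (md_tgt m)"
    "tr_dom (md_tgt m) = tr_dom (md_src m)" "tr_cod (md_tgt m) = tr_cod (md_src m)"
    "x \<in> Obj X \<Longrightarrow> md_obj m x \<in> Cell Y"
    "x \<in> Obj X \<Longrightarrow> Src Y (md_obj m x) = tr_obj (md_src m) x"
    "x \<in> Obj X \<Longrightarrow> Tgt Y (md_obj m x) = tr_obj (md_tgt m) x"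
  using assms unfolding is_modification_def by blast+

lemma modification_natural:
  assumes "is_modification m" "g \<in> Mor X"
  shows "VComp Y (HComp Y (md_obj m (Cod X g)) (CellId Y (at_mor (tr_dom (md_src m)) g))) (tr_mor (md_src m) g) =
    VComp Y (tr_mor (md_tgt m) g) (HComp Y (CellId Y (at_mor (tr_cod (md_src m)) g)) (md_obj m (Dom X g)))"
  using assms unfolding is_modification_def by blast

lemma pseudonatural_identity [simp]:
  assumes "F \<in> extensional_functors X Y"
  shows "pseudonatural (identity_transformation F)"
  unfolding pseudonatural_def using assms by (simp add: identity_transformation_def)

lemma pseudonatural_comp [simp]:
  assumes t: "pseudonatural t" and s: "pseudonatural s" and ts: "tr_dom t = tr_cod s"
  shows "pseudonatural (comp_transformation t s)"
  unfolding pseudonatural_def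
proof (intro conjI ballI impI, goal_cases)
  case (12 f g)
  \<comment> \<open>After expansion the cell of \<open>t\<close> at \<open>g\<close> and the cell of
    \<open>s\<close> at \<open>f\<close> occur in opposite orders on the two sides; they act in
    different places and commute.\<close>
  show ?case
    using 12 assms Y.exchange[of "tr_mor s f" "tr_mor t g"]
    by (simp add: Y.whisker_left Y.whisker_right Y.HComp_CellId_left)
next
  case (13 \<beta>)
  let ?x = "Dom X (Src X \<beta>)" and ?y = "Cod X (Src X \<beta>)"
  \<comment> \<open>First the naturality square of \<open>t\<close>, whiskered by a component of
    \<open>s\<close>; afterwards that of \<open>s\<close>, whiskered by a component of
    \<open>t\<close>.\<close>
  have "VComp Y (HComp Y (tr_mor t (Tgt X \<beta>)) (CellId Y (tr_obj s ?x)))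
      (HComp Y (at_cell (tr_cod t) \<beta>) (CellId Y (Comp Y (tr_obj t ?x) (tr_obj s ?x)))) =
    VComp Y (HComp Y (CellId Y (tr_obj t ?y)) (HComp Y (at_cell (tr_cod s) \<beta>) (CellId Y (tr_obj s ?x))))
      (HComp Y (tr_mor t (Src X \<beta>)) (CellId Y (tr_obj s ?x)))"
    using arg_cong[OF tr_mor_natural[OF t 13], of "\<lambda>\<gamma>. HComp Y \<gamma> (CellId Y (tr_obj s ?x))"] 13 assms
    by (simp add: Y.whisker_left Y.whisker_right)
  moreover have "VComp Y (HComp Y (CellId Y (tr_obj t ?y)) (tr_mor s (Tgt X \<beta>)))
      (VComp Y (HComp Y (CellId Y (tr_obj t ?y)) (HComp Y (at_cell (tr_cod s) \<beta>) (CellId Y (tr_obj s ?x))))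
        (HComp Y (tr_mor t (Src X \<beta>)) (CellId Y (tr_obj s ?x)))) =
    VComp Y (HComp Y (CellId Y (Comp Y (tr_obj t ?y) (tr_obj s ?y))) (at_cell (tr_dom s) \<beta>))
      (VComp Y (HComp Y (CellId Y (tr_obj t ?y)) (tr_mor s (Src X \<beta>)))
        (HComp Y (tr_mor t (Src X \<beta>)) (CellId Y (tr_obj s ?x))))"
    using arg_cong[OF tr_mor_natural[OF s 13], of "\<lambda>\<gamma>. VComp Y (HComp Y (CellId Y (tr_obj t ?y)) \<gamma>)
      (HComp Y (tr_mor t (Src X \<beta>)) (CellId Y (tr_obj s ?x)))"] 13 assms
    by (simp add: Y.whisker_left Y.whisker_right Y.HComp_CellId_left)
  ultimately show ?case using 13 assms by simp
qed (use assms in \<open>simp_all add: comp_transformation_def\<close>)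

lemma comp_transformation_assoc:
  assumes "pseudonatural r" "pseudonatural s" "pseudonatural t" "tr_dom s = tr_cod r" "tr_dom t = tr_cod s"
  shows "comp_transformation t (comp_transformation s r) = comp_transformation (comp_transformation t s) r"
  by (rule transformation_eqI)
    (use assms in \<open>simp_all add: Y.whisker_left Y.whisker_right Y.HComp_CellId_left\<close>)

lemma comp_transformation_identity:
  assumes "pseudonatural t"
  shows "comp_transformation t (identity_transformation (tr_dom t)) = t"
    "comp_transformation (identity_transformation (tr_cod t)) t = t"
  by (rule transformation_eqI; use assms in simp)+

lemma is_category_Trans: "is_category Trans"
  unfolding is_category_def Hom_def
  by (simp add: comp_transformation_identity comp_transformation_assoc)

lemma is_modification_CellId:
  "pseudonatural t \<Longrightarrow> is_modification \<lparr>md_src = t, md_tgt = t, md_obj = (\<lambda>x\<in>Obj X. CellId Y (tr_obj t x))\<rparr>"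
  unfolding is_modification_def by simp

lemma is_modification_VComp:
  assumes m: "is_modification m" and n: "is_modification n" and mn: "md_src n = md_tgt m"
  shows "is_modification \<lparr>md_src = md_src m, md_tgt = md_tgt n, md_obj = (\<lambda>x\<in>Obj X. VComp Y (md_obj n x) (md_obj m x))\<rparr>"
  unfolding is_modification_def
proof (intro conjI ballI impI, goal_cases)
  case (9 g)
  let ?x = "Dom X g" and ?y = "Cod X g"
  let ?F = "CellId Y (at_mor (tr_dom (md_src m)) g)" and ?G = "CellId Y (at_mor (tr_cod (md_src m)) g)"
  note * = modification_natural[OF m 9] modification_natural[OF n 9]
  have "VComp Y (HComp Y (md_obj n ?y) ?F) (VComp Y (HComp Y (md_obj m ?y) ?F) (tr_mor (md_src m) g)) =
    VComp Y (VComp Y (HComp Y (md_obj n ?y) ?F) (tr_mor (md_tgt m) g)) (HComp Y ?G (md_obj m ?x))"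
    unfolding *(1) using 9 m n mn by simp
  also have "\<dots> = VComp Y (VComp Y (tr_mor (md_tgt n) g) (HComp Y ?G (md_obj n ?x))) (HComp Y ?G (md_obj m ?x))"
    using *(2) m n mn by simp
  finally show ?case using 9 m n mn by (simp add: Y.whisker_left Y.whisker_right)
qed (use assms in simp_all)

text \<open>The axiom for \<open>m\<close> is applied underneath \<open>n\<close>, then the axiom
  for \<open>n\<close> next to \<open>m\<close>; interchange regroups the cells between the two
  uses.\<close>

lemma is_modification_HComp:
  assumes m: "is_modification m" and n: "is_modification n" and mn: "tr_dom (md_src n) = tr_cod (md_src m)"
  shows "is_modification \<lparr>md_src = comp_transformation (md_src n) (md_src m),
       md_tgt = comp_transformation (md_tgt n) (md_tgt m),
       md_obj = (\<lambda>x\<in>Obj X. HComp Y (md_obj n x) (md_obj m x))\<rparr>"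
  unfolding is_modification_def
proof (intro conjI ballI impI, goal_cases)
  case (9 g)
  let ?x = "Dom X g" and ?y = "Cod X g"
  let ?F = "CellId Y (at_mor (tr_dom (md_src m)) g)" and ?G = "CellId Y (at_mor (tr_cod (md_src m)) g)"
    and ?H = "CellId Y (at_mor (tr_cod (md_src n)) g)"
  let ?s = "CellId Y (tr_obj (md_src m) ?x)" and ?s' = "CellId Y (tr_obj (md_tgt m) ?x)"
    and ?t = "CellId Y (tr_obj (md_src n) ?y)" and ?t' = "CellId Y (tr_obj (md_tgt n) ?y)"
  have "VComp Y (HComp Y (HComp Y (md_obj n ?y) (md_obj m ?y)) ?F)
      (VComp Y (HComp Y ?t (tr_mor (md_src m) g)) (HComp Y (tr_mor (md_src n) g) ?s)) =
    VComp Y (HComp Y (md_obj n ?y) (VComp Y (HComp Y (md_obj m ?y) ?F) (tr_mor (md_src m) g))) (HComp Y (tr_mor (md_src n) g) ?s)"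
    using 9 m n mn Y.interchange[of "tr_mor (md_src m) g" "HComp Y (md_obj m ?y) ?F" ?t "md_obj n ?y"] by simp
  also have "\<dots> = VComp Y (HComp Y (md_obj n ?y) (VComp Y (tr_mor (md_tgt m) g) (HComp Y ?G (md_obj m ?x)))) (HComp Y (tr_mor (md_src n) g) ?s)"
    unfolding modification_natural[OF m 9] ..
  also have "\<dots> = VComp Y (HComp Y ?t' (tr_mor (md_tgt m) g)) (HComp Y (VComp Y (HComp Y (md_obj n ?y) ?G) (tr_mor (md_src n) g)) (md_obj m ?x))"
    using 9 m n mn Y.interchange[of "HComp Y ?G (md_obj m ?x)" "tr_mor (md_tgt m) g" "md_obj n ?y" ?t']
      Y.interchange[of ?s "md_obj m ?x" "tr_mor (md_src n) g" "HComp Y (md_obj n ?y) ?G"] by simp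
  also have "\<dots> = VComp Y (HComp Y ?t' (tr_mor (md_tgt m) g)) (HComp Y (VComp Y (tr_mor (md_tgt n) g) (HComp Y ?H (md_obj n ?x))) (md_obj m ?x))"
    using modification_natural[OF n 9] mn by simp
  also have "\<dots> = VComp Y (HComp Y ?t' (tr_mor (md_tgt m) g)) (VComp Y (HComp Y (tr_mor (md_tgt n) g) ?s') (HComp Y (HComp Y ?H (md_obj n ?x)) (md_obj m ?x)))"
    using 9 m n mn Y.interchange[of "md_obj m ?x" ?s' "HComp Y ?H (md_obj n ?x)" "tr_mor (md_tgt n) g"] by simp
  finally show ?case using 9 m n mn by simp
qed (use assms in simp_all)

lemma extensional_modification: "is_modification m \<Longrightarrow> md_obj m \<in> extensional (Obj X)"
  unfolding is_modification_def by blast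

lemma modification_eta:
  "is_modification m \<Longrightarrow> \<lparr>md_src = md_src m, md_tgt = md_tgt m, md_obj = \<lambda>x\<in>Obj X. md_obj m x\<rparr> = m"
  by (rule modification.equality) (simp_all add: extensional_restrict extensional_modification)

lemma two_cat_Trans: "two_cat Trans"
proof (rule two_catI[OF is_category_Trans], goal_cases)
  case (7 \<alpha>)
  then show ?case
    using comp_transformation_identity[of "md_src \<alpha>"] comp_transformation_identity[of "md_tgt \<alpha>"]
    by (simp add: modification_eta cong: restrict_cong)
qed (simp_all add: is_modification_CellId is_modification_VComp is_modification_HComp modification_eta
    comp_transformation_assoc Y.interchange cong: restrict_cong)

sublocale T: two_cat Trans by (rule two_cat_Trans)

end

section \<open>Exponentials\<close>

context functors
begin

text \<open>
  An edge of the exponential over \<open>t : F \<rightarrow> G\<close> is the restriction of a morphism of flexible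
  2-categories \<open>I \<times> X \<rightarrow> Y\<close>, with \<open>I\<close> the free category on one arrow \<open>\<epsilon>\<close>: besides the components \<open>t x\<close>
  on the edges \<open>(\<epsilon>, 1)\<close>, it has an edge \<open>d e\<close> of \<open>Y\<close> for each edge \<open>(\<epsilon>, e)\<close> and the invertible cell
  \<open>d e \<Rightarrow> t y \<circ> F e\<close> relating the two 1-cells \<open>(\<epsilon>, e)\<close> and \<open>(\<epsilon>, 1) \<circ> (1, e)\<close>.
\<close>

definition exp_edges where
  "exp_edges = {(t, d, \<tau>). pseudonatural t \<and> d \<in> extensional (edges X) \<and> \<tau> \<in> extensional (edges X) \<and>
     (\<forall>e \<in> edges X. d e \<in> edges Y \<and> Dom Y (d e) = at_obj (tr_dom t) (Dom X e) \<and>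
        Cod Y (d e) = at_obj (tr_cod t) (Cod X e) \<and> Y.invertible (\<tau> e) \<and> Src Y (\<tau> e) = d e \<and>
        Tgt Y (\<tau> e) = Comp Y (tr_obj t (Cod X e)) (at_mor (tr_dom t) e)) \<and>
     (\<forall>x \<in> Obj X. d (Idn X x) = tr_obj t x \<and> \<tau> (Idn X x) = CellId Y (tr_obj t x))}"

definition exp_idn where
  "exp_idn F = (identity_transformation F, \<lambda>e\<in>edges X. at_mor F e, \<lambda>e\<in>edges X. CellId Y (at_mor F e))"

lemma exp_idn_simps [simp]: "fst (exp_idn F) = identity_transformation F"
  "e \<in> edges X \<Longrightarrow> fst (snd (exp_idn F)) e = at_mor F e"
  "e \<in> edges X \<Longrightarrow> snd (snd (exp_idn F)) e = CellId Y (at_mor F e)"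
  by (simp_all add: exp_idn_def)

lemma exp_edgesD [simp]:
  assumes "r \<in> exp_edges"
  shows "pseudonatural (fst r)"
    "e \<in> edges X \<Longrightarrow> fst (snd r) e \<in> edges Y"
    "e \<in> edges X \<Longrightarrow> Dom Y (fst (snd r) e) = at_obj (tr_dom (fst r)) (Dom X e)"
    "e \<in> edges X \<Longrightarrow> Cod Y (fst (snd r) e) = at_obj (tr_cod (fst r)) (Cod X e)"
    "e \<in> edges X \<Longrightarrow> Y.invertible (snd (snd r) e)"
    "e \<in> edges X \<Longrightarrow> Src Y (snd (snd r) e) = fst (snd r) e"
    "e \<in> edges X \<Longrightarrow> Tgt Y (snd (snd r) e) = Comp Y (tr_obj (fst r) (Cod X e)) (at_mor (tr_dom (fst r)) e)"
    "x \<in> Obj X \<Longrightarrow> fst (snd r) (Idn X x) = tr_obj (fst r) x"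
    "x \<in> Obj X \<Longrightarrow> snd (snd r) (Idn X x) = CellId Y (tr_obj (fst r) x)"
  using assms unfolding exp_edges_def by auto

lemma exp_edges_eqI:
  assumes "r \<in> exp_edges" "r' \<in> exp_edges" "fst r = fst r'"
    "\<And>e. e \<in> edges X \<Longrightarrow> fst (snd r) e = fst (snd r') e" "\<And>e. e \<in> edges X \<Longrightarrow> snd (snd r) e = snd (snd r') e"
  shows "r = r'"
  using assms by (intro prod_eqI extensionalityI[of _ "edges X"]) (auto simp: exp_edges_def)

lemma exp_idn_edges: "F \<in> extensional_functors X Y \<Longrightarrow> exp_idn F \<in> exp_edges"
  unfolding exp_edges_def exp_idn_def by simp

sublocale E: path_graph Trans exp_edges fst exp_idn
  by unfold_locales (simp_all add: exp_idn_edges)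

lemma E_Mor [simp]:
  assumes "p \<in> Mor E.Paths"
  shows "fst p \<in> extensional_functors X Y" "pseudonatural (E.pcomp p)" "tr_dom (E.pcomp p) = fst p"
  using E.fst_Obj[OF assms] E.pcomp_Mor[OF assms] E.Dom_pcomp[OF assms] by simp_all

lemma E_Cell [simp]:
  assumes "\<alpha> \<in> Cell E.Paths"
  shows "is_modification (snd (snd \<alpha>))" "md_src (snd (snd \<alpha>)) = E.pcomp (fst \<alpha>)"
    "md_tgt (snd (snd \<alpha>)) = E.pcomp (fst (snd \<alpha>))"
  using E.Cell_PathsD[OF assms] by simp_all

section \<open>The evaluation morphism\<close>

sublocale EX: flex_product E.Paths X by unfold_locales

lemma EX_left_simps [simp]:
  assumes "x \<in> Obj X"
  shows "F \<in> extensional_functors X Y \<Longrightarrow> at_mor (EX.left x) (F, []) = ((F, x), [])"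
    and "f \<in> Mor E.Paths \<Longrightarrow> g \<in> Mor E.Paths \<Longrightarrow> fst g = tr_cod (E.pcomp f) \<Longrightarrow>
      at_mor (EX.left x) (path_append g f) = path_append (at_mor (EX.left x) g) (at_mor (EX.left x) f)"
  using EX.left_path(3,4)[OF assms] assms by simp_all

text \<open>Edges of \<open>E.Paths\<close> are paths of length at most one, while evaluation needs
  the underlying graph edge with its \<open>d\<close> and \<open>\<tau>\<close>. The empty path
  stands for the degenerate edge, so this inverts \<open>E.single\<close> on edges.\<close>

definition the_edge where
  "the_edge p = (case snd p of [] \<Rightarrow> exp_idn (fst p) | r # _ \<Rightarrow> r)"

lemma the_edge_single [simp]: "r \<in> exp_edges \<Longrightarrow> the_edge (E.single r) = r"
  by (simp add: the_edge_def E.single_def)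

lemma the_edge_edges [simp]: "p \<in> edges E.Paths \<Longrightarrow> the_edge p \<in> exp_edges"
  and fst_the_edge [simp]: "p \<in> edges E.Paths \<Longrightarrow> fst (the_edge p) = E.pcomp p"
  by (auto simp: E.edges_Paths)

lemma the_edge_Nil [simp]: "the_edge (F, []) = exp_idn F"
  by (simp add: the_edge_def)

definition eval_map where
  "eval_map = \<lparr>at_obj = (\<lambda>z. at_obj (fst z) (snd z)),
     at_mor = (\<lambda>f. Comp Y (tr_obj (fst f) (Cod X (snd f))) (at_mor (tr_dom (fst f)) (snd f))),
     at_cell = (\<lambda>\<alpha>. HComp Y (md_obj (fst \<alpha>) (Cod X (Src X (snd \<alpha>)))) (at_cell (tr_dom (md_src (fst \<alpha>))) (snd \<alpha>)))\<rparr>"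

text \<open>For \<open>f = (t, a)\<close> and \<open>g = (t', b)\<close> with
  \<open>t : F \<rightarrow> G\<close> and \<open>b : y \<rightarrow> z\<close>, the composite of
  the values and the value of the composite differ by \<open>G b \<circ> t y\<close> against
  \<open>t z \<circ> F b\<close>. The constraint is the cell of \<open>t\<close> at
  \<open>b\<close>, whiskered on both sides.\<close>

definition eval_coherence where
  "eval_coherence g f = HComp Y (CellId Y (tr_obj (fst g) (Cod X (snd g))))
     (HComp Y (tr_mor (fst f) (snd g)) (CellId Y (at_mor (tr_dom (fst f)) (snd f))))"

lemma eval_map_simps [simp]: "at_obj eval_map z = at_obj (fst z) (snd z)"
  "at_mor eval_map f = Comp Y (tr_obj (fst f) (Cod X (snd f))) (at_mor (tr_dom (fst f)) (snd f))"
  "at_cell eval_map \<alpha> = HComp Y (md_obj (fst \<alpha>) (Cod X (Src X (snd \<alpha>)))) (at_cell (tr_dom (md_src (fst \<alpha>))) (snd \<alpha>))"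
  by (simp_all add: eval_map_def)

text \<open>Naturality in both variables at once: the horizontal composite is cut into two
  whiskerings, one treated by naturality of the transformation in \<open>\<beta>\<close>, the other
  by the modification axiom.\<close>

lemma eval_natural:
  assumes m: "is_modification m" and g: "\<beta> \<in> Cell X"
  shows "VComp Y (tr_mor (md_tgt m) (Tgt X \<beta>)) (HComp Y (at_cell (tr_cod (md_src m)) \<beta>) (md_obj m (Dom X (Src X \<beta>)))) =
    VComp Y (HComp Y (md_obj m (Cod X (Src X \<beta>))) (at_cell (tr_dom (md_src m)) \<beta>)) (tr_mor (md_src m) (Src X \<beta>))"
proof -
  let ?F = "tr_dom (md_src m)" and ?G = "tr_cod (md_src m)" and ?x = "Dom X (Src X \<beta>)" and ?y = "Cod X (Src X \<beta>)"
  have "VComp Y (tr_mor (md_tgt m) (Tgt X \<beta>)) (HComp Y (at_cell ?G \<beta>) (md_obj m ?x)) =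
    VComp Y (VComp Y (tr_mor (md_tgt m) (Tgt X \<beta>)) (HComp Y (at_cell ?G \<beta>) (CellId Y (tr_obj (md_tgt m) ?x))))
      (HComp Y (CellId Y (at_mor ?G (Src X \<beta>))) (md_obj m ?x))"
    using m g Y.HComp_right_left[of "md_obj m ?x" "at_cell ?G \<beta>"] by simp
  also have "\<dots> = VComp Y (VComp Y (HComp Y (CellId Y (tr_obj (md_tgt m) ?y)) (at_cell ?F \<beta>)) (tr_mor (md_tgt m) (Src X \<beta>)))
      (HComp Y (CellId Y (at_mor ?G (Src X \<beta>))) (md_obj m ?x))"
    using tr_mor_natural[of "md_tgt m" \<beta>] m g by simp
  also have "\<dots> = VComp Y (HComp Y (CellId Y (tr_obj (md_tgt m) ?y)) (at_cell ?F \<beta>))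
    (VComp Y (HComp Y (md_obj m ?y) (CellId Y (at_mor ?F (Src X \<beta>)))) (tr_mor (md_src m) (Src X \<beta>)))"
    using m g modification_natural[OF m, of "Src X \<beta>"] by simp
  also have "\<dots> = VComp Y (VComp Y (HComp Y (CellId Y (tr_obj (md_tgt m) ?y)) (at_cell ?F \<beta>))
    (HComp Y (md_obj m ?y) (CellId Y (at_mor ?F (Src X \<beta>))))) (tr_mor (md_src m) (Src X \<beta>))"
    using m g by simp
  also have "VComp Y (HComp Y (CellId Y (tr_obj (md_tgt m) ?y)) (at_cell ?F \<beta>))
    (HComp Y (md_obj m ?y) (CellId Y (at_mor ?F (Src X \<beta>)))) = HComp Y (md_obj m ?y) (at_cell ?F \<beta>)"
    using m g by (intro Y.HComp_left_right) simp_all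
  finally show ?thesis .
qed

lemma pseudofunctor_eval: "pseudofunctor (prod_two_cat Trans X) Y eval_map eval_coherence"
proof -
  interpret TX: two_cat "prod_two_cat Trans X" by (rule two_cat_prod) unfold_locales
  show ?thesis
  proof (unfold_locales, goal_cases)
    case (10 k l)
    then show ?case by (auto simp: Y.interchange)
  next
    case (14 k l)
    then obtain m \<alpha> n \<beta> where e: "k = (m, \<alpha>)" "l = (n, \<beta>)"
      and k: "is_modification m" "\<alpha> \<in> Cell X" "is_modification n" "\<beta> \<in> Cell X"
      and c: "tr_dom (md_src n) = tr_cod (md_src m)" "Dom X (Src X \<beta>) = Cod X (Src X \<alpha>)"
      by auto
    let ?y = "Cod X (Src X \<alpha>)" and ?z = "Cod X (Src X \<beta>)" and ?F = "at_cell (tr_dom (md_src m))"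
    let ?t = "CellId Y (tr_obj (md_src n) ?z)" and ?t' = "CellId Y (tr_obj (md_tgt n) ?z)"
    let ?f = "CellId Y (at_mor (tr_dom (md_src m)) (Src X \<alpha>))" and ?f' = "CellId Y (at_mor (tr_dom (md_src m)) (Tgt X \<alpha>))"
    let ?\<sigma> = "tr_mor (md_src m) (Src X \<beta>)" and ?\<sigma>' = "tr_mor (md_tgt m) (Tgt X \<beta>)"
    let ?Gm = "HComp Y (at_cell (tr_dom (md_src n)) \<beta>) (md_obj m ?y)" and ?mF = "HComp Y (md_obj m ?z) (?F \<beta>)"
    have "VComp Y (HComp Y ?t' (HComp Y ?\<sigma>' ?f'))
        (HComp Y (HComp Y (md_obj n ?z) (at_cell (tr_dom (md_src n)) \<beta>)) (HComp Y (md_obj m ?y) (?F \<alpha>))) =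
      HComp Y (md_obj n ?z) (HComp Y (VComp Y ?\<sigma>' ?Gm) (?F \<alpha>))"
      using k c Y.interchange[of "HComp Y ?Gm (?F \<alpha>)" "HComp Y ?\<sigma>' ?f'" "md_obj n ?z" ?t']
        Y.interchange[of "?F \<alpha>" ?f' ?Gm ?\<sigma>'] by simp
    also have "\<dots> = HComp Y (md_obj n ?z) (HComp Y (VComp Y ?mF ?\<sigma>) (?F \<alpha>))"
      using eval_natural[OF k(1,4)] c by simp
    also have "\<dots> = VComp Y (HComp Y (HComp Y (md_obj n ?z) (md_obj m ?z)) (HComp Y (?F \<beta>) (?F \<alpha>)))
      (HComp Y ?t (HComp Y ?\<sigma> ?f))"
      using k c Y.interchange[of "HComp Y ?\<sigma> ?f" "HComp Y ?mF (?F \<alpha>)" ?t "md_obj n ?z"]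
        Y.interchange[of ?f "?F \<alpha>" ?\<sigma> ?mF] by simp
    finally show ?case using k c by (simp add: eval_coherence_def e)
  next
    case (15 f g h)
    have m: "pseudonatural (fst f)" "snd f \<in> Mor X" "pseudonatural (fst g)" "snd g \<in> Mor X" "pseudonatural (fst h)" "snd h \<in> Mor X"
      and c: "tr_dom (fst g) = tr_cod (fst f)" "Dom X (snd g) = Cod X (snd f)" "tr_dom (fst h) = tr_cod (fst g)" "Dom X (snd h) = Cod X (snd g)"
      using 15 by auto
    \<comment> \<open>Expanding the cells at composites leaves three cells on each side. The last is
      the cell of \<open>fst f\<close> at \<open>snd h\<close>; the other two, here whiskered to
      \<open>?\<alpha>\<close> and \<open>?\<beta>\<close>, occur in opposite orders and act in
      different places.\<close>
    let ?\<alpha> = "HComp Y (tr_mor (fst f) (snd g)) (CellId Y (at_mor (tr_dom (fst f)) (snd f)))"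
    let ?\<beta> = "HComp Y (CellId Y (tr_obj (fst h) (Cod X (snd h)))) (tr_mor (fst g) (snd h))"
    have "?\<alpha> \<in> Cell Y" "?\<beta> \<in> Cell Y" "Dom Y (Src Y ?\<beta>) = Cod Y (Src Y ?\<alpha>)" using m c by simp_all
    then have "VComp Y (HComp Y (CellId Y (Tgt Y ?\<beta>)) ?\<alpha>) (HComp Y ?\<beta> (CellId Y (Src Y ?\<alpha>))) =
      VComp Y (HComp Y ?\<beta> (CellId Y (Tgt Y ?\<alpha>))) (HComp Y (CellId Y (Src Y ?\<beta>)) ?\<alpha>)"
      by (simp only: Y.HComp_left_right Y.HComp_right_left)
    then show ?case
      using m c by (simp add: eval_coherence_def Y.whisker_left Y.whisker_right Y.HComp_CellId_left)
  qed (auto simp: eval_coherence_def)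
qed

definition exp_eval_map where
  "exp_eval_map = comp_map eval_map
    \<lparr>at_obj = (\<lambda>z. z), at_mor = (\<lambda>f. (E.pcomp (fst f), snd f)), at_cell = (\<lambda>\<alpha>. (snd (snd (fst \<alpha>)), snd \<alpha>))\<rparr>"

definition exp_coherence where
  "exp_coherence g f = eval_coherence (E.pcomp (fst g), snd g) (E.pcomp (fst f), snd f)"

lemma exp_coherence_pair: "exp_coherence (g, g') (f, f') = HComp Y (CellId Y (tr_obj (E.pcomp g) (Cod X g')))
     (HComp Y (tr_mor (E.pcomp f) g') (CellId Y (at_mor (tr_dom (E.pcomp f)) f')))"
  by (simp add: exp_coherence_def eval_coherence_def)

text \<open>On the pair of an edge \<open>(t, d, \<tau>)\<close> and
  \<open>e : x \<rightarrow> y\<close> the strict value is \<open>d e\<close>, compared by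
  \<open>\<tau> e\<close> with \<open>t y \<circ> F e\<close>. The boundary and invertibility
  conditions in \<open>exp_edges\<close> make this choice admissible, and since each
  \<open>d e\<close> is an edge of \<open>Y\<close>, evaluation preserves edges.\<close>

sublocale ev: strictification "prod_two_cat E.Paths X" "edges E.Paths \<times> edges X" "\<lambda>e. e" "pair_idn E.Paths X" Y
  exp_eval_map exp_coherence "\<lambda>e. fst (snd (the_edge (fst e))) (snd e)" "\<lambda>e. snd (snd (the_edge (fst e))) (snd e)"
proof -
  let ?W = "\<lparr>at_obj = (\<lambda>z. z), at_mor = (\<lambda>f. (E.pcomp (fst f), snd f)), at_cell = (\<lambda>\<alpha>. (snd (snd (fst \<alpha>)), snd \<alpha>))\<rparr>"
  have "two_functor (prod_two_cat E.Paths X) (prod_two_cat Trans X) ?W"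
    by (rule two_functorI) (simp_all add: EX.K.two_cat_axioms two_cat_prod T.two_cat_axioms X.two_cat_axioms mem_Times_iff)
  from pseudofunctor_comp[OF this pseudofunctor_eval]
  have "pseudofunctor (prod_two_cat E.Paths X) Y exp_eval_map exp_coherence"
    by (simp add: exp_eval_map_def exp_coherence_def[abs_def])
  then interpret N: pseudofunctor "prod_two_cat E.Paths X" Y exp_eval_map exp_coherence .
  show "strictification (prod_two_cat E.Paths X) (edges E.Paths \<times> edges X) (\<lambda>e. e) (pair_idn E.Paths X) Y
    exp_eval_map exp_coherence (\<lambda>e. fst (snd (the_edge (fst e))) (snd e)) (\<lambda>e. snd (snd (the_edge (fst e))) (snd e))"
  proof (unfold_locales, goal_cases)
    case (4 x)
    then show ?case by (simp add: pair_idn_def exp_eval_map_def mem_Times_iff)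
  next
    case (8 x)
    then show ?case by (simp add: pair_idn_def exp_eval_map_def mem_Times_iff)
  qed (simp_all add: exp_eval_map_def mem_Times_iff)
qed

abbreviation "ev \<equiv> ev.strict_map"

lemma flex_functor_ev: "flex_functor EX.Paths Y ev"
  by (rule flex_functorI)
    (auto simp: ev.two_functor_strict_map EX.P.flex_axioms Y.flex_axioms EX.edges_Paths)

lemma exp_eval_map_simps [simp]: "at_obj exp_eval_map z = at_obj (fst z) (snd z)"
  "at_mor exp_eval_map f = Comp Y (tr_obj (E.pcomp (fst f)) (Cod X (snd f))) (at_mor (tr_dom (E.pcomp (fst f))) (snd f))"
  "at_cell exp_eval_map \<alpha> = HComp Y (md_obj (snd (snd (fst \<alpha>))) (Cod X (Src X (snd \<alpha>))))
     (at_cell (tr_dom (md_src (snd (snd (fst \<alpha>))))) (snd \<alpha>))"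
  by (simp_all add: exp_eval_map_def)

text \<open>The conditions of \<open>exp_edges\<close> at identities enter here: an edge paired with
  an identity of \<open>X\<close> has the component of its transformation as value and an identity
  as comparison. The constraints are identities too, being cells of transformations at identity
  1-cells.\<close>

lemma ev_left:
  assumes "x \<in> Obj X" "f \<in> Mor E.Paths"
  shows "ev.strict_mor (at_mor (EX.left x) f) = tr_obj (E.pcomp f) x \<and>
    ev.coherence (at_mor (EX.left x) f) = CellId Y (tr_obj (E.pcomp f) x)"
  using assms(2)
proof (induction rule: E.P.free_induct)
  case (Idn F)
  then show ?case using assms(1) by simp
next
  case (Comp e g)
  then show ?case using assms(1)
    by (simp add: EX.left_edges exp_coherence_pair)
qed

lemma ev_right:
  assumes "F \<in> extensional_functors X Y" "g \<in> Mor X"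
  shows "ev.strict_mor (at_mor (EX.right F) g) = at_mor F g \<and>
    ev.coherence (at_mor (EX.right F) g) = CellId Y (at_mor F g)"
  using assms(2)
proof (induction rule: X.free_induct)
  case (Idn x)
  then show ?case using assms(1) by simp
next
  case (Comp e g)
  have "(F, []) \<in> edges E.Paths" using E.P.Idn_edges[of F] assms(1) by simp
  with Comp show ?case using assms(1)
    by (simp add: EX.right_edges exp_coherence_pair)
qed

text \<open>The piece applied first has an identity transformation, so the constraint between the
  two pieces is an identity. In the opposite order it is not, and this difference is the value on
  \<open>swap\<close>.\<close>

lemma ev_normal:
  assumes "f \<in> Mor E.Paths" "g \<in> Mor X"
  shows "ev.strict_mor (EX.normal f g) = Comp Y (tr_obj (E.pcomp f) (Cod X g)) (at_mor (fst f) g)"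
    and "ev.coherence (EX.normal f g) = CellId Y (Comp Y (tr_obj (E.pcomp f) (Cod X g)) (at_mor (fst f) g))"
  using assms ev_left[of "Cod X g" f] ev_right[of "fst f" g]
  by (simp_all add: EX.normal_def exp_coherence_pair)

text \<open>The target of \<open>split\<close> is a normal form and has identity coherence, so the
  cell is sent to the coherence of its source, which is the prescribed comparison.\<close>

lemma ev_split:
  assumes "r \<in> exp_edges" "e \<in> edges X"
  shows "ev.strict_mor (EX.single (E.single r, e)) = fst (snd r) e"
    and "ev.strict_cell (EX.split (E.single r) e) = snd (snd r) e"
proof -
  have r: "E.single r \<in> edges E.Paths" using assms by (simp add: E.edges_Paths)
  then show "ev.strict_mor (EX.single (E.single r, e)) = fst (snd r) e" using assms by simp
  show "ev.strict_cell (EX.split (E.single r) e) = snd (snd r) e"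
  proof (rule ev.strict_cell_eqI)
    show "EX.split (E.single r) e \<in> Cell EX.Paths" using r assms by simp
  qed (use r assms ev_normal[of "E.single r" e] in \<open>simp_all add: EX.split_def\<close>)
qed

text \<open>The target has identity coherence. The source consists of two pieces with identity
  coherence, so its own coherence is the constraint between them: the cell of the
  transformation.\<close>

lemma ev_swap:
  assumes "f \<in> Mor E.Paths" "g \<in> Mor X"
  shows "ev.strict_cell (EX.swap f g) = tr_mor (E.pcomp f) g"
proof (rule ev.strict_cell_eqI)
  show "EX.swap f g \<in> Cell EX.Paths" using assms by simp
qed (use assms ev_normal[of f g] ev_left[of "Dom X g" f] ev_right[of "Cod E.Paths f" g] in
    \<open>simp_all add: EX.swap_def exp_coherence_pair\<close>)

lemma ev_left_cell:
  assumes "x \<in> Obj X" "\<alpha> \<in> Cell E.Paths"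
  shows "ev.strict_cell (at_cell (EX.left x) \<alpha>) = md_obj (snd (snd \<alpha>)) x"
proof (rule ev.strict_cell_eqI)
  show "at_cell (EX.left x) \<alpha> \<in> Cell EX.Paths" using assms by (rule EX.left_cell)
qed (use assms ev_left[of x "fst \<alpha>"] ev_left[of x "fst (snd \<alpha>)"] in simp_all)

lemma ev_right_cell:
  assumes "F \<in> extensional_functors X Y" "\<beta> \<in> Cell X"
  shows "ev.strict_cell (at_cell (EX.right F) \<beta>) = at_cell F \<beta>"
proof (rule ev.strict_cell_eqI)
  show "at_cell (EX.right F) \<beta> \<in> Cell EX.Paths" using assms by (intro EX.right_cell) simp_all
qed (use assms ev_right[of F "Src X \<beta>"] ev_right[of F "Tgt X \<beta>"] in simp_all)

end

section \<open>Product with a fixed factor\<close>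

definition times_map where
  "times_map X Z W F = pairing W X (flex_prod Z X) (comp_map F (proj1 Z X)) (proj2 Z X)"

locale product_map = F: flex_functor Z W F + X: flex X
  for Z :: "('o, 'm, 'c, 'x) two_category_scheme" and W :: "('p, 'n, 'd, 'y) two_category_scheme" and F
    and X :: "('q, 'k, 'e, 'z) two_category_scheme"
begin

sublocale ZX: flex_product Z X by unfold_locales
sublocale WX: flex_product W X by unfold_locales

abbreviation "K \<equiv> times_map X Z W F"

lemmas components = flex_functor_comp[OF ZX.flex_functor_proj1 F.flex_functor_axioms] ZX.flex_functor_proj2

lemma flex_functor_times: "flex_functor ZX.Paths WX.Paths K"
  unfolding times_map_def by (rule WX.flex_functor_pairing[OF components])

lemma proj_times:
  "agree ZX.Paths (comp_map (proj1 W X) K) (comp_map F (proj1 Z X))"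
  "agree ZX.Paths (comp_map (proj2 W X) K) (proj2 Z X)"
  unfolding times_map_def by (rule WX.proj_pairing[OF components])+

lemma times_obj [simp]: "at_obj K z = (at_obj F (fst z), snd z)"
  unfolding times_map_def using WX.pairing_simps(1)[OF components] by simp

lemma times_cell: "\<alpha> \<in> Cell ZX.Paths \<Longrightarrow> at_cell K \<alpha> = (at_mor K (fst \<alpha>), at_mor K (fst (snd \<alpha>)),
  at_cell F (fst (snd (snd \<alpha>))), snd (snd (snd \<alpha>)))"
proof -
  interpret K: flex_functor ZX.Paths WX.Paths K by (rule flex_functor_times)
  assume "\<alpha> \<in> Cell ZX.Paths"
  moreover have "snd (snd (at_cell K \<alpha>)) = (at_cell F (fst (snd (snd \<alpha>))), snd (snd (snd \<alpha>)))"
    unfolding times_map_def using WX.pairing_simps(4)[OF components] by simp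
  ultimately show ?thesis using K.Src_at_cell[of \<alpha>] K.Tgt_at_cell[of \<alpha>] by (simp add: prod_eq_iff)
qed

lemma times_single: "a \<in> edges Z \<Longrightarrow> e \<in> edges X \<Longrightarrow> at_mor K (ZX.single (a, e)) = WX.single (at_mor F a, e)"
  unfolding times_map_def using WX.pairing_simps(3)[OF components, of "ZX.single (a, e)"]
  by (simp add: ZX.single_functor)

text \<open>Both sides have the same projections, so uniqueness for products identifies them without
  any computation of paths.\<close>

lemma times_left:
  assumes "x \<in> Obj X"
  shows "agree Z (comp_map K (ZX.left x)) (comp_map (WX.left x) F)"
  by (rule WX.product_unique[OF flex_functor_comp[OF ZX.flex_functor_left flex_functor_times]
        flex_functor_comp[OF F.flex_functor_axioms WX.flex_functor_left]])
    (use assms proj_times ZX.left_cell in \<open>simp_all add: agree_def mem_Times_iff del: ZX.left_at_cell\<close>)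

lemma times_right:
  assumes "z \<in> Obj Z"
  shows "agree X (comp_map K (ZX.right z)) (WX.right (at_obj F z))"
  by (rule WX.product_unique[OF flex_functor_comp[OF ZX.flex_functor_right flex_functor_times] WX.flex_functor_right])
    (use assms proj_times ZX.right_cell in \<open>simp_all add: agree_def mem_Times_iff del: ZX.right_at_cell\<close>)

lemma times_right_simps:
  assumes "z \<in> Obj Z"
  shows "g \<in> Mor X \<Longrightarrow> at_mor K (at_mor (ZX.right z) g) = at_mor (WX.right (at_obj F z)) g"
    and "\<beta> \<in> Cell X \<Longrightarrow> at_cell K (at_cell (ZX.right z) \<beta>) = at_cell (WX.right (at_obj F z)) \<beta>"
  using times_right[OF assms] unfolding agree_def comp_map_simps by blast+

lemma times_left_simps:
  assumes "x \<in> Obj X"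
  shows "f \<in> Mor Z \<Longrightarrow> at_mor K (at_mor (ZX.left x) f) = at_mor (WX.left x) (at_mor F f)"
    and "\<alpha> \<in> Cell Z \<Longrightarrow> at_cell K (at_cell (ZX.left x) \<alpha>) = at_cell (WX.left x) (at_cell F \<alpha>)"
  using times_left[OF assms] unfolding agree_def comp_map_simps by blast+

lemma times_append:
  assumes "p \<in> Mor ZX.Paths" "q \<in> Mor ZX.Paths" "fst q = Cod (prod_two_cat Z X) (ZX.pcomp p)"
  shows "at_mor K (path_append q p) = path_append (at_mor K q) (at_mor K p)"
proof -
  interpret K: flex_functor ZX.Paths WX.Paths K by (rule flex_functor_times)
  show ?thesis using K.at_mor_Comp[OF assms(1,2)] assms(3) by simp
qed

text \<open>A 2-functor preserves the identity components of these cells; what remains is that it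
  maps one boundary path to the other, piece by piece.\<close>

lemma times_split:
  assumes "a \<in> edges Z" "e \<in> edges X"
  shows "at_cell K (ZX.split a e) = WX.split (at_mor F a) e"
  using times_cell[OF ZX.split_Cell[OF assms]] assms
  by (simp add: ZX.split_def WX.split_def ZX.normal_def WX.normal_def times_single times_append
      times_left_simps times_right_simps)

lemma times_swap:
  assumes "f \<in> Mor Z" "g \<in> Mor X"
  shows "at_cell K (ZX.swap f g) = WX.swap (at_mor F f) g"
  using times_cell[OF ZX.swap_Cell[OF assms]] assms
  by (simp add: ZX.swap_def WX.swap_def ZX.normal_def WX.normal_def times_append
      times_left_simps times_right_simps)

end

text \<open>All data of \<open>h\<close> can be read off by evaluating: its values on objects from
  the copies of \<open>X\<close>, the transformations from \<open>left\<close> and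
  \<open>swap\<close>, the graph edges from \<open>single\<close> and \<open>split\<close>, and the
  modifications from the cells of \<open>Z\<close>.\<close>

lemma (in functors) exponential_unique:
  assumes "flex_functor Z E.Paths h" "flex_functor Z E.Paths h'"
    and "agree (flex_prod Z X) (comp_map ev (times_map X Z E.Paths h)) (comp_map ev (times_map X Z E.Paths h'))"
  shows "agree Z h h'"
proof -
  interpret h: product_map Z E.Paths h X using assms(1) X.flex_axioms by (simp add: product_map_def)
  interpret h': product_map Z E.Paths h' X using assms(2) X.flex_axioms by (simp add: product_map_def)
  have ev: "at_obj ev (at_obj h.K z) = at_obj ev (at_obj h'.K z)" if "z \<in> Obj h.ZX.Paths" for z
    using assms(3) that unfolding agree_def comp_map_simps by blast
  have ev1: "at_mor ev (at_mor h.K z) = at_mor ev (at_mor h'.K z)" if "z \<in> Mor h.ZX.Paths" for z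
    using assms(3) that unfolding agree_def comp_map_simps by blast
  have ev2: "at_cell ev (at_cell h.K z) = at_cell ev (at_cell h'.K z)" if "z \<in> Cell h.ZX.Paths" for z
    using assms(3) that unfolding agree_def comp_map_simps by blast
  have o: "at_obj h z \<in> extensional_functors X Y" "at_obj h' z \<in> extensional_functors X Y" if "z \<in> Obj Z" for z
    using that h.F.at_obj_Obj[of z] h'.F.at_obj_Obj[of z] by simp_all
  have eq0: "at_obj h z = at_obj h' z" if z: "z \<in> Obj Z" for z
  proof (rule cell_map.equality)
    show "at_obj (at_obj h z) = at_obj (at_obj h' z)"
      by (rule extensionalityI[of _ "Obj X"]) (use o[OF z] ev[of "(z, _)"] z in \<open>auto simp: extensional_functors_def\<close>)
    show "at_mor (at_obj h z) = at_mor (at_obj h' z)"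
    proof (rule extensionalityI[of _ "Mor X"])
      fix g assume "g \<in> Mor X"
      then show "at_mor (at_obj h z) g = at_mor (at_obj h' z) g"
        using ev1[of "at_mor (h.ZX.right z) g"] ev_right[OF o(1)[OF z], of g] ev_right[OF o(2)[OF z], of g] z
        by (simp add: h.times_right_simps h'.times_right_simps)
    qed (use o[OF z] in \<open>auto simp: extensional_functors_def\<close>)
    show "at_cell (at_obj h z) = at_cell (at_obj h' z)"
    proof (rule extensionalityI[of _ "Cell X"])
      fix g assume "g \<in> Cell X"
      then show "at_cell (at_obj h z) g = at_cell (at_obj h' z) g"
        using ev2[OF h.ZX.right_cell[OF z, of g]] ev_right_cell[OF o(1)[OF z], of g] ev_right_cell[OF o(2)[OF z], of g] z
        by (simp add: h.times_right_simps h'.times_right_simps del: h.ZX.right_at_cell)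
    qed (use o[OF z] in \<open>auto simp: extensional_functors_def\<close>)
  qed simp
  have tro: "tr_obj (E.pcomp (at_mor h f)) x = tr_obj (E.pcomp (at_mor h' f)) x" if "f \<in> Mor Z" "x \<in> Obj X" for f x
    using ev1[of "at_mor (h.ZX.left x) f"] ev_left[of x "at_mor h f"] ev_left[of x "at_mor h' f"] that
    by (simp add: h.times_left_simps h'.times_left_simps)
  have trm: "tr_mor (E.pcomp (at_mor h f)) g = tr_mor (E.pcomp (at_mor h' f)) g" if "f \<in> Mor Z" "g \<in> Mor X" for f g
    using ev2[of "h.ZX.swap f g"] ev_swap[of "at_mor h f" g] ev_swap[of "at_mor h' f" g] that
    by (simp add: h.times_swap h'.times_swap)
  have pc: "E.pcomp (at_mor h f) = E.pcomp (at_mor h' f)" if f: "f \<in> Mor Z" for f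
  proof (rule transformation_eqI)
    show "tr_dom (E.pcomp (at_mor h f)) = tr_dom (E.pcomp (at_mor h' f))"
      using f eq0[of "Dom Z f"] h.F.Dom_at_mor[OF f] h'.F.Dom_at_mor[OF f] by simp
    show "tr_cod (E.pcomp (at_mor h f)) = tr_cod (E.pcomp (at_mor h' f))"
      using f eq0[of "Cod Z f"] h.F.Cod_at_mor[OF f] h'.F.Cod_at_mor[OF f] by simp
  qed (use f tro trm in simp_all)
  show ?thesis
  proof (rule E.lift_unique[OF assms(1,2) eq0])
    fix a assume a: "a \<in> edges Z"
    then obtain r r' where r: "at_mor h a = E.single r" "r \<in> exp_edges" "at_mor h' a = E.single r'" "r' \<in> exp_edges"
      using h.F.at_mor_edges[OF a] h'.F.at_mor_edges[OF a] by (auto simp: E.edges_Paths)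
    have "r = r'"
    proof (rule exp_edges_eqI[OF r(2,4)])
      show "fst r = fst r'" using pc[of a] a r by simp
      fix e assume e: "e \<in> edges X"
      show "fst (snd r) e = fst (snd r') e"
        using ev1[of "h.ZX.single (a, e)"] ev_split(1)[OF r(2) e] ev_split(1)[OF r(4) e] a e
        by (simp add: h.times_single h'.times_single r(1,3))
      show "snd (snd r) e = snd (snd r') e"
        using ev2[of "h.ZX.split a e"] ev_split(2)[OF r(2) e] ev_split(2)[OF r(4) e] a e
        by (simp add: h.times_split h'.times_split r(1,3))
    qed
    then show "at_mor h a = at_mor h' a" using r by simp
  next
    fix \<alpha> assume \<alpha>: "\<alpha> \<in> Cell Z"
    show "snd (snd (at_cell h \<alpha>)) = snd (snd (at_cell h' \<alpha>))"
    proof (rule modification_eqI)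
      fix x assume x: "x \<in> Obj X"
      show "md_obj (snd (snd (at_cell h \<alpha>))) x = md_obj (snd (snd (at_cell h' \<alpha>))) x"
        using ev2[OF h.ZX.left_cell[OF x \<alpha>]] ev_left_cell[OF x h.F.at_cell_Cell[OF \<alpha>]] ev_left_cell[OF x h'.F.at_cell_Cell[OF \<alpha>]] x \<alpha>
        by (simp add: h.times_left_simps h'.times_left_simps del: h.ZX.left_at_cell)
    qed (use \<alpha> pc h.F.Src_at_cell[OF \<alpha>] h'.F.Src_at_cell[OF \<alpha>] h.F.Tgt_at_cell[OF \<alpha>] h'.F.Tgt_at_cell[OF \<alpha>]
        h.F.at_cell_Cell[OF \<alpha>] h'.F.at_cell_Cell[OF \<alpha>] in \<open>simp_all del: h.F.at_cell_Cell h'.F.at_cell_Cell\<close>)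
  qed auto
qed

section \<open>Currying\<close>

lemma (in flex_functor) restrict_extensional_functors:
  "\<lparr>at_obj = restrict (at_obj F) (Obj X), at_mor = restrict (at_mor F) (Mor X),
     at_cell = restrict (at_cell F) (Cell X)\<rparr> \<in> extensional_functors X Y"
  unfolding extensional_functors_def using agree_flex_functor by (simp add: agree_def)

locale currying = functors X Y + ZX: flex_product Z X + H: flex_functor "flex_prod Z X" Y H
  for X :: "('o, 'm, 'c) two_category" and Y :: "('p, 'n, 'd) two_category"
    and Z :: "('q, 'k, 'e, 'z) two_category_scheme" and H
begin

text \<open>\<open>H\<close> is an arbitrary morphism, so 1-cells and cells of the product have to
  remain composites of \<open>left\<close>, \<open>right\<close>, \<open>split\<close> and
  \<open>swap\<close>, to which its functoriality applies. Their description by lists is suspended,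
  and empty paths are read as identities.\<close>

declare ZX.Paths_simps(2-) [simp del] ZX.left_path [simp del] ZX.right_path [simp del]
  ZX.left_simps(2,3) [simp del] ZX.right_simps(2,3) [simp del] ZX.left_at_cell [simp del] ZX.right_at_cell [simp del]
declare ZX.left_functor [simp] ZX.right_functor [simp] ZX.swap_functor [simp] ZX.split_functor [simp]
  ZX.single_functor [simp] ZX.Paths_simps(3) [symmetric, simp]

definition curry_obj where
  "curry_obj z = (let G = comp_map H (ZX.right z) in
     \<lparr>at_obj = restrict (at_obj G) (Obj X), at_mor = restrict (at_mor G) (Mor X),
      at_cell = restrict (at_cell G) (Cell X)\<rparr>)"

definition curry_mor where
  "curry_mor f = \<lparr>tr_dom = curry_obj (Dom Z f), tr_cod = curry_obj (Cod Z f),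
     tr_obj = (\<lambda>x\<in>Obj X. at_mor H (at_mor (ZX.left x) f)),
     tr_mor = (\<lambda>g\<in>Mor X. at_cell H (ZX.swap f g))\<rparr>"

definition curry_cell where
  "curry_cell \<alpha> = \<lparr>md_src = curry_mor (Src Z \<alpha>), md_tgt = curry_mor (Tgt Z \<alpha>),
     md_obj = (\<lambda>x\<in>Obj X. at_cell H (at_cell (ZX.left x) \<alpha>))\<rparr>"

definition curry_base where
  "curry_base = \<lparr>at_obj = curry_obj, at_mor = curry_mor, at_cell = curry_cell\<rparr>"

lemma curry_base_simps [simp]: "at_obj curry_base z = curry_obj z" "at_mor curry_base f = curry_mor f"
  "at_cell curry_base \<alpha> = curry_cell \<alpha>"
  by (simp_all add: curry_base_def)

text \<open>The transformation \<open>curry_mor a\<close> determines the value of \<open>H\<close>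
  at the edge \<open>(a, e)\<close> only up to isomorphism; the graph edge records the value itself
  together with the isomorphism.\<close>

definition curry_edge where
  "curry_edge a = (curry_mor a, \<lambda>e\<in>edges X. at_mor H (ZX.single (a, e)), \<lambda>e\<in>edges X. at_cell H (ZX.split a e))"

lemma curry_obj_functor [simp]: "z \<in> Obj Z \<Longrightarrow> curry_obj z \<in> extensional_functors X Y"
  unfolding curry_obj_def Let_def
  by (intro flex_functor.restrict_extensional_functors flex_functor_comp[OF _ H.flex_functor_axioms]
      ZX.flex_functor_right)

lemma curry_obj_simps [simp]:
  "x \<in> Obj X \<Longrightarrow> z \<in> Obj Z \<Longrightarrow> at_obj (curry_obj z) x = at_obj H (z, x)"
  "g \<in> Mor X \<Longrightarrow> at_mor (curry_obj z) g = at_mor H (at_mor (ZX.right z) g)"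
  "\<beta> \<in> Cell X \<Longrightarrow> at_cell (curry_obj z) \<beta> = at_cell H (at_cell (ZX.right z) \<beta>)"
  by (simp_all add: curry_obj_def Let_def)

lemma curry_mor_simps [simp]:
  "tr_dom (curry_mor f) = curry_obj (Dom Z f)" "tr_cod (curry_mor f) = curry_obj (Cod Z f)"
  "x \<in> Obj X \<Longrightarrow> tr_obj (curry_mor f) x = at_mor H (at_mor (ZX.left x) f)"
  "g \<in> Mor X \<Longrightarrow> tr_mor (curry_mor f) g = at_cell H (ZX.swap f g)"
  by (simp_all add: curry_mor_def)

lemma curry_cell_simps [simp]:
  "md_src (curry_cell \<alpha>) = curry_mor (Src Z \<alpha>)" "md_tgt (curry_cell \<alpha>) = curry_mor (Tgt Z \<alpha>)"
  "x \<in> Obj X \<Longrightarrow> md_obj (curry_cell \<alpha>) x = at_cell H (at_cell (ZX.left x) \<alpha>)"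
  by (simp_all add: curry_cell_def)

lemma pseudonatural_curry [simp]:
  assumes f: "f \<in> Mor Z"
  shows "pseudonatural (curry_mor f)"
  unfolding pseudonatural_def
proof (intro conjI ballI impI, goal_cases)
  case (11 x)
  then show ?case using f by (simp add: ZX.swap_Idn_right)
next
  case (12 g g')
  then show ?case using f by (simp add: ZX.swap_Comp_right)
next
  case (13 \<beta>)
  then show ?case using f arg_cong[OF ZX.swap_natural_right[OF f 13], of "at_cell H"] by simp
qed (use f in \<open>simp_all add: curry_mor_def\<close>)

lemma curry_Idn: "z \<in> Obj Z \<Longrightarrow> curry_mor (Idn Z z) = identity_transformation (curry_obj z)"
  by (rule transformation_eqI) (simp_all add: ZX.swap_Idn_left)

lemma curry_Comp: "f \<in> Mor Z \<Longrightarrow> f' \<in> Mor Z \<Longrightarrow> Dom Z f' = Cod Z f \<Longrightarrow>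
  curry_mor (Comp Z f' f) = comp_transformation (curry_mor f') (curry_mor f)"
  by (rule transformation_eqI) (simp_all add: ZX.swap_Comp_left)

lemma is_modification_curry [simp]:
  assumes \<alpha>: "\<alpha> \<in> Cell Z"
  shows "is_modification (curry_cell \<alpha>)"
  unfolding is_modification_def
proof (intro conjI ballI impI, goal_cases)
  case (9 g)
  then show ?case using \<alpha> arg_cong[OF ZX.swap_natural_left[OF \<alpha> 9], of "at_cell H"] by simp
qed (use \<alpha> in \<open>simp_all add: curry_cell_def\<close>)

lemma two_functor_curry: "two_functor Z Trans curry_base"
proof (rule two_functorI, goal_cases)
  case (8 f)
  then show ?case
    unfolding curry_base_simps Trans_simps
    by (intro modification_eqI) (simp_all add: is_modification_CellId)
next
  case (9 \<alpha> \<beta>)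
  then show ?case using is_modification_VComp[of "curry_cell \<alpha>" "curry_cell \<beta>"]
    unfolding curry_base_simps Trans_simps by (intro modification_eqI) simp_all
next
  case (10 \<alpha> \<beta>)
  then show ?case using is_modification_HComp[of "curry_cell \<alpha>" "curry_cell \<beta>"]
    unfolding curry_base_simps Trans_simps by (intro modification_eqI) (simp_all add: curry_Comp)
qed (simp_all add: ZX.X.two_cat_axioms T.two_cat_axioms curry_Idn curry_Comp)

lemma path_lift_curry: "path_lift Trans exp_edges fst exp_idn Z curry_base curry_edge"
proof -
  interpret C: two_functor Z Trans curry_base by (rule two_functor_curry)
  show ?thesis
  proof unfold_locales
    fix a assume a: "a \<in> edges Z"
    then show "curry_edge a \<in> exp_edges"
      unfolding curry_edge_def exp_edges_def
      by (auto simp: ZX.split_Idn_right ZX.left_edges[symmetric])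
    show "fst (curry_edge a) = at_mor curry_base a" by (simp add: curry_edge_def)
  next
    fix z assume z: "z \<in> Obj Z"
    then show "curry_edge (Idn Z z) = exp_idn (at_obj curry_base z)"
      by (auto simp: curry_edge_def exp_idn_def curry_Idn ZX.split_Idn_left
          ZX.right_edges[symmetric] intro!: restrict_ext)
  qed
qed

sublocale L: path_lift Trans exp_edges fst exp_idn Z curry_base curry_edge
  by (rule path_lift_curry)

lemma curry_edge_apply: "e \<in> edges X \<Longrightarrow> fst (snd (curry_edge a)) e = at_mor H (ZX.single (a, e))"
  "e \<in> edges X \<Longrightarrow> snd (snd (curry_edge a)) e = at_cell H (ZX.split a e)"
  by (simp_all add: curry_edge_def)

text \<open>1-cells are compared on edges, where evaluation returns the recorded values; cells are
  compared on the generators, where evaluation returns the entries from which the transpose was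
  formed.\<close>

lemma curry_eval: "agree ZX.Paths (comp_map ev (times_map X Z E.Paths L.lift)) H"
proof -
  interpret K: product_map Z E.Paths L.lift X
    using L.flex_functor_lift X.flex_axioms by (simp add: product_map_def)
  have 1: "flex_functor ZX.Paths Y (comp_map ev K.K)"
    by (rule flex_functor_comp[OF K.flex_functor_times flex_functor_ev])
  have 2: "two_functor ZX.Paths Y (comp_map ev K.K)" using 1 by (simp add: flex_functor_def)
  have o: "at_obj (comp_map ev K.K) x = at_obj H x" if "x \<in> Obj ZX.Paths" for x
    using that by auto
  have m: "at_mor (comp_map ev K.K) p = at_mor H p" if "p \<in> Mor ZX.Paths" for p
  proof (rule ZX.P.at_mor_eqI[OF 2 H.two_functor_axioms o _ that])
    fix p assume "p \<in> edges ZX.Paths"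
    then obtain a e where p: "p = ZX.single (a, e)" "a \<in> edges Z" "e \<in> edges X" by (auto simp: ZX.edges_Paths)
    then show "at_mor (comp_map ev K.K) p = at_mor H p"
      using ev_split(1)[of "curry_edge a" e] by (simp add: K.times_single) (simp add: curry_edge_apply)
  qed
  have "at_cell (comp_map ev K.K) \<alpha> = at_cell H \<alpha>" if "\<alpha> \<in> Cell ZX.Paths" for \<alpha>
  proof (rule ZX.agree_on_generators[OF 2 H.two_functor_axioms m _ _ _ _ that])
    fix a e assume "a \<in> edges Z" "e \<in> edges X"
    then show "at_cell (comp_map ev K.K) (ZX.split a e) = at_cell H (ZX.split a e)"
      using ev_split(2)[of "curry_edge a" e] by (simp add: K.times_split) (simp add: curry_edge_apply)
  next
    fix f g assume "f \<in> Mor Z" "g \<in> Mor X"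
    then show "at_cell (comp_map ev K.K) (ZX.swap f g) = at_cell H (ZX.swap f g)"
      using ev_swap[of "at_mor L.lift f" g] by (simp add: K.times_swap)
  next
    fix x \<alpha> assume "x \<in> Obj X" "\<alpha> \<in> Cell Z"
    then show "at_cell (comp_map ev K.K) (at_cell (ZX.left x) \<alpha>) = at_cell H (at_cell (ZX.left x) \<alpha>)"
      using ev_left_cell[of x "at_cell L.lift \<alpha>"] by (simp add: K.times_left_simps)
  next
    fix z \<beta> assume z: "z \<in> Obj Z" and "\<beta> \<in> Cell X"
    then show "at_cell (comp_map ev K.K) (at_cell (ZX.right z) \<beta>) = at_cell H (at_cell (ZX.right z) \<beta>)"
      using ev_right_cell[of "at_obj L.lift z" \<beta>] by (simp add: K.times_right_simps)
  qed
  with o m show ?thesis unfolding agree_def by blast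
qed

end

lemma (in functors) exponential_exists:
  assumes "flex Z" "flex_functor (flex_prod Z X) Y H"
  shows "\<exists>h. flex_functor Z E.Paths h \<and> agree (flex_prod Z X) (comp_map ev (times_map X Z E.Paths h)) H"
proof -
  interpret H: flex_functor "flex_prod Z X" Y H by fact
  interpret Z: flex Z by fact
  interpret currying X Y Z H by unfold_locales
  show ?thesis using L.flex_functor_lift curry_eval by blast
qed

section \<open>Isomorphic copies in the universe\<close>

definition inverse_functors where
  "inverse_functors X T F G \<longleftrightarrow> flex_functor X T F \<and> flex_functor T X G \<and>
     agree X (comp_map G F) id_map \<and> agree T (comp_map F G) id_map"

definition transport where
  "transport j0 j1 j2 X = (let k0 = inv_into (Obj X) j0; k1 = inv_into (Mor X) j1; k2 = inv_into (Cell X) j2 in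
    \<lparr>Obj = j0 ` Obj X, Mor = j1 ` Mor X, Dom = (\<lambda>f. j0 (Dom X (k1 f))), Cod = (\<lambda>f. j0 (Cod X (k1 f))),
     Idn = (\<lambda>x. j1 (Idn X (k0 x))), Comp = (\<lambda>g f. j1 (Comp X (k1 g) (k1 f))),
     Cell = j2 ` Cell X, Src = (\<lambda>\<alpha>. j1 (Src X (k2 \<alpha>))), Tgt = (\<lambda>\<alpha>. j1 (Tgt X (k2 \<alpha>))),
     CellId = (\<lambda>f. j2 (CellId X (k1 f))), VComp = (\<lambda>\<beta> \<alpha>. j2 (VComp X (k2 \<beta>) (k2 \<alpha>))),
     HComp = (\<lambda>\<beta> \<alpha>. j2 (HComp X (k2 \<beta>) (k2 \<alpha>)))\<rparr>)"

lemma (in two_functor) composes_to_image: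
  "composes_to X fs f \<Longrightarrow> composes_to Y (map (at_mor F) fs) (at_mor F f)"
proof (induction rule: composes_to.induct)
  case (Nil x)
  then show ?case using composes_to.Nil[of "at_obj F x" Y] by simp
next
  case (Cons f fs g)
  then show ?case using composes_to.Cons[of "at_mor F f" Y "map (at_mor F) fs" "at_mor F g"] X.composes_to_Mor[of fs g]
    by simp
qed

lemma inverse_atomic:
  assumes F: "two_functor X T F" and G: "two_functor T X G"
    and GF: "agree X (comp_map G F) id_map" and FG: "agree T (comp_map F G) id_map" and a: "atomic X a"
  shows "atomic T (at_mor F a)"
proof -
  interpret F: two_functor X T F by fact
  interpret G: two_functor T X G by fact
  have GF1: "at_mor G (at_mor F f) = f" if "f \<in> Mor X" for f using GF that by (simp add: agree_def)
  have GF0: "at_obj G (at_obj F f) = f" if "f \<in> Obj X" for f using GF that by (simp add: agree_def)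
  have FG1: "at_mor F (at_mor G f) = f" if "f \<in> Mor T" for f using FG that by (simp add: agree_def)
  have i: "is_identity T f" if id: "is_identity X (at_mor G f)" and f: "f \<in> Mor T" for f
  proof -
    obtain x where "x \<in> Obj X" "at_mor G f = Idn X x" using id by (auto simp: is_identity_def)
    then have "f = Idn T (at_obj F x)" "at_obj F x \<in> Obj T" using FG1[OF f] by simp_all
    then show ?thesis by (auto simp: is_identity_def)
  qed
  have am: "a \<in> Mor X" using a by (simp add: atomic_def)
  show ?thesis
    unfolding atomic_def
  proof (intro conjI ballI impI notI)
    show "at_mor F a \<in> Mor T" using am by simp
    show False if id: "is_identity T (at_mor F a)"
    proof -
      obtain x where "x \<in> Obj T" "at_mor F a = Idn T x" using id by (auto simp: is_identity_def)
      then have "a = Idn X (at_obj G x)" "at_obj G x \<in> Obj X" using GF1[OF am] by simp_all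
      then show False using a by (auto simp: atomic_def is_identity_def)
    qed
    fix g h assume gh: "g \<in> Mor T" "h \<in> Mor T" "Dom T h = Cod T g" "at_mor F a = Comp T h g"
    then have "a = Comp X (at_mor G h) (at_mor G g)" using GF1[OF am] by simp
    then have "is_identity X (at_mor G g) \<or> is_identity X (at_mor G h)"
      using a gh by (simp add: atomic_def)
    then show "is_identity T g \<or> is_identity T h" using i gh by blast
  qed
qed

text \<open>Isomorphisms preserve atomic 1-cells, so the unique decompositions of \<open>X\<close>
  are carried over to \<open>T\<close>. Both functors then preserve edges without further
  assumption.\<close>

lemma inverse_free:
  assumes F: "two_functor X T F" and G: "two_functor T X G"
    and GF: "agree X (comp_map G F) id_map" and FG: "agree T (comp_map F G) id_map" and X: "flex X"
  shows "inverse_functors X T F G"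
proof -
  interpret F: two_functor X T F by fact
  interpret G: two_functor T X G by fact
  interpret X: flex X by fact
  have GF1: "at_mor G (at_mor F f) = f" if "f \<in> Mor X" for f using GF that by (simp add: agree_def)
  have FG1: "at_mor F (at_mor G f) = f" if "f \<in> Mor T" for f using FG that by (simp add: agree_def)
  note F_atomic = inverse_atomic[OF F G GF FG] and G_atomic = inverse_atomic[OF G F FG GF]
  have "\<exists>!fs. (\<forall>a \<in> set fs. atomic T a) \<and> composes_to T fs f" if f: "f \<in> Mor T" for f
  proof (rule ex1I)
    let ?ds = "decomposition X (at_mor G f)"
    have "(\<forall>a \<in> set ?ds. atomic X a) \<and> composes_to X ?ds (at_mor G f)"
      using f by (intro X.decomposition_works) simp
    then show "(\<forall>a \<in> set (map (at_mor F) ?ds). atomic T a) \<and> composes_to T (map (at_mor F) ?ds) f"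
      using F_atomic F.composes_to_image[of ?ds "at_mor G f"] FG1[OF f] by auto
    fix fs assume fs: "(\<forall>a \<in> set fs. atomic T a) \<and> composes_to T fs f"
    then have "?ds = map (at_mor G) fs"
      using G_atomic by (intro X.decomposition_eqI G.composes_to_image) auto
    then show "fs = map (at_mor F) ?ds"
      using fs FG1 by (auto simp: atomic_def intro!: map_idI[symmetric])
  qed
  then have T: "flex T" using F.Y.two_cat_axioms
    by (simp add: flex_def free_cat_def free_cat_axioms_def two_cat_def free_category_def cat_def)
  interpret T: flex T by (rule T)
  have "flex_functor X T F"
  proof (rule flex_functorI[OF F X T])
    fix e assume "e \<in> edges X"
    then show "at_mor F e \<in> edges T" by (cases rule: X.edges_cases) (simp_all add: F_atomic T.atomic_edges)
  qed
  moreover have "flex_functor T X G"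
  proof (rule flex_functorI[OF G T X])
    fix e assume "e \<in> edges T"
    then show "at_mor G e \<in> edges X" by (cases rule: T.edges_cases) (simp_all add: G_atomic X.atomic_edges)
  qed
  ultimately show ?thesis using GF FG by (simp add: inverse_functors_def)
qed

lemma inverse_functors_transport:
  assumes "flex X" and inj: "inj_on j0 (Obj X)" "inj_on j1 (Mor X)" "inj_on j2 (Cell X)"
  shows "inverse_functors X (transport j0 j1 j2 X) \<lparr>at_obj = j0, at_mor = j1, at_cell = j2\<rparr>
    \<lparr>at_obj = inv_into (Obj X) j0, at_mor = inv_into (Mor X) j1, at_cell = inv_into (Cell X) j2\<rparr>"
proof -
  interpret X: flex X by fact
  define k0 k1 k2 where k: "k0 = inv_into (Obj X) j0" "k1 = inv_into (Mor X) j1" "k2 = inv_into (Cell X) j2"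
  let ?T = "transport j0 j1 j2 X"
  have kj: "x \<in> Obj X \<Longrightarrow> k0 (j0 x) = x" "f \<in> Mor X \<Longrightarrow> k1 (j1 f) = f" "\<alpha> \<in> Cell X \<Longrightarrow> k2 (j2 \<alpha>) = \<alpha>" for x f \<alpha>
    using inj by (simp_all add: k)
  note j = inj[THEN inj_on_eq_iff]
  have T: "Obj ?T = j0 ` Obj X" "Mor ?T = j1 ` Mor X" "Dom ?T = (\<lambda>f. j0 (Dom X (k1 f)))" "Cod ?T = (\<lambda>f. j0 (Cod X (k1 f)))"
     "Idn ?T = (\<lambda>x. j1 (Idn X (k0 x)))" "Comp ?T = (\<lambda>g f. j1 (Comp X (k1 g) (k1 f)))"
     "Cell ?T = j2 ` Cell X" "Src ?T = (\<lambda>\<alpha>. j1 (Src X (k2 \<alpha>)))" "Tgt ?T = (\<lambda>\<alpha>. j1 (Tgt X (k2 \<alpha>)))"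
     "CellId ?T = (\<lambda>f. j2 (CellId X (k1 f)))" "VComp ?T = (\<lambda>\<beta> \<alpha>. j2 (VComp X (k2 \<beta>) (k2 \<alpha>)))"
     "HComp ?T = (\<lambda>\<beta> \<alpha>. j2 (HComp X (k2 \<beta>) (k2 \<alpha>)))"
    by (simp_all add: transport_def k Let_def)
  have "is_category ?T"
    unfolding is_category_def Hom_def T by (simp add: kj j)
  then have t: "two_cat ?T"
    by (rule two_catI) (auto simp: T kj j X.interchange)
  have F: "two_functor X ?T \<lparr>at_obj = j0, at_mor = j1, at_cell = j2\<rparr>"
    by (rule two_functorI[OF X.two_cat_axioms t]) (simp_all add: T kj)
  have G: "two_functor ?T X \<lparr>at_obj = k0, at_mor = k1, at_cell = k2\<rparr>"
    by (rule two_functorI[OF t X.two_cat_axioms]) (auto simp: T kj j)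
  show ?thesis unfolding k[symmetric]
    by (rule inverse_free[OF F G _ _ assms(1)]) (auto simp: agree_def T kj)
qed

section \<open>Smallness\<close>

text \<open>\<open>small\<close> concerns only sets of elements of the universe type, whereas paths,
  transformations and modifications live in other types.\<close>

definition smaller :: "'u itself \<Rightarrow> 'a set \<Rightarrow> bool" where
  "smaller _ A \<longleftrightarrow> A \<prec> (UNIV :: 'u set)"

locale universe =
  fixes U :: "'u itself"
  assumes is_universe: "is_universe TYPE('u)"
begin

abbreviation tiny :: "'a set \<Rightarrow> bool" where
  "tiny A \<equiv> smaller U A"

lemma uncountable_universe: "uncountable (UNIV :: 'u set)"
  using is_universe by (simp add: is_universe_def)

lemma tiny_inj: "tiny B \<Longrightarrow> inj_on f A \<Longrightarrow> f ` A \<subseteq> B \<Longrightarrow> tiny A"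
  unfolding smaller_def by (meson lepoll_def lesspoll_trans1)

lemma tiny_subset: "tiny B \<Longrightarrow> A \<subseteq> B \<Longrightarrow> tiny A"
  by (rule tiny_inj[of B id]) auto

lemma tiny_countable:
  assumes "countable A"
  shows "tiny A"
proof -
  have "A \<lesssim> (UNIV :: nat set)" using assms by (auto simp: countable_def lepoll_def)
  moreover have "(UNIV :: nat set) \<lesssim> (UNIV :: 'u set)"
    using uncountable_universe by (simp add: infinite_le_lepoll[symmetric] uncountable_infinite)
  ultimately show ?thesis
    using assms uncountable_universe countable_eqpoll[of A "UNIV :: 'u set"]
    by (auto simp: smaller_def lesspoll_def eqpoll_sym intro: lepoll_trans)
qed

text \<open>The universe hypothesis speaks of subsets of the universe type, so \<open>A\<close> is
  first moved there by an injection.\<close>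

lemma tiny_Pow:
  assumes "tiny A"
  shows "tiny (Pow A)"
proof -
  obtain f :: "'a \<Rightarrow> 'u" where f: "inj_on f A" using assms by (auto simp: smaller_def lesspoll_def lepoll_def)
  then have "small (f ` A)" using assms by (simp add: small_def smaller_def)
  then have "tiny (Pow (f ` A))" using is_universe by (simp add: is_universe_def smaller_def)
  then show ?thesis by (rule tiny_inj[of _ "image f"]) (use f in \<open>auto simp: inj_on_image_Pow\<close>)
qed

text \<open>Comparability of cardinals embeds the product into the square of one factor; a square is
  finite or equipollent to the set itself.\<close>

lemma tiny_Times:
  assumes "tiny A" "tiny B"
  shows "tiny (A \<times> B)"
proof -
  have *: "tiny (C \<times> C)" if "tiny C" for C :: "'c set"
  proof (cases "finite C")
    case True
    then show ?thesis by (intro tiny_countable countable_finite) simp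
  next
    case False
    then have "C \<times> C \<approx> C" by (simp add: card_of_Times_same_infinite eqpoll_iff_card_of_ordIso)
    then show ?thesis using that unfolding smaller_def by (rule eq_lesspoll_trans)
  qed
  have "A \<lesssim> B \<or> B \<lesssim> A"
    using ordLeq_total[OF card_of_Well_order[of A] card_of_Well_order[of B]]
    by (simp add: lepoll_def card_of_ordLeq[symmetric])
  then have "A \<times> B \<lesssim> B \<times> B \<or> A \<times> B \<lesssim> A \<times> A"
    using times_lepoll_mono[of A B B B] times_lepoll_mono[of A A B A] by auto
  then show ?thesis
    using lesspoll_trans1[OF _ *[OF assms(1), unfolded smaller_def]]
      lesspoll_trans1[OF _ *[OF assms(2), unfolded smaller_def]] by (auto simp: smaller_def)
qed

text \<open>An extensional function is determined by its graph over \<open>A\<close>, so a strong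
  limit bounds function spaces by power sets of products.\<close>

lemma tiny_functions:
  assumes "tiny A" "tiny B" and S: "S \<subseteq> extensional A" "\<And>f x. f \<in> S \<Longrightarrow> x \<in> A \<Longrightarrow> f x \<in> B"
  shows "tiny S"
proof (rule tiny_inj[OF tiny_Pow[OF tiny_Times[OF assms(1,2)]]])
  show "inj_on (\<lambda>f. (\<lambda>x. (x, f x)) ` A) S"
  proof (rule inj_onI)
    fix f g assume f: "f \<in> S" "g \<in> S" and "(\<lambda>x. (x, f x)) ` A = (\<lambda>x. (x, g x)) ` A"
    then have "f x = g x" if "x \<in> A" for x using that by (auto simp: image_def set_eq_iff)
    then show "f = g" using f S(1) by (intro extensionalityI[of f A g]) auto
  qed
qed (use S(2) in auto)

text \<open>A list is coded as the set of its pairs of position and entry. The length is the number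
  of positions that occur, which makes the coding injective; the set of all positions is countable
  and therefore small.\<close>

lemma tiny_lists:
  assumes "tiny A"
  shows "tiny (lists A)"
proof (rule tiny_inj[OF tiny_Pow[OF tiny_Times[OF tiny_countable[of "UNIV :: nat set"] assms]]])
  let ?f = "\<lambda>xs. (\<lambda>k. (k, xs ! k)) ` {..<length xs}"
  show "inj_on ?f (lists A)"
  proof (rule inj_onI)
    fix xs ys assume eq: "?f xs = ?f ys"
    have "fst ` ?f xs = {..<length xs}" "fst ` ?f ys = {..<length ys}" by (auto simp: image_image)
    then have l: "length xs = length ys" unfolding eq using lessThan_eq_iff by metis
    have "xs ! k = ys ! k" if "k < length xs" for k
    proof -
      have "(k, xs ! k) \<in> ?f ys" unfolding eq[symmetric] using that by auto
      then show ?thesis by auto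
    qed
    with l show "xs = ys" by (intro nth_equalityI) auto
  qed
  show "?f ` lists A \<subseteq> Pow (UNIV \<times> A)" by (auto simp: lists_eq_set)
qed simp

definition tiny_two_category :: "('o, 'm, 'c, 'z) two_category_scheme \<Rightarrow> bool" where
  "tiny_two_category X \<longleftrightarrow> tiny (Obj X) \<and> tiny (Mor X) \<and> tiny (Cell X)"

lemma tiny_paths:
  assumes "path_graph K E u i" "tiny (Obj K)" "tiny E" "tiny (Cell K)"
  shows "tiny_two_category (path_two_category K E u i)"
proof -
  interpret path_graph K E u i by fact
  have "is_path K E u i x es \<Longrightarrow> es \<in> lists E" for x es
    by (induction es arbitrary: x) auto
  then have "Mor Paths \<subseteq> Obj K \<times> lists E"
    using fst_Obj by (fastforce simp: Mor_Paths mem_Times_iff simp del: fst_Obj)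
  then have m: "tiny (Mor Paths)" by (rule tiny_subset[rotated]) (intro tiny_Times tiny_lists assms)
  have "Cell Paths \<subseteq> Mor Paths \<times> (Mor Paths \<times> Cell K)" by (auto simp: Cell_Paths)
  then have "tiny (Cell Paths)" by (rule tiny_subset[rotated]) (intro tiny_Times m assms)
  with m assms(2) show ?thesis by (simp add: tiny_two_category_def)
qed

lemma tiny_edges: "tiny (Mor C) \<Longrightarrow> tiny (edges C)"
  by (rule tiny_subset) (auto simp: edges_def)

lemma tiny_flex_prod:
  assumes "flex X" "flex Y" "tiny_two_category X" "tiny_two_category Y"
  shows "tiny_two_category (flex_prod X Y)"
proof -
  interpret flex_product X Y using assms(1,2) by (simp add: flex_product_def)
  show ?thesis using assms(3,4)
    by (intro tiny_paths[OF path_graph_axioms]) (simp_all add: tiny_two_category_def tiny_Times tiny_edges)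
qed

end

locale small_functors = universe U + functors X Y
  for U :: "'u itself" and X :: "('o, 'm, 'c) two_category" and Y :: "('p, 'n, 'd) two_category" +
  assumes tiny_X: "tiny_two_category X" and tiny_Y: "tiny_two_category Y"
begin

lemma tiny_carriers: "tiny (Obj X)" "tiny (Mor X)" "tiny (Cell X)" "tiny (Obj Y)" "tiny (Mor Y)" "tiny (Cell Y)"
  using tiny_X tiny_Y by (simp_all add: tiny_two_category_def)

lemma tiny_extensional_functors: "tiny (extensional_functors X Y)"
proof (rule tiny_inj)
  let ?S = "extensional_functors X Y"
  show "inj_on (\<lambda>F. (at_obj F, at_mor F, at_cell F)) ?S" by (auto simp: inj_on_def)
  show "(\<lambda>F. (at_obj F, at_mor F, at_cell F)) ` ?S \<subseteq> (at_obj ` ?S) \<times> ((at_mor ` ?S) \<times> (at_cell ` ?S))" by auto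
  show "tiny ((at_obj ` ?S) \<times> ((at_mor ` ?S) \<times> (at_cell ` ?S)))"
  proof (intro tiny_Times)
    show "tiny (at_obj ` ?S)"
      by (rule tiny_functions[OF tiny_carriers(1,4)]) (auto, auto simp: extensional_functors_def)
    show "tiny (at_mor ` ?S)"
      by (rule tiny_functions[OF tiny_carriers(2,5)]) (auto, auto simp: extensional_functors_def)
    show "tiny (at_cell ` ?S)"
      by (rule tiny_functions[OF tiny_carriers(3,6)]) (auto, auto simp: extensional_functors_def)
  qed
qed

lemma tiny_transformations: "tiny {t. pseudonatural t}"
proof (rule tiny_inj)
  let ?S = "{t. pseudonatural t}" and ?E = "extensional_functors X Y"
  show "inj_on (\<lambda>t. (tr_dom t, tr_cod t, tr_obj t, tr_mor t)) ?S" by (auto simp: inj_on_def)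
  show "(\<lambda>t. (tr_dom t, tr_cod t, tr_obj t, tr_mor t)) ` ?S \<subseteq> ?E \<times> (?E \<times> ((tr_obj ` ?S) \<times> (tr_mor ` ?S)))" by auto
  show "tiny (?E \<times> (?E \<times> ((tr_obj ` ?S) \<times> (tr_mor ` ?S))))"
  proof (intro tiny_Times tiny_extensional_functors)
    show "tiny (tr_obj ` ?S)"
      by (rule tiny_functions[OF tiny_carriers(1,5)]) (unfold pseudonatural_def, blast+)
    show "tiny (tr_mor ` ?S)"
      by (rule tiny_functions[OF tiny_carriers(2,6)]) (unfold pseudonatural_def, blast, blast intro: Y.invertible_Cell)
  qed
qed

lemma tiny_modifications: "tiny {m. is_modification m}"
proof (rule tiny_inj)
  let ?S = "{m. is_modification m}" and ?T = "{t. pseudonatural t}"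
  show "inj_on (\<lambda>m. (md_src m, md_tgt m, md_obj m)) ?S" by (auto simp: inj_on_def)
  show "(\<lambda>m. (md_src m, md_tgt m, md_obj m)) ` ?S \<subseteq> ?T \<times> (?T \<times> (md_obj ` ?S))" by auto
  show "tiny (?T \<times> (?T \<times> (md_obj ` ?S)))"
  proof (intro tiny_Times tiny_transformations)
    show "tiny (md_obj ` ?S)"
      by (rule tiny_functions[OF tiny_carriers(1,6)]) (unfold is_modification_def, blast+)
  qed
qed

lemma tiny_exp_edges: "tiny exp_edges"
proof (rule tiny_subset)
  let ?d = "(\<lambda>r. fst (snd r)) ` exp_edges" and ?t = "(\<lambda>r. snd (snd r)) ` exp_edges"
  show "exp_edges \<subseteq> {t. pseudonatural t} \<times> (?d \<times> ?t)"
    by (rule subsetI) (simp add: mem_Times_iff)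
  show "tiny ({t. pseudonatural t} \<times> (?d \<times> ?t))"
  proof (intro tiny_Times tiny_transformations)
    show "tiny ?d"
      by (rule tiny_functions[OF tiny_edges[OF tiny_carriers(2)] tiny_edges[OF tiny_carriers(5)]])
        (auto simp: exp_edges_def)
    show "tiny ?t"
      by (rule tiny_functions[OF tiny_edges[OF tiny_carriers(2)] tiny_carriers(6)])
        (auto simp: exp_edges_def)
  qed
qed

lemma tiny_exponential: "tiny_two_category E.Paths"
proof (rule tiny_paths[OF E.path_graph_axioms _ tiny_exp_edges])
  show "tiny (Obj Trans)" using tiny_extensional_functors by simp
  have "Cell Trans = {m. is_modification m}" by (simp add: Trans_def)
  then show "tiny (Cell Trans)" using tiny_modifications by simp
qed

end

section \<open>The category of flexible 2-categories\<close>

text \<open>Products are unique up to an isomorphism compatible with the projections, so for each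
  \<open>z\<close> the universal property has to be checked for only one product of \<open>z\<close>
  and \<open>a\<close>.\<close>

lemma is_exponentialI:
  assumes C: "is_category C" and e: "e \<in> Obj C" and p: "is_product C e a p \<pi>1 \<pi>2" and ev: "ev \<in> Hom C p b"
    and univ: "\<And>z. z \<in> Obj C \<Longrightarrow> \<exists>q \<rho>1 \<rho>2. is_product C z a q \<rho>1 \<rho>2 \<and> (\<forall>f \<in> Hom C q b. \<exists>!h. h \<in> Hom C z e \<and>
       (\<exists>k \<in> Hom C q p. Comp C \<pi>1 k = Comp C h \<rho>1 \<and> Comp C \<pi>2 k = \<rho>2 \<and> Comp C ev k = f))"
  shows "is_exponential C a b e p \<pi>1 \<pi>2 ev"
  unfolding is_exponential_def
proof (intro conjI e p ev ballI allI impI)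
  interpret cat C using C by unfold_locales
  let ?T = "\<lambda>q \<rho>1 \<rho>2 h f. \<exists>k \<in> Hom C q p. Comp C \<pi>1 k = Comp C h \<rho>1 \<and> Comp C \<pi>2 k = \<rho>2 \<and> Comp C ev k = f"
  fix z q' \<sigma>1 \<sigma>2 f' assume z: "z \<in> Obj C" and q': "is_product C z a q' \<sigma>1 \<sigma>2" and f': "f' \<in> Hom C q' b"
  obtain q \<rho>1 \<rho>2 where q: "is_product C z a q \<rho>1 \<rho>2" and
    u: "\<forall>f \<in> Hom C q b. \<exists>!h. h \<in> Hom C z e \<and>
       (?T q \<rho>1 \<rho>2 h f)"
    using univ[OF z] by (elim exE conjE) (rule that)
  have qq: "q \<in> Obj C" "\<rho>1 \<in> Hom C q z" "\<rho>2 \<in> Hom C q a" "q' \<in> Obj C" "\<sigma>1 \<in> Hom C q' z" "\<sigma>2 \<in> Hom C q' a"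
    using q q' by (simp_all add: is_product_def)
  have "\<exists>i. i \<in> Hom C q q' \<and> Comp C \<sigma>1 i = \<rho>1 \<and> Comp C \<sigma>2 i = \<rho>2"
    using q' qq unfolding is_product_def by blast
  then obtain i where i: "i \<in> Hom C q q'" "Comp C \<sigma>1 i = \<rho>1" "Comp C \<sigma>2 i = \<rho>2" by blast
  have "\<exists>j. j \<in> Hom C q' q \<and> Comp C \<rho>1 j = \<sigma>1 \<and> Comp C \<rho>2 j = \<sigma>2"
    using q qq unfolding is_product_def by blast
  then obtain j where j: "j \<in> Hom C q' q" "Comp C \<rho>1 j = \<sigma>1" "Comp C \<rho>2 j = \<sigma>2" by blast
  have "\<exists>!h. h \<in> Hom C q' q' \<and> Comp C \<sigma>1 h = \<sigma>1 \<and> Comp C \<sigma>2 h = \<sigma>2"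
    using q' qq unfolding is_product_def by blast
  moreover have "Comp C i j \<in> Hom C q' q' \<and> Comp C \<sigma>1 (Comp C i j) = \<sigma>1 \<and> Comp C \<sigma>2 (Comp C i j) = \<sigma>2"
    using i j qq Comp_assoc[of j i \<sigma>1] Comp_assoc[of j i \<sigma>2] by (simp add: Hom_def del: Comp_assoc)
  moreover have "Idn C q' \<in> Hom C q' q' \<and> Comp C \<sigma>1 (Idn C q') = \<sigma>1 \<and> Comp C \<sigma>2 (Idn C q') = \<sigma>2"
    using qq by (simp add: Hom_def)
  ultimately have ij: "Comp C i j = Idn C q'" by blast
  have p': "\<pi>1 \<in> Hom C p e" "\<pi>2 \<in> Hom C p a" using p by (simp_all add: is_product_def)
  \<comment> \<open>Composition with \<open>j\<close> and with \<open>i\<close> turns witnesses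
    \<open>k\<close> for one product into witnesses for the other.\<close>
  have iff: "(?T q \<rho>1 \<rho>2 h (Comp C f' i)) \<longleftrightarrow>
    (?T q' \<sigma>1 \<sigma>2 h f')"
    if h: "h \<in> Hom C z e" for h
  proof
    assume "?T q \<rho>1 \<rho>2 h (Comp C f' i)"
    then obtain k where k: "k \<in> Hom C q p" "Comp C \<pi>1 k = Comp C h \<rho>1" "Comp C \<pi>2 k = \<rho>2" "Comp C ev k = Comp C f' i" by blast
    have "Comp C \<pi>1 (Comp C k j) = Comp C h \<sigma>1"
      using k j h p' qq Comp_assoc[of j k \<pi>1] by (simp add: Hom_def)
    moreover have "Comp C \<pi>2 (Comp C k j) = \<sigma>2"
      using k j p' Comp_assoc[of j k \<pi>2] by (simp add: Hom_def del: Comp_assoc)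
    moreover have "Comp C ev (Comp C k j) = f'"
      using k j ev f' i ij Comp_assoc[of j k ev] by (simp add: Hom_def)
    moreover have "Comp C k j \<in> Hom C q' p" using k j by (simp add: Hom_def)
    ultimately show "?T q' \<sigma>1 \<sigma>2 h f'" by blast
  next
    assume "?T q' \<sigma>1 \<sigma>2 h f'"
    then obtain k where k: "k \<in> Hom C q' p" "Comp C \<pi>1 k = Comp C h \<sigma>1" "Comp C \<pi>2 k = \<sigma>2" "Comp C ev k = f'" by blast
    have "Comp C \<pi>1 (Comp C k i) = Comp C h \<rho>1"
      using k i h p' qq Comp_assoc[of i k \<pi>1] by (simp add: Hom_def)
    moreover have "Comp C \<pi>2 (Comp C k i) = \<rho>2"
      using k i p' Comp_assoc[of i k \<pi>2] by (simp add: Hom_def del: Comp_assoc)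
    moreover have "Comp C ev (Comp C k i) = Comp C f' i"
      using k i ev Comp_assoc[of i k ev] by (simp add: Hom_def del: Comp_assoc)
    moreover have "Comp C k i \<in> Hom C q p" using k i by (simp add: Hom_def)
    ultimately show "?T q \<rho>1 \<rho>2 h (Comp C f' i)" by blast
  qed
  have "Comp C f' i \<in> Hom C q b" using f' i by (simp add: Hom_def)
  from bspec[OF u this] show "\<exists>!h. h \<in> Hom C z e \<and>
      (?T q' \<sigma>1 \<sigma>2 h f')"
    by (simp only: iff cong: conj_cong)
qed

section \<open>Arrows of \<open>Flex\<close> represented by 2-functors\<close>

definition arrow where
  "arrow X Y F = \<lparr>source = X, target = Y, on_obj = restrict (at_obj F) (Obj X),
     on_mor = restrict (at_mor F) (Mor X), on_cell = restrict (at_cell F) (Cell X)\<rparr>"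

lemma Obj_Flex: "X \<in> Obj Flex \<longleftrightarrow> flex X \<and> small_two_category X"
  by (simp add: Flex_def flex_iff)

lemma restrict_eq_iff: "restrict f A = restrict g A \<longleftrightarrow> (\<forall>x\<in>A. f x = g x)"
  by (auto simp: restrict_def fun_eq_iff)

lemma arrow_eq_iff: "arrow X Y F = arrow X Y G \<longleftrightarrow> agree X F G"
  by (simp add: arrow_def agree_def restrict_eq_iff)

lemma arrow_Hom:
  assumes "X \<in> Obj Flex" "Y \<in> Obj Flex" "flex_functor X Y F"
  shows "arrow X Y F \<in> Hom Flex X Y"
proof -
  have "flex_functor X Y \<lparr>at_obj = restrict (at_obj F) (Obj X), at_mor = restrict (at_mor F) (Mor X),
     at_cell = restrict (at_cell F) (Cell X)\<rparr>"
    using flex_functor.restrict_extensional_functors[OF assms(3)] by (simp add: extensional_functors_def)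
  then show ?thesis using assms(1,2)
    by (simp add: Hom_def arrow_def flex_functor_iff Obj_Flex) (simp add: Flex_def)
qed

lemma Hom_arrow:
  assumes "f \<in> Hom Flex X Y"
  obtains F where "flex_functor X Y F" "f = arrow X Y F"
proof -
  let ?F = "\<lparr>at_obj = on_obj f, at_mor = on_mor f, at_cell = on_cell f\<rparr>"
  have f: "source f = X" "target f = Y" using assms by (simp_all add: Hom_def Flex_def)
  have "flex_functor X Y ?F" using assms f by (auto simp: flex_functor_iff Hom_def Flex_def)
  moreover have "f = arrow X Y ?F"
    using assms f by (auto simp: arrow_def Hom_def Flex_def extensional_restrict intro!: flex_arrow.equality)
  ultimately show thesis by (rule that)
qed

lemma Comp_arrow:
  assumes "flex_functor X Y F"
  shows "Comp Flex (arrow Y Z G) (arrow X Y F) = arrow X Z (comp_map G F)"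
proof -
  interpret F: flex_functor X Y F by fact
  show ?thesis by (auto simp: Flex_def arrow_def compose_def restrict_def fun_eq_iff)
qed

lemma Idn_arrow: "Idn Flex X = arrow X X id_map"
  by (simp add: Flex_def arrow_def id_map_def)

lemma agree_refl: "agree X F F"
  and agree_sym: "agree X F G \<Longrightarrow> agree X G F"
  and agree_trans: "agree X F G \<Longrightarrow> agree X G H \<Longrightarrow> agree X F H"
  and agree_comp_left: "agree X F G \<Longrightarrow> agree X (comp_map W F) (comp_map W G)"
  by (simp_all add: agree_def)

lemma agree_comp_right:
  assumes "flex_functor X Y F" "agree Y G H"
  shows "agree X (comp_map G F) (comp_map H F)"
proof -
  interpret F: flex_functor X Y F by fact
  show ?thesis using assms(2) unfolding agree_def by simp
qed

lemma comp_map_assoc: "comp_map (comp_map H G) F = comp_map H (comp_map G F)"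
  by (simp add: comp_map_def)

lemma comp_map_id [simp]: "comp_map F id_map = F" "comp_map id_map F = F"
  by (simp_all add: comp_map_def id_map_def)

lemma agree_cong: "agree X F G \<Longrightarrow> agree X F H \<longleftrightarrow> agree X G H"
  using agree_sym agree_trans by blast

text \<open>An isomorphism is moved to the other side of an equation. In this way statements about
  copies in the universe reduce to statements about the original constructions.\<close>

lemma agree_inverse_left:
  assumes FG: "inverse_functors X T F G" and H: "flex_functor Z T H" and P: "flex_functor Z X P"
  shows "agree Z (comp_map G H) P \<longleftrightarrow> agree Z H (comp_map F P)"
proof -
  have "agree Z (comp_map F (comp_map G H)) H" "agree Z (comp_map G (comp_map F P)) P"
    using FG agree_comp_right[OF H, of "comp_map F G" id_map] agree_comp_right[OF P, of "comp_map G F" id_map]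
    by (simp_all add: inverse_functors_def comp_map_assoc)
  then show ?thesis using agree_comp_left agree_sym agree_trans by metis
qed

lemma agree_inverse_right:
  assumes FG: "inverse_functors X T F G"
  shows "agree T (comp_map A G) B \<longleftrightarrow> agree X A (comp_map B F)"
proof -
  have F: "flex_functor X T F" and G: "flex_functor T X G"
    and A: "agree X (comp_map (comp_map A G) F) A" and B: "agree T (comp_map (comp_map B F) G) B"
    using FG agree_comp_left[of X "comp_map G F" id_map A] agree_comp_left[of T "comp_map F G" id_map B]
    by (simp_all add: inverse_functors_def comp_map_assoc)
  show ?thesis
    using agree_comp_right[OF F, of "comp_map A G" B] agree_comp_right[OF G, of A "comp_map B F"]
      agree_trans[OF agree_sym[OF A]] agree_trans[OF _ B] by blast
qed

lemma is_category_Flex: "is_category Flex"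
proof -
  have o: "X \<in> Obj Flex \<and> Y \<in> Obj Flex" if "f \<in> Hom Flex X Y" for f X Y
    using that by (auto simp: Hom_def Flex_def)
  have H: "f \<in> Hom Flex (Dom Flex f) (Cod Flex f)" if "f \<in> Mor Flex" for f
    using that by (simp add: Hom_def)
  have i: "Idn Flex X \<in> Hom Flex X X" if "X \<in> Obj Flex" for X
    unfolding Idn_arrow by (rule arrow_Hom[OF that that flex_functor_id]) (use that in \<open>simp add: Obj_Flex\<close>)
  have c: "Comp Flex g f \<in> Hom Flex X Z" if f: "f \<in> Hom Flex X Y" and g: "g \<in> Hom Flex Y Z" for f g X Y Z
  proof -
    obtain F where F: "flex_functor X Y F" "f = arrow X Y F" using f by (rule Hom_arrow)
    obtain G where G: "flex_functor Y Z G" "g = arrow Y Z G" using g by (rule Hom_arrow)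
    show ?thesis unfolding F(2) G(2) Comp_arrow[OF F(1)]
      using o[OF f] o[OF g] by (intro arrow_Hom flex_functor_comp[OF F(1) G(1)]) auto
  qed
  have ir: "Comp Flex f (Idn Flex X) = f \<and> Comp Flex (Idn Flex Y) f = f" if f: "f \<in> Hom Flex X Y" for f X Y
  proof -
    obtain F where F: "flex_functor X Y F" "f = arrow X Y F" using f by (rule Hom_arrow)
    have "flex_functor X X id_map" using o[OF f] by (intro flex_functor_id) (simp add: Obj_Flex)
    then show ?thesis unfolding F(2) Idn_arrow by (simp add: Comp_arrow F(1))
  qed
  have a: "Comp Flex h (Comp Flex g f) = Comp Flex (Comp Flex h g) f"
    if f: "f \<in> Hom Flex W X" and g: "g \<in> Hom Flex X Y" and h: "h \<in> Hom Flex Y Z" for f g h W X Y Z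
  proof -
    obtain F where F: "flex_functor W X F" "f = arrow W X F" using f by (rule Hom_arrow)
    obtain G where G: "flex_functor X Y G" "g = arrow X Y G" using g by (rule Hom_arrow)
    obtain H where H: "flex_functor Y Z H" "h = arrow Y Z H" using h by (rule Hom_arrow)
    show ?thesis unfolding F(2) G(2) H(2)
      by (simp add: Comp_arrow F(1) G(1) flex_functor_comp[OF F(1) G(1)] comp_map_assoc)
  qed
  show ?thesis
    unfolding is_category_def
  proof (intro conjI ballI impI, goal_cases)
    case (1 f) then show ?case using o[OF H[OF 1]] by simp
  next
    case (2 f) then show ?case using o[OF H[OF 2]] by simp
  next
    case (3 x) then show ?case by (rule i)
  next
    case (4 f g) then show ?case using c[OF H[of f], of g "Cod Flex g"] H[of g] by simp
  next
    case (5 f) then show ?case using ir[OF H[of f]] by simp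
  next
    case (6 f) then show ?case using ir[OF H[of f]] by simp
  next
    case (7 f g h) then show ?case using a[OF H[of f], of g "Cod Flex g" h "Cod Flex h"] H[of g] H[of h] by simp
  qed
qed

text \<open>Compatibility with agreement does not require comparing the lifted paths: the
  projections of both sides agree, and uniqueness for products does the rest.\<close>

lemma times_agree:
  assumes "flex_functor Z W F" "flex_functor Z W F'" "flex X" "agree Z F F'"
  shows "agree (flex_prod Z X) (times_map X Z W F) (times_map X Z W F')"
proof -
  interpret F: product_map Z W F X using assms by (simp add: product_map_def)
  interpret F': product_map Z W F' X using assms by (simp add: product_map_def)
  show ?thesis
  proof (rule F.WX.product_unique[OF F.flex_functor_times F'.flex_functor_times])
    have "agree F.ZX.Paths (comp_map F (proj1 Z X)) (comp_map F' (proj1 Z X))"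
      by (rule agree_comp_right[OF F.ZX.flex_functor_proj1 assms(4)])
    then show "agree F.ZX.Paths (comp_map (proj1 W X) F.K) (comp_map (proj1 W X) F'.K)"
      by (rule agree_trans[OF F.proj_times(1) agree_trans[OF _ agree_sym[OF F'.proj_times(1)]]])
    show "agree F.ZX.Paths (comp_map (proj2 W X) F.K) (comp_map (proj2 W X) F'.K)"
      by (rule agree_trans[OF F.proj_times(2) agree_sym[OF F'.proj_times(2)]])
  qed
qed

lemma times_comp:
  assumes "flex_functor Z W F" "flex_functor W V G" "flex X"
  shows "agree (flex_prod Z X) (comp_map (times_map X W V G) (times_map X Z W F)) (times_map X Z V (comp_map G F))"
proof -
  interpret F: product_map Z W F X using assms by (simp add: product_map_def)
  interpret G: product_map W V G X using assms by (simp add: product_map_def)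
  interpret GF: product_map Z V "comp_map G F" X using assms flex_functor_comp by (simp add: product_map_def)
  show ?thesis
  proof (rule G.WX.product_unique[OF flex_functor_comp[OF F.flex_functor_times G.flex_functor_times] GF.flex_functor_times])
    have 1: "agree F.ZX.Paths (comp_map (comp_map (proj1 V X) G.K) F.K) (comp_map (comp_map G (proj1 W X)) F.K)"
      by (rule agree_comp_right[OF F.flex_functor_times G.proj_times(1)])
    have 2: "agree F.ZX.Paths (comp_map G (comp_map (proj1 W X) F.K)) (comp_map G (comp_map F (proj1 Z X)))"
      by (rule agree_comp_left[OF F.proj_times(1)])
    show "agree F.ZX.Paths (comp_map (proj1 V X) (comp_map G.K F.K)) (comp_map (proj1 V X) GF.K)"
      by (rule agree_trans[OF 1[unfolded comp_map_assoc] agree_trans[OF 2 agree_sym[OF GF.proj_times(1)[unfolded comp_map_assoc]]]])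
    have 3: "agree F.ZX.Paths (comp_map (comp_map (proj2 V X) G.K) F.K) (comp_map (proj2 W X) F.K)"
      by (rule agree_comp_right[OF F.flex_functor_times G.proj_times(2)])
    show "agree F.ZX.Paths (comp_map (proj2 V X) (comp_map G.K F.K)) (comp_map (proj2 V X) GF.K)"
      by (rule agree_trans[OF 3[unfolded comp_map_assoc] agree_trans[OF F.proj_times(2) agree_sym[OF GF.proj_times(2)]]])
  qed
qed

section \<open>Terminal object, products and exponentials in \<open>Flex\<close>\<close>

context universe
begin

lemma transport_universe:
  fixes X :: "('o, 'm, 'c) two_category"
  assumes "flex X" "tiny_two_category X"
  obtains T :: "('u, 'u, 'u) two_category" and F G where "T \<in> Obj Flex" "inverse_functors X T F G"
proof -
  obtain j0 :: "'o \<Rightarrow> 'u" and j1 :: "'m \<Rightarrow> 'u" and j2 :: "'c \<Rightarrow> 'u"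
    where j: "inj_on j0 (Obj X)" "inj_on j1 (Mor X)" "inj_on j2 (Cell X)"
    using assms(2) by (auto simp: tiny_two_category_def smaller_def lesspoll_def lepoll_def)
  have inv: "inverse_functors X (transport j0 j1 j2 X) \<lparr>at_obj = j0, at_mor = j1, at_cell = j2\<rparr>
    \<lparr>at_obj = inv_into (Obj X) j0, at_mor = inv_into (Mor X) j1, at_cell = inv_into (Cell X) j2\<rparr>"
    by (rule inverse_functors_transport[OF assms(1) j])
  have "small_two_category (transport j0 j1 j2 X)"
    using assms(2) j by (simp add: small_two_category_def transport_def Let_def small_def tiny_two_category_def smaller_def)
  moreover have "flex (transport j0 j1 j2 X)"
    using inv by (simp add: inverse_functors_def flex_functor_def)
  ultimately show thesis using that[OF _ inv] by (simp add: Obj_Flex)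
qed

lemma Flex_tiny:
  fixes X :: "('u, 'u, 'u) two_category"
  shows "X \<in> Obj Flex \<Longrightarrow> flex X" "X \<in> Obj Flex \<Longrightarrow> tiny_two_category X"
  by (simp_all add: Obj_Flex tiny_two_category_def small_two_category_def smaller_def small_def)

lemma terminal_Flex: "\<exists>t :: ('u, 'u, 'u) two_category. is_terminal Flex t"
proof -
  \<comment> \<open>Any element of the nonempty universe may serve as the only 0-cell, 1-cell and
    2-cell. As there are no atomic 1-cells, the empty decomposition is the only one.\<close>
  define c :: 'u where "c = undefined"
  define t :: "('u, 'u, 'u) two_category" where t: "t = \<lparr>Obj = {c}, Mor = {c}, Dom = (\<lambda>_. c), Cod = (\<lambda>_. c),
    Idn = (\<lambda>_. c), Comp = (\<lambda>_ _. c), Cell = {c}, Src = (\<lambda>_. c), Tgt = (\<lambda>_. c), CellId = (\<lambda>_. c),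
    VComp = (\<lambda>_ _. c), HComp = (\<lambda>_ _. c)\<rparr>"
  have "is_category t" by (simp add: is_category_def Hom_def t)
  then interpret t: two_cat t by (rule two_catI) (simp_all add: t)
  have "\<not> atomic t a" for a by (auto simp: atomic_def is_identity_def t)
  moreover have "composes_to t [] c" using composes_to.Nil[of c t] by (simp add: t)
  ultimately have "\<exists>!fs. (\<forall>a \<in> set fs. atomic t a) \<and> composes_to t fs f" if "f \<in> Mor t" for f
    using that by (intro ex1I[of _ "[]"]) (auto simp: t intro: hd_in_set)
  then interpret t: flex t
    by unfold_locales (use t.is_category in \<open>simp add: free_category_def\<close>)
  have "small_two_category t"
    using tiny_countable[of "{c}"] by (simp add: small_two_category_def small_def smaller_def t)
  then have tF: "t \<in> Obj Flex" using t.flex_axioms by (simp add: Obj_Flex)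
  have "\<exists>!f. f \<in> Hom Flex a t" if a: "a \<in> Obj Flex" for a
  proof (rule ex1I)
    have "flex_functor a t (const_map t c)"
      by (rule flex_functor_const) (use a t.flex_axioms in \<open>simp_all add: Obj_Flex t\<close>)
    then show "arrow a t (const_map t c) \<in> Hom Flex a t" by (rule arrow_Hom[OF a tF])
    fix f assume "f \<in> Hom Flex a t"
    then obtain F where F: "flex_functor a t F" "f = arrow a t F" by (rule Hom_arrow)
    interpret F: flex_functor a t F by (rule F(1))
    show "f = arrow a t (const_map t c)"
      unfolding F(2) arrow_eq_iff agree_def
      using F.at_obj_Obj F.at_mor_Mor F.at_cell_Cell by (simp add: t)
  qed
  then show ?thesis using tF unfolding is_terminal_def by blast
qed

text \<open>The two equations for the projections of the copy \<open>T\<close> are condensed into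
  agreement with \<open>F\<close> after a mediating \<open>P\<close>; existence and uniqueness can
  both be read off this equivalence.\<close>

lemma product_arrow_iff:
  assumes "flex X" "flex Y" and FG: "inverse_functors (flex_prod X Y) T F G"
    and H: "flex_functor Z T H" and P: "flex_functor Z (flex_prod X Y) P"
    and A: "agree Z (comp_map (proj1 X Y) P) A" and B: "agree Z (comp_map (proj2 X Y) P) B"
  shows "Comp Flex (arrow T X (comp_map (proj1 X Y) G)) (arrow Z T H) = arrow Z X A \<and>
    Comp Flex (arrow T Y (comp_map (proj2 X Y) G)) (arrow Z T H) = arrow Z Y B \<longleftrightarrow>
    agree Z H (comp_map F P)"
proof -
  interpret flex_product X Y using assms(1,2) by (simp add: flex_product_def)
  have "flex_functor T Paths G" using FG by (simp add: inverse_functors_def)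
  from product_unique[OF flex_functor_comp[OF H this] P] show ?thesis
    unfolding Comp_arrow[OF H] arrow_eq_iff comp_map_assoc agree_inverse_left[OF FG H P, symmetric]
    using agree_trans[OF _ agree_sym[OF A]] agree_trans[OF _ agree_sym[OF B]]
      agree_trans[OF agree_comp_left A] agree_trans[OF agree_comp_left B] by blast
qed

lemma product_Flex:
  fixes X Y T :: "('u, 'u, 'u) two_category"
  assumes X: "X \<in> Obj Flex" and Y: "Y \<in> Obj Flex" and T: "T \<in> Obj Flex"
    and FG: "inverse_functors (flex_prod X Y) T F G"
  shows "is_product Flex X Y T (arrow T X (comp_map (proj1 X Y) G)) (arrow T Y (comp_map (proj2 X Y) G))"
    (is "is_product Flex X Y T ?\<pi>1 ?\<pi>2")
proof -
  interpret flex_product X Y using Flex_tiny[OF X] Flex_tiny[OF Y] by (simp add: flex_product_def)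
  have F: "flex_functor Paths T F" and G: "flex_functor T Paths G"
    using FG by (simp_all add: inverse_functors_def)
  have "\<exists>!h. h \<in> Hom Flex Z T \<and> Comp Flex ?\<pi>1 h = f \<and> Comp Flex ?\<pi>2 h = g"
    if Z: "Z \<in> Obj Flex" and f: "f \<in> Hom Flex Z X" and g: "g \<in> Hom Flex Z Y" for Z f g
  proof -
    obtain A where A: "flex_functor Z X A" "f = arrow Z X A" using f by (rule Hom_arrow)
    obtain B where B: "flex_functor Z Y B" "g = arrow Z Y B" using g by (rule Hom_arrow)
    note P = flex_functor_pairing[OF A(1) B(1)]
    note iff = product_arrow_iff[OF X.flex_axioms Y.flex_axioms FG _ P proj_pairing[OF A(1) B(1)], folded A(2) B(2)]
    note FP = flex_functor_comp[OF P F]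
    show ?thesis
    proof (rule ex1I)
      show "arrow Z T (comp_map F (pairing X Y Z A B)) \<in> Hom Flex Z T \<and>
          Comp Flex ?\<pi>1 (arrow Z T (comp_map F (pairing X Y Z A B))) = f \<and>
          Comp Flex ?\<pi>2 (arrow Z T (comp_map F (pairing X Y Z A B))) = g"
        using iff[OF FP] agree_refl arrow_Hom[OF Z T FP] by blast
      fix h assume h: "h \<in> Hom Flex Z T \<and> Comp Flex ?\<pi>1 h = f \<and> Comp Flex ?\<pi>2 h = g"
      then obtain H where H: "flex_functor Z T H" "h = arrow Z T H" using Hom_arrow by blast
      then show "h = arrow Z T (comp_map F (pairing X Y Z A B))"
        using h iff[OF H(1)] arrow_eq_iff by blast
    qed
  qed
  then show ?thesis
    unfolding is_product_def
    using T arrow_Hom[OF T X flex_functor_comp[OF G flex_functor_proj1]]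
      arrow_Hom[OF T Y flex_functor_comp[OF G flex_functor_proj2]] by blast
qed

lemma exponential_Flex:
  fixes X Y :: "('u, 'u, 'u) two_category"
  assumes X: "X \<in> Obj Flex" and Y: "Y \<in> Obj Flex"
  shows "\<exists>e p \<pi>1 \<pi>2 ev. is_exponential Flex X Y e p \<pi>1 \<pi>2 ev"
proof -
  interpret small_functors U X Y
    using Flex_tiny[OF X] Flex_tiny[OF Y] universe_axioms
    by (simp add: small_functors_def functors_def small_functors_axioms_def)
  have products: thesis if z: "z \<in> Obj Flex" and
    *: "\<And>(q :: ('u, 'u, 'u) two_category) F G. q \<in> Obj Flex \<Longrightarrow> inverse_functors (flex_prod z X) q F G \<Longrightarrow> thesis"
    for z :: "('u, 'u, 'u) two_category" and thesis
  proof -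
    interpret zX: flex_product z X using Flex_tiny(1)[OF z] X.flex_axioms by (simp add: flex_product_def)
    show thesis
      by (rule transport_universe[OF zX.flex_prod tiny_flex_prod[OF Flex_tiny(1)[OF z] X.flex_axioms Flex_tiny(2)[OF z] tiny_X]])
        (rule *)
  qed
  obtain e :: "('u, 'u, 'u) two_category" and F G where e: "e \<in> Obj Flex" and FG: "inverse_functors E.Paths e F G"
    by (rule transport_universe[OF E.P.flex_axioms tiny_exponential])
  have F: "flex_functor E.Paths e F" and G: "flex_functor e E.Paths G"
    using FG by (simp_all add: inverse_functors_def)
  interpret G: product_map e E.Paths G X using G X.flex_axioms by (simp add: product_map_def)
  obtain p :: "('u, 'u, 'u) two_category" and F' G' where p: "p \<in> Obj Flex"
    and FG': "inverse_functors (flex_prod e X) p F' G'" using products[OF e] .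
  have F': "flex_functor (flex_prod e X) p F'" and G': "flex_functor p (flex_prod e X) G'"
    using FG' by (simp_all add: inverse_functors_def)
  \<comment> \<open>Evaluation starts at the product with the original exponential; the product of
    \<open>G\<close> with \<open>X\<close> leads there from the product with the copy
    \<open>e\<close>.\<close>
  let ?ev = "comp_map ev (times_map X e E.Paths G)"
  let ?\<pi>1 = "arrow p e (comp_map (proj1 e X) G')" and ?\<pi>2 = "arrow p X (comp_map (proj2 e X) G')"
  let ?E = "arrow p Y (comp_map ?ev G')"
  have E: "?E \<in> Hom Flex p Y"
    by (rule arrow_Hom[OF p Y flex_functor_comp[OF G' flex_functor_comp[OF G.flex_functor_times flex_functor_ev]]])
  have "is_exponential Flex X Y e p ?\<pi>1 ?\<pi>2 ?E"
  proof (rule is_exponentialI[OF is_category_Flex e product_Flex[OF e X p FG'] E])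
    fix z :: "('u, 'u, 'u) two_category" assume z: "z \<in> Obj Flex"
    interpret zX: flex_product z X using Flex_tiny(1)[OF z] X.flex_axioms by (simp add: flex_product_def)
    obtain q :: "('u, 'u, 'u) two_category" and F'' G'' where q: "q \<in> Obj Flex"
      and FG'': "inverse_functors (flex_prod z X) q F'' G''" using products[OF z] .
    have F'': "flex_functor (flex_prod z X) q F''" and G'': "flex_functor q (flex_prod z X) G''"
      using FG'' by (simp_all add: inverse_functors_def)
    let ?\<rho>1 = "arrow q z (comp_map (proj1 z X) G'')" and ?\<rho>2 = "arrow q X (comp_map (proj2 z X) G'')"
    let ?T = "\<lambda>h f. \<exists>k \<in> Hom Flex q p. Comp Flex ?\<pi>1 k = Comp Flex h ?\<rho>1 \<and> Comp Flex ?\<pi>2 k = ?\<rho>2 \<and> Comp Flex ?E k = f"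
    \<comment> \<open>This removes all copies: the condition on an arrow into \<open>e\<close>
      becomes an equation between morphisms out of \<open>flex_prod z X\<close>, to which existence
      and uniqueness of transposes apply.\<close>
    have key: "?T (arrow z e H) (arrow q Y f) \<longleftrightarrow>
      agree (flex_prod z X) (comp_map ev (times_map X z E.Paths (comp_map G H))) (comp_map f F'')"
      if H: "flex_functor z e H" and f: "flex_functor q Y f" for H f
    proof -
      interpret H: product_map z e H X using H X.flex_axioms by (simp add: product_map_def)
      \<comment> \<open>The morphism \<open>H \<times> X\<close> read between the copies
        \<open>q\<close> and \<open>p\<close>, that is, \<open>times_map\<close> framed by the
        isomorphisms; by \<open>uniq\<close> it is the only one with the required
        projections.\<close>
      define k where "k = comp_map F' (comp_map (times_map X z e H) G'')"
      have tG: "flex_functor q (flex_prod e X) (comp_map (times_map X z e H) G'')"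
        by (rule flex_functor_comp[OF G'' H.flex_functor_times])
      have k: "flex_functor q p k" unfolding k_def by (rule flex_functor_comp[OF tG F'])
      have uniq: "Comp Flex ?\<pi>1 (arrow q p k') = Comp Flex (arrow z e H) ?\<rho>1 \<and> Comp Flex ?\<pi>2 (arrow q p k') = ?\<rho>2 \<longleftrightarrow>
          agree q k' k" if k': "flex_functor q p k'" for k'
        unfolding Comp_arrow[OF flex_functor_comp[OF G'' zX.flex_functor_proj1]] k_def
        using agree_comp_right[OF G'' H.proj_times(1)] agree_comp_right[OF G'' H.proj_times(2)]
        by (intro product_arrow_iff[OF Flex_tiny(1)[OF e] X.flex_axioms FG' k' tG]) (simp_all add: comp_map_assoc)
      have "?T (arrow z e H) (arrow q Y f) \<longleftrightarrow> Comp Flex ?E (arrow q p k) = arrow q Y f"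
      proof
        assume "?T (arrow z e H) (arrow q Y f)"
        then obtain l where l: "l \<in> Hom Flex q p" "Comp Flex ?\<pi>1 l = Comp Flex (arrow z e H) ?\<rho>1" "Comp Flex ?\<pi>2 l = ?\<rho>2"
          "Comp Flex ?E l = arrow q Y f" by blast
        obtain k' where k': "flex_functor q p k'" "l = arrow q p k'" using l(1) by (rule Hom_arrow)
        then have "l = arrow q p k" using uniq[OF k'(1)] l(2,3) by (simp add: arrow_eq_iff)
        then show "Comp Flex ?E (arrow q p k) = arrow q Y f" using l(4) by simp
      next
        assume "Comp Flex ?E (arrow q p k) = arrow q Y f"
        then show "?T (arrow z e H) (arrow q Y f)"
          using arrow_Hom[OF q p k] uniq[OF k] agree_refl by blast
      qed
      also have "\<dots> \<longleftrightarrow> agree q (comp_map ?ev (comp_map G' k)) f"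
        unfolding Comp_arrow[OF k] arrow_eq_iff comp_map_assoc ..
      also have "\<dots> \<longleftrightarrow> agree q (comp_map (comp_map ?ev (times_map X z e H)) G'') f"
        using agree_comp_left[OF agree_inverse_left[OF FG' k tG, THEN iffD2], of ?ev]
        by (intro agree_cong) (simp add: k_def comp_map_assoc agree_refl)
      also have "\<dots> \<longleftrightarrow> agree (flex_prod z X) (comp_map ?ev (times_map X z e H)) (comp_map f F'')"
        by (rule agree_inverse_right[OF FG''])
      also have "\<dots> \<longleftrightarrow> agree (flex_prod z X) (comp_map ev (times_map X z E.Paths (comp_map G H))) (comp_map f F'')"
        unfolding comp_map_assoc by (rule agree_cong[OF agree_comp_left[OF times_comp[OF H G X.flex_axioms]]])
      finally show ?thesis .
    qed
    have "\<exists>!h. h \<in> Hom Flex z e \<and> ?T h f" if f: "f \<in> Hom Flex q Y" for f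
    proof -
      obtain A where A: "flex_functor q Y A" "f = arrow q Y A" using f by (rule Hom_arrow)
      obtain h where h: "flex_functor z E.Paths h"
        "agree (flex_prod z X) (comp_map ev (times_map X z E.Paths h)) (comp_map A F'')"
        using exponential_exists[OF zX.X.flex_axioms flex_functor_comp[OF F'' A(1)]] by blast
      have Fh: "flex_functor z e (comp_map F h)" by (rule flex_functor_comp[OF h(1) F])
      \<comment> \<open>One direction is uniqueness of transposes, the other the compatibility of
        \<open>times_map\<close> with agreement.\<close>
      have iff: "?T (arrow z e H) f \<longleftrightarrow> agree z H (comp_map F h)" if H: "flex_functor z e H" for H
      proof -
        note GH = flex_functor_comp[OF H G]
        show ?thesis
          unfolding A(2) key[OF H A(1)] agree_inverse_left[OF FG H h(1), symmetric]
          using exponential_unique[OF GH h(1)] agree_trans[OF _ agree_sym[OF h(2)]]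
            agree_trans[OF agree_comp_left[OF times_agree[OF GH h(1) X.flex_axioms]] h(2)] by blast
      qed
      show ?thesis
      proof (rule ex1I)
        show "arrow z e (comp_map F h) \<in> Hom Flex z e \<and> ?T (arrow z e (comp_map F h)) f"
          using iff[OF Fh] agree_refl arrow_Hom[OF z e Fh] by blast
        fix l assume l: "l \<in> Hom Flex z e \<and> ?T l f"
        then have "l \<in> Hom Flex z e" by blast
        then obtain H where H: "flex_functor z e H" "l = arrow z e H" by (rule Hom_arrow)
        then show "l = arrow z e (comp_map F h)"
          using l iff[OF H(1)] by (simp only: arrow_eq_iff)
      qed
    qed
    then show "\<exists>q \<rho>1 \<rho>2. is_product Flex z X q \<rho>1 \<rho>2 \<and> (\<forall>f \<in> Hom Flex q Y. \<exists>!h. h \<in> Hom Flex z e \<and>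
       (\<exists>k \<in> Hom Flex q p. Comp Flex ?\<pi>1 k = Comp Flex h \<rho>1 \<and> Comp Flex ?\<pi>2 k = \<rho>2 \<and> Comp Flex ?E k = f))"
      using product_Flex[OF z X q FG''] by (intro exI conjI ballI)
  qed
  then show ?thesis by blast
qed

lemma cartesian_closed_Flex: "cartesian_closed (Flex :: (('u, 'u, 'u) two_category, 'u flex_arrow) category)"
  unfolding cartesian_closed_def
proof (intro conjI ballI is_category_Flex terminal_Flex exponential_Flex)
  fix X Y :: "('u, 'u, 'u) two_category" assume X: "X \<in> Obj Flex" and Y: "Y \<in> Obj Flex"
  interpret flex_product X Y using Flex_tiny[OF X] Flex_tiny[OF Y] by (simp add: flex_product_def)
  obtain T :: "('u, 'u, 'u) two_category" and F G where T: "T \<in> Obj Flex" and FG: "inverse_functors (flex_prod X Y) T F G"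
    by (rule transport_universe[OF flex_prod tiny_flex_prod[OF Flex_tiny(1)[OF X] Flex_tiny(1)[OF Y] Flex_tiny(2)[OF X] Flex_tiny(2)[OF Y]]])
  show "\<exists>p \<pi>1 \<pi>2. is_product Flex X Y p \<pi>1 \<pi>2"
    using product_Flex[OF X Y T FG] by blast
qed

end

theorem proposition7p11:
  assumes "is_universe TYPE('u)"
  shows "cartesian_closed (Flex :: (('u, 'u, 'u) two_category, 'u flex_arrow) category)"
proof -
  interpret universe "TYPE('u)" using assms by unfold_locales
  show ?thesis by (rule cartesian_closed_Flex)
qed

end
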